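(* Let $D$ be an integral domain that is not a field and consider the following conditions: (1) $D[X]$ is Clifford $w$-regular; (2) $\mathrm{Na}(D,v)$ is Clifford regular; (3) $D[X]$ has $t$-finite character and $D_M(X)$ is Clifford regular for each $M\in t\text{-Max}(D)$. Then (1) implies (2), and (2) implies (3). Moreover, if $D$ is integrally closed or $D[X]$ is weakly Matlis, then (3) implies (1), and (3) implies that $D$ is Clifford $w$-regular.
   Context: For an integral domain $D$ with field of fractions $K$, "ideal" means fractional ideal, an integral ideal is an ideal contained in $D$, and $\mathcal{F}(D)$ is the set of nonzero ideals. For ideals $I,J$, $(J:I)=\{x\in K: xI\subseteq J\}$. For $I\in\mathcal F(D)$: $I^v=(D:(D:I))$; $I^t=\bigcup\{J^v: J\in\mathcal F(D)\text{ finitely generated}, J\subseteq I\}$; $I$ is a $t$-ideal if $I=I^t$; a $t$-prime is a (nonzero) prime $t$-ideal; a $t$-maximal ideal is an ideal maximal among the proper integral $t$-ideals (it is prime), and $t\text{-Max}(D)$ is the set of these; $I^w=\bigcap_{M\in t\text{-Max}(D)}ID_M$, equivalently $I^w=\bigcup\{(I:J): J\text{ finitely generated},(D:J)=D\}$. These are defined for every domain (e.g. $D[X]$). $D$ has $t$-finite character if each nonzero element lies in at most finitely many $t$-maximal ideals. $D$ is weakly Matlis if it has $t$-finite character and each $t$-prime ideal is contained in a unique $t$-maximal ideal. $I\in\mathcal F(D)$ is vN-regular if $I=I^2J$ for some nonzero ideal $J$; $D$ is Clifford regular if every nonzero ideal is vN-regular. $I$ is $w$-regular if $I^w=(I^2J)^w$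 for some nonzero ideal $J$; $D$ is Clifford $w$-regular if every nonzero ideal is $w$-regular. $X$ is an indeterminate, $c(h)$ is the ideal of $D$ generated by the coefficients of $h\in D[X]$. $\mathrm{Na}(D,v)=D[X]_{N(v)}$ with $N(v)=\{h\in D[X]: h\neq0,\ c(h)^v=D\}$. For a domain $R$, the Nagata ring is $R(X)=R[X]_S$ with $S=\{h\in R[X]: c(h)=R\}$; $D_M(X)$ is the Nagata ring of the localization $D_M$. *)

theory Defs
  imports
    "HOL-Computational_Algebra.Polynomial"
    "HOL-Computational_Algebra.Polynomial_Factorial"
begin

text \<open>
  An integral domain is represented as a subring \<open>R\<close> of a field type \<open>'k\<close> such that every element
  of \<open>'k\<close> is a quotient of elements of \<open>R\<close>; thus \<open>'k\<close> is the field of fractions of \<open>R\<close>, and every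
  integral domain occurs in this form up to isomorphism. All rings below (localizations,
  polynomial rings, Nagata rings) are again of this form: localizations have the same field
  of fractions \<open>'k\<close>, and \<open>R[X]\<close> and its localizations live in \<open>'k(X)\<close>, which is the type
  \<open>'k poly fract\<close>. The definitions depending on the field of fractions are meant for such \<open>R\<close> only.
\<close>

definition subdomain :: "'k::field set \<Rightarrow> bool" where
  "subdomain R \<longleftrightarrow> 1 \<in> R \<and> (\<forall>x\<in>R. \<forall>y\<in>R. x - y \<in> R \<and> x * y \<in> R)"

definition domain_with_fraction_field :: "'k::field set \<Rightarrow> bool" where
  "domain_with_fraction_field R \<longleftrightarrow> subdomain R \<and> (\<forall>x. \<exists>a\<in>R. \<exists>b\<in>R. b \<noteq> 0 \<and> x = a / b)"

definition subfield :: "'k::field set \<Rightarrow> bool" where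
  "subfield R \<longleftrightarrow> subdomain R \<and> (\<forall>x\<in>R. x \<noteq> 0 \<longrightarrow> inverse x \<in> R)"

definition integrally_closed :: "'k::field set \<Rightarrow> bool" where
  "integrally_closed R \<longleftrightarrow>
     (\<forall>x. (\<exists>p. lead_coeff p = 1 \<and> (\<forall>i. coeff p i \<in> R) \<and> poly p x = 0) \<longrightarrow> x \<in> R)"


subsection \<open>Fractional ideals\<close>

definition is_submodule :: "'k::field set \<Rightarrow> 'k set \<Rightarrow> bool" where
  "is_submodule R I \<longleftrightarrow>
     0 \<in> I \<and> (\<forall>x\<in>I. \<forall>y\<in>I. x + y \<in> I) \<and> (\<forall>r\<in>R. \<forall>x\<in>I. r * x \<in> I)"

definition is_ideal :: "'k::field set \<Rightarrow> 'k set \<Rightarrow> bool" where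
  "is_ideal R I \<longleftrightarrow> is_submodule R I \<and> (\<exists>d\<in>R. d \<noteq> 0 \<and> (\<forall>x\<in>I. d * x \<in> R))"

definition nz_ideals :: "'k::field set \<Rightarrow> 'k set set" where
  "nz_ideals R = {I. is_ideal R I \<and> I \<noteq> {0}}"

definition finitely_generated :: "'k::field set \<Rightarrow> 'k set \<Rightarrow> bool" where
  "finitely_generated R I \<longleftrightarrow> (\<exists>A. finite A \<and> I = is_submodule R hull A)"

definition ideal_mult :: "'k::field set \<Rightarrow> 'k set \<Rightarrow> 'k set \<Rightarrow> 'k set" where
  "ideal_mult R I J = is_submodule R hull {x * y | x y. x \<in> I \<and> y \<in> J}"

definition ideal_quot :: "'k::field set \<Rightarrow> 'k set \<Rightarrow> 'k set" where
  "ideal_quot J I = {x. \<forall>y\<in>I. x * y \<in> J}"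

definition is_prime :: "'k::field set \<Rightarrow> 'k set \<Rightarrow> bool" where
  "is_prime R P \<longleftrightarrow>
     is_ideal R P \<and> P \<subset> R \<and> (\<forall>a\<in>R. \<forall>b\<in>R. a * b \<in> P \<longrightarrow> a \<in> P \<or> b \<in> P)"


subsection \<open>Localizations and polynomial rings\<close>

definition fractions :: "'k::field set \<Rightarrow> 'k set \<Rightarrow> 'k set" where
  "fractions R S = {a / s | a s. a \<in> R \<and> s \<in> S}"

definition localization :: "'k::field set \<Rightarrow> 'k set \<Rightarrow> 'k set" where
  "localization R P = fractions R (R - P)"

definition polys_over :: "'k::field set \<Rightarrow> 'k poly set" where
  "polys_over R = {h. \<forall>i. coeff h i \<in> R}"

definition poly_ring :: "'k::field set \<Rightarrow> 'k poly fract set" where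
  "poly_ring R = to_fract ` polys_over R"

definition content_ideal :: "'k::field set \<Rightarrow> 'k poly \<Rightarrow> 'k set" where
  "content_ideal R h = is_submodule R hull (range (coeff h))"

definition Nagata_ring :: "'k::field set \<Rightarrow> 'k poly fract set" where
  "Nagata_ring R =
     fractions (poly_ring R) (to_fract ` {h \<in> polys_over R. content_ideal R h = R})"


subsection \<open>The operations \<open>v\<close>, \<open>t\<close> and \<open>w\<close>\<close>

definition v_op :: "'k::field set \<Rightarrow> 'k set \<Rightarrow> 'k set" where
  "v_op R I = ideal_quot R (ideal_quot R I)"

definition t_op :: "'k::field set \<Rightarrow> 'k set \<Rightarrow> 'k set" where
  "t_op R I = \<Union> {v_op R J | J. J \<in> nz_ideals R \<and> finitely_generated R J \<and> J \<subseteq> I}"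

definition t_ideal :: "'k::field set \<Rightarrow> 'k set \<Rightarrow> bool" where
  "t_ideal R I \<longleftrightarrow> I \<in> nz_ideals R \<and> t_op R I = I"

definition t_prime :: "'k::field set \<Rightarrow> 'k set \<Rightarrow> bool" where
  "t_prime R P \<longleftrightarrow> is_prime R P \<and> t_ideal R P"

definition t_Max :: "'k::field set \<Rightarrow> 'k set set" where
  "t_Max R = {M. t_ideal R M \<and> M \<subset> R \<and> (\<forall>N. t_ideal R N \<and> N \<subset> R \<and> M \<subseteq> N \<longrightarrow> N = M)}"

text \<open>Here \<open>is_submodule (localization R M) hull I\<close> is the extension \<open>I R\<^sub>M\<close>.\<close>

definition w_op :: "'k::field set \<Rightarrow> 'k set \<Rightarrow> 'k set" where
  "w_op R I = (\<Inter>M\<in>t_Max R. is_submodule (localization R M) hull I)"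

definition t_finite_character :: "'k::field set \<Rightarrow> bool" where
  "t_finite_character R \<longleftrightarrow> (\<forall>x\<in>R. x \<noteq> 0 \<longrightarrow> finite {M \<in> t_Max R. x \<in> M})"

definition weakly_Matlis :: "'k::field set \<Rightarrow> bool" where
  "weakly_Matlis R \<longleftrightarrow>
     t_finite_character R \<and> (\<forall>P. t_prime R P \<longrightarrow> (\<exists>!M. M \<in> t_Max R \<and> P \<subseteq> M))"

definition Na_v :: "'k::field set \<Rightarrow> 'k poly fract set" where
  "Na_v R =
     fractions (poly_ring R)
       (to_fract ` {h \<in> polys_over R. h \<noteq> 0 \<and> v_op R (content_ideal R h) = R})"


subsection \<open>Regularity\<close>

definition vN_regular :: "'k::field set \<Rightarrow> 'k set \<Rightarrow> bool" where
  "vN_regular R I \<longleftrightarrow> (\<exists>J\<in>nz_ideals R. I = ideal_mult R (ideal_mult R I I) J)"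

definition Clifford_regular :: "'k::field set \<Rightarrow> bool" where
  "Clifford_regular R \<longleftrightarrow> (\<forall>I\<in>nz_ideals R. vN_regular R I)"

definition w_regular :: "'k::field set \<Rightarrow> 'k set \<Rightarrow> bool" where
  "w_regular R I \<longleftrightarrow>
     (\<exists>J\<in>nz_ideals R. w_op R I = w_op R (ideal_mult R (ideal_mult R I I) J))"

definition Clifford_w_regular :: "'k::field set \<Rightarrow> bool" where
  "Clifford_w_regular R \<longleftrightarrow> (\<forall>I\<in>nz_ideals R. w_regular R I)"


subsection \<open>The rings involved have the expected fields of fractions\<close>

lemma domain_with_fraction_field_range_to_fract:
  "domain_with_fraction_field (range (to_fract :: 'a::idom \<Rightarrow> 'a fract))"
proof -
  have "\<exists>a b. to_fract b \<noteq> 0 \<and> x = to_fract a / to_fract b" for x :: "'a fract"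
    by (cases x) (auto simp: to_fract_def Zero_fract_def eq_fract)
  then show ?thesis
    unfolding domain_with_fraction_field_def subdomain_def
    by (auto simp flip: to_fract_1 to_fract_diff to_fract_mult)
qed

lemma domain_with_fraction_field_fractions:
  assumes R: "domain_with_fraction_field R" and S: "S \<subseteq> R" "0 \<notin> S" "1 \<in> S"
    and mult: "\<And>s t. s \<in> S \<Longrightarrow> t \<in> S \<Longrightarrow> s * t \<in> S"
  shows "domain_with_fraction_field (fractions R S)"
proof -
  have sub: "subdomain R" using R by (simp add: domain_with_fraction_field_def)
  have RS: "R \<subseteq> fractions R S"
    unfolding fractions_def using S by force
  have cl: "x - y \<in> fractions R S \<and> x * y \<in> fractions R S"
    if "x \<in> fractions R S" "y \<in> fractions R S" for x y
  proof -
    from that obtain a s b t where *: "x = a / s" "y = b / t" "a \<in> R" "b \<in> R" "s \<in> S" "t \<in> S"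
      unfolding fractions_def by blast
    then have nz: "s \<noteq> 0" "t \<noteq> 0" using S by auto
    have "x - y = (a * t - b * s) / (s * t)" "x * y = (a * b) / (s * t)"
      using * nz by (simp_all add: field_simps)
    moreover have "a * t - b * s \<in> R" "a * b \<in> R" "s * t \<in> S"
      using * sub S mult unfolding subdomain_def by blast+
    ultimately show ?thesis unfolding fractions_def by blast
  qed
  show ?thesis
    using R RS cl unfolding domain_with_fraction_field_def subdomain_def by (meson subsetD)
qed

lemma subdomain_zero_add:
  assumes "subdomain R"
  shows "0 \<in> R" and "x \<in> R \<Longrightarrow> y \<in> R \<Longrightarrow> x + y \<in> R"
proof -
  show z: "0 \<in> R" using assms unfolding subdomain_def by (metis diff_self)
  assume "x \<in> R" "y \<in> R"
  then have "x - (0 - y) \<in> R" using assms z unfolding subdomain_def by blast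
  then show "x + y \<in> R" by simp
qed

lemma common_denominator:
  assumes R: "domain_with_fraction_field R"
  shows "\<exists>d\<in>R. d \<noteq> 0 \<and> smult d p \<in> polys_over R"
proof (induction p)
  case 0
  have "1 \<in> R" "0 \<in> R"
    using R subdomain_zero_add(1) by (auto simp: domain_with_fraction_field_def subdomain_def)
  then show ?case by (intro bexI[of _ 1]) (auto simp: polys_over_def)
next
  case (pCons a p)
  then obtain d where d: "d \<in> R" "d \<noteq> 0" "\<And>i. d * coeff p i \<in> R" by (auto simp: polys_over_def)
  obtain x b where b: "x \<in> R" "b \<in> R" "b \<noteq> 0" "a = x / b"
    using R unfolding domain_with_fraction_field_def by blast
  have mul: "u * v \<in> R" if "u \<in> R" "v \<in> R" for u v
    using R that by (simp add: domain_with_fraction_field_def subdomain_def)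
  have "b * d * coeff (pCons a p) i \<in> R" for i
  proof (cases i)
    case 0
    then have "b * d * coeff (pCons a p) i = x * d" using b by (simp add: field_simps)
    then show ?thesis using mul[OF b(1) d(1)] by (simp only:)
  next
    case (Suc j)
    then show ?thesis using mul[OF b(2) d(3)[of j]] by (simp add: mult.assoc)
  qed
  then have "smult (b * d) (pCons a p) \<in> polys_over R"
    unfolding polys_over_def mem_Collect_eq coeff_smult by blast
  then show ?case using b d mul by (intro bexI[of _ "b * d"]) simp_all
qed

lemma domain_with_fraction_field_poly_ring:
  assumes R: "domain_with_fraction_field R"
  shows "domain_with_fraction_field (poly_ring R)"
proof -
  have sub: "subdomain R" using R by (simp add: domain_with_fraction_field_def)
  have sum_in: "(\<Sum>i\<in>A. f i) \<in> R" if "\<And>i. f i \<in> R" for f :: "nat \<Rightarrow> 'a" and A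
    using that by (induction A rule: infinite_finite_induct) (auto simp: subdomain_zero_add[OF sub])
  have polys: "1 \<in> polys_over R"
    "\<And>p q. p \<in> polys_over R \<Longrightarrow> q \<in> polys_over R \<Longrightarrow> p - q \<in> polys_over R \<and> p * q \<in> polys_over R"
    using sub subdomain_zero_add(1)[OF sub]
    by (auto simp: polys_over_def subdomain_def coeff_mult coeff_1 intro!: sum_in)
  have "\<exists>a\<in>poly_ring R. \<exists>b\<in>poly_ring R. b \<noteq> 0 \<and> x = a / b" for x
  proof -
    obtain p q where pq: "x = Fraction_Field.Fract p q" "q \<noteq> 0" by (cases x)
    obtain d where d: "d \<in> R" "d \<noteq> 0" "smult d p \<in> polys_over R"
      using common_denominator[OF R] by blast
    obtain e where e: "e \<in> R" "e \<noteq> 0" "smult e q \<in> polys_over R"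
      using common_denominator[OF R] by blast
    have const: "[:r:] \<in> polys_over R" if "r \<in> R" for r
      using that subdomain_zero_add(1)[OF sub] by (auto simp: polys_over_def coeff_pCons split: nat.split)
    have "smult (e * d) p \<in> polys_over R" "smult (e * d) q \<in> polys_over R"
      using polys(2)[OF const[OF e(1)] d(3)] polys(2)[OF const[OF d(1)] e(3)]
      by (simp_all add: mult.commute)
    moreover have "x = to_fract (smult (e * d) p) / to_fract (smult (e * d) q)"
      using pq d e by (simp add: to_fract_def eq_fract)
    moreover have "to_fract (smult (e * d) q) \<noteq> 0"
      using pq d e by (simp add: to_fract_eq_0_iff)
    ultimately show ?thesis unfolding poly_ring_def by blast
  qed
  moreover have "subdomain (poly_ring R)"
    using polys unfolding subdomain_def poly_ring_def
    by (auto simp flip: to_fract_1 to_fract_diff to_fract_mult intro!: imageI)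
  ultimately show ?thesis by (simp add: domain_with_fraction_field_def)
qed

end

theory Submission
  imports Defs
begin

text \<open>
  \<open>Na(D,v)\<close> is the localization of \<open>D[X]\<close> at polynomials that generate the unit ideal up to
  \<open>w\<close>-closure, so the equation \<open>I\<^sup>w = (I\<^sup>2J)\<^sup>w\<close> extends to \<open>I = I\<^sup>2J\<close>; this gives (2) from (1).

  A Clifford regular domain \<open>R\<close> has finite character: otherwise some nonzero element lies in infinitely
  many pairwise comaximal proper finitely generated ideals \<open>I\<^sub>n\<close>, and the fractional ideal
  \<open>\<Sum>(R : I\<^sub>n\<^sup>2)\<close> is not regular. Moreover the \<open>t\<close>-maximal ideals of \<open>D[X]\<close> are the \<open>M[X]\<close> and some
  uppers to zero, and a nonzero polynomial lies in finitely many of the latter; this gives (3) from (2).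

  For (3) to (1), put \<open>J = \<Inter>(I\<^sub>M : I\<^sub>M\<^sup>2)\<close> over the \<open>t\<close>-maximal ideals \<open>M\<close>. By \<open>t\<close>-finite character,
  \<open>I\<^sup>w = (I\<^sup>2J)\<^sup>w\<close> follows from local regularity as soon as, for \<open>M \<noteq> N\<close>, localizing \<open>(I\<^sub>N : I\<^sub>N\<^sup>2)\<close> at \<open>M\<close> gives a
  module containing \<open>(I\<^sub>M : I\<^sub>M\<^sup>2)\<close>. In a weakly Matlis domain that localization is the whole field of
  fractions; if \<open>D\<close> is integrally closed, the local rings are valuation rings, where the inclusion
  is checked on elements. Regularity of \<open>D\<^sub>M(X)\<close> descends to \<open>D\<^sub>M\<close>, so the same argument applies to \<open>D\<close>.
\<close>

subsection \<open>Modules over a subring of a field\<close>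

text \<open>The obstacle between (3) and (1) is that localization commutes with finite intersections
  only, whereas J is an intersection over all \<open>t\<close>-maximal ideals. A given y lies in
  (I_N : I_N^2) for every N that avoids a certain nonzero e depending on y, so
  \<open>t\<close>-finite character leaves finitely many N, and these can be treated one pair M, N
  at a time. The colon (I : I^2) recurs because it contains every J with I = I^2 J. It is the
  largest candidate, both when local regularity is glued and when regularity descends from a Nagata
  ring. The square in (R : I_n^2) has the same origin: for integral I_n a witness J lies in this
  module, and once the module is closed under products, J is forced into R and I_n becomes R. The
  passage between D and D[X] rests on one cancellation: a polynomial of large content cancels modulo
  a submodule. This makes P[X] prime, makes the denominators of the Nagata rings and of Na(D,v)
  multiplicative, and lets extended ideals contract back to the original ones.\<close>

locale subdom =
  fixes R :: "'k::field set"
  assumes subdomain: "subdomain R"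
begin

abbreviation span :: "'k set \<Rightarrow> 'k set" where
  "span A \<equiv> is_submodule R hull A"

lemma one_closed [simp, intro]: "1 \<in> R"
  and diff_closed [intro]: "x \<in> R \<Longrightarrow> y \<in> R \<Longrightarrow> x - y \<in> R"
  and mult_closed [intro]: "x \<in> R \<Longrightarrow> y \<in> R \<Longrightarrow> x * y \<in> R"
  using subdomain by (auto simp: subdomain_def)

lemma zero_closed [simp, intro]: "0 \<in> R"
  and add_closed [intro]: "x \<in> R \<Longrightarrow> y \<in> R \<Longrightarrow> x + y \<in> R"
  using subdomain subdomain_zero_add by blast+

lemma uminus_closed [intro]: "x \<in> R \<Longrightarrow> - x \<in> R"
  using diff_closed[OF zero_closed] by simp

lemma prod_closed [intro]: "(\<And>i. i \<in> A \<Longrightarrow> f i \<in> R) \<Longrightarrow> prod f A \<in> R"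
  by (induction A rule: infinite_finite_induct) auto

lemma submodule_zero: "is_submodule R I \<Longrightarrow> 0 \<in> I"
  and submodule_add: "is_submodule R I \<Longrightarrow> x \<in> I \<Longrightarrow> y \<in> I \<Longrightarrow> x + y \<in> I"
  and submodule_scale: "is_submodule R I \<Longrightarrow> r \<in> R \<Longrightarrow> x \<in> I \<Longrightarrow> r * x \<in> I"
  by (auto simp: is_submodule_def)

lemma submodule_scale_right: "is_submodule R I \<Longrightarrow> r \<in> R \<Longrightarrow> x \<in> I \<Longrightarrow> x * r \<in> I"
  by (simp add: submodule_scale mult.commute)

lemma submodule_uminus: "is_submodule R I \<Longrightarrow> x \<in> I \<Longrightarrow> - x \<in> I"
  using submodule_scale[OF _ uminus_closed[OF one_closed]] by fastforce

lemma submodule_diff: "is_submodule R I \<Longrightarrow> x \<in> I \<Longrightarrow> y \<in> I \<Longrightarrow> x - y \<in> I"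
  using submodule_add[of I x "- y"] submodule_uminus by auto

lemma submodule_sum: "is_submodule R I \<Longrightarrow> (\<And>i. i \<in> A \<Longrightarrow> f i \<in> I) \<Longrightarrow> sum f A \<in> I"
  by (induction A rule: infinite_finite_induct) (auto simp: submodule_zero submodule_add)

lemma submodule_self: "is_submodule R R"
  by (auto simp: is_submodule_def)

lemma submodule_Int: "is_submodule R I \<Longrightarrow> is_submodule R J \<Longrightarrow> is_submodule R (I \<inter> J)"
  by (auto simp: is_submodule_def)

lemma submodule_colon: "is_submodule R L \<Longrightarrow> is_submodule R {x. \<forall>y\<in>A. x * y \<in> L}"
  by (auto simp: is_submodule_def algebra_simps)

lemma submodule_principal: "is_submodule R {r * x |r. r \<in> R}"
  unfolding is_submodule_def
proof safe
  show "\<exists>r. 0 = r * x \<and> r \<in> R" by (rule exI[of _ 0]) simp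
next
  fix r s assume "r \<in> R" "s \<in> R"
  then show "\<exists>t. r * x + s * x = t * x \<and> t \<in> R"
    by (intro exI[of _ "r + s"]) (auto simp: distrib_right)
next
  fix r s assume "r \<in> R" "s \<in> R"
  then show "\<exists>t. r * (s * x) = t * x \<and> t \<in> R"
    by (intro exI[of _ "r * s"]) (auto simp: mult.assoc)
qed

lemma submodule_plus:
  assumes "is_submodule R I" "is_submodule R J"
  shows "is_submodule R {x. \<exists>p\<in>I. \<exists>q\<in>J. x = p + q}"
  unfolding is_submodule_def
proof safe
  show "\<exists>p\<in>I. \<exists>q\<in>J. 0 = p + q" using assms[THEN submodule_zero] by force
next
  fix p q p' q' assume "p \<in> I" "q \<in> J" "p' \<in> I" "q' \<in> J"
  then have "p + p' \<in> I" "q + q' \<in> J" using assms by (auto intro: submodule_add)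
  moreover have "p + q + (p' + q') = (p + p') + (q + q')" by simp
  ultimately show "\<exists>r\<in>I. \<exists>s\<in>J. p + q + (p' + q') = r + s" by blast
next
  fix r p q assume "r \<in> R" "p \<in> I" "q \<in> J"
  then have "r * p \<in> I" "r * q \<in> J" using assms by (auto intro: submodule_scale)
  then show "\<exists>s\<in>I. \<exists>t\<in>J. r * (p + q) = s + t" by (auto simp: distrib_left)
qed

lemma submodule_span: "is_submodule R (span A)"
  by (rule hull_in) (auto simp: is_submodule_def)

lemma span_superset: "x \<in> A \<Longrightarrow> x \<in> span A"
  using hull_subset by fastforce

lemma span_least: "is_submodule R L \<Longrightarrow> A \<subseteq> L \<Longrightarrow> span A \<subseteq> L"
  by (simp add: hull_minimal)

text \<open>Coefficients from a submodule \<open>E\<close> cover two cases at once: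
  \<open>E = R\<close> describes the span of \<open>A\<close>, and E = IJ the module (IJ)A to which
  the determinant trick is applied.\<close>

lemma submodule_combinations:
  assumes E: "is_submodule R E"
  shows "is_submodule R {x. \<exists>f. (\<forall>a. f a \<in> E) \<and> x = (\<Sum>a\<in>A. f a * a)}"
  unfolding is_submodule_def mem_Collect_eq Ball_def
proof (intro conjI allI impI; (elim exE conjE)?)
  show "\<exists>f. (\<forall>a. f a \<in> E) \<and> 0 = (\<Sum>a\<in>A. f a * a)"
    by (rule exI[of _ "\<lambda>_. 0"]) (auto simp: submodule_zero[OF E])
next
  fix x y f g
  assume "\<forall>a. f a \<in> E" "x = (\<Sum>a\<in>A. f a * a)" "\<forall>a. g a \<in> E" "y = (\<Sum>a\<in>A. g a * a)"
  then show "\<exists>f. (\<forall>a. f a \<in> E) \<and> x + y = (\<Sum>a\<in>A. f a * a)"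
    by (intro exI[of _ "\<lambda>a. f a + g a"]) (auto simp: algebra_simps sum.distrib submodule_add[OF E])
next
  fix r x f
  assume "r \<in> R" "\<forall>a. f a \<in> E" "x = (\<Sum>a\<in>A. f a * a)"
  then show "\<exists>f. (\<forall>a. f a \<in> E) \<and> r * x = (\<Sum>a\<in>A. f a * a)"
    by (intro exI[of _ "\<lambda>a. r * f a"]) (auto simp: algebra_simps sum_distrib_left submodule_scale[OF E])
qed

lemma submodule_chain_Union:
  assumes C: "C \<noteq> {}" "subset.chain \<A> C" and sub: "\<And>X. X \<in> C \<Longrightarrow> is_submodule R X"
  shows "is_submodule R (\<Union>C)"
  unfolding is_submodule_def
proof (intro conjI ballI)
  obtain X0 where X0: "X0 \<in> C" using C(1) by blast
  show "0 \<in> \<Union>C" using X0 submodule_zero[OF sub[OF X0]] by (rule UnionI)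
  fix x assume "x \<in> \<Union>C"
  then obtain X where X: "X \<in> C" "x \<in> X" by (rule UnionE)
  show "r * x \<in> \<Union>C" if "r \<in> R" for r
    using X(1) submodule_scale[OF sub[OF X(1)] that X(2)] by (rule UnionI)
  fix y assume "y \<in> \<Union>C"
  then obtain Y where Y: "Y \<in> C" "y \<in> Y" by (rule UnionE)
  from X Y have "X \<subseteq> Y \<or> Y \<subseteq> X" using C(2) by (auto simp: subset_chain_def)
  then show "x + y \<in> \<Union>C"
    using X Y submodule_add[OF sub[OF X(1)], of x y] submodule_add[OF sub[OF Y(1)], of x y] by blast
qed

text \<open>\<open>B\<close> only has to consist of elements with a denominator in \<open>S\<close>,
  so one proof serves localizations at primes, Nagata rings and Na(D,v).\<close>

lemma submodule_fractions:
  assumes I: "is_submodule R I" and S: "S \<subseteq> R" "1 \<in> S" "\<And>s t. s \<in> S \<Longrightarrow> t \<in> S \<Longrightarrow> s * t \<in> S"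
    and B: "\<And>r. r \<in> B \<Longrightarrow> \<exists>s\<in>S. s * r \<in> R"
  shows "is_submodule B {x. \<exists>s\<in>S. s * x \<in> I}"
  unfolding is_submodule_def mem_Collect_eq
proof (intro conjI ballI)
  show "\<exists>s\<in>S. s * 0 \<in> I" using S(2) submodule_zero[OF I] by auto
next
  fix x y assume "x \<in> {x. \<exists>s\<in>S. s * x \<in> I}" "y \<in> {x. \<exists>s\<in>S. s * x \<in> I}"
  then obtain s t where st: "s \<in> S" "s * x \<in> I" "t \<in> S" "t * y \<in> I" by blast
  have "t * (s * x) + s * (t * y) \<in> I"
    by (rule submodule_add[OF I submodule_scale[OF I subsetD[OF S(1) st(3)] st(2)]
      submodule_scale[OF I subsetD[OF S(1) st(1)] st(4)]])
  then have "(s * t) * (x + y) \<in> I" by (simp add: algebra_simps)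
  then show "\<exists>s\<in>S. s * (x + y) \<in> I" using S(3)[OF st(1,3)] by blast
next
  fix r x assume "r \<in> B" "x \<in> {x. \<exists>s\<in>S. s * x \<in> I}"
  then obtain s t where st: "s \<in> S" "s * r \<in> R" "t \<in> S" "t * x \<in> I" using B by blast
  have "(s * r) * (t * x) \<in> I" by (rule submodule_scale[OF I st(2,4)])
  then have "(s * t) * (r * x) \<in> I" by (simp add: mult_ac)
  then show "\<exists>s\<in>S. s * (r * x) \<in> I" using S(3)[OF st(1,3)] by blast
qed

lemma span_finite:
  assumes "finite A" "x \<in> span A"
  shows "\<exists>f. (\<forall>a. f a \<in> R) \<and> x = (\<Sum>a\<in>A. f a * a)"
proof -
  let ?Z = "{x. \<exists>f. (\<forall>a. f a \<in> R) \<and> x = (\<Sum>a\<in>A. f a * a)}"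
  have "is_submodule R ?Z" by (rule submodule_combinations[OF submodule_self])
  moreover have "A \<subseteq> ?Z"
  proof
    fix a assume "a \<in> A"
    then have "a = (\<Sum>b\<in>A. (if b = a then 1 else 0) * b)"
      using assms(1) by (simp add: if_distrib[of "\<lambda>x. x * _"] cong: if_cong)
    then show "a \<in> ?Z" by (intro CollectI exI[of _ "\<lambda>b. if b = a then 1 else 0"]) auto
  qed
  ultimately show ?thesis using span_least assms(2) by blast
qed

section \<open>Nonzero fractional ideals, their products and von Neumann regularity\<close>

lemma nz_idealsI:
  "is_submodule R I \<Longrightarrow> x \<in> I \<Longrightarrow> x \<noteq> 0 \<Longrightarrow> d \<in> R \<Longrightarrow> d \<noteq> 0 \<Longrightarrow> (\<And>y. y \<in> I \<Longrightarrow> d * y \<in> R)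
    \<Longrightarrow> I \<in> nz_ideals R"
  by (auto simp: nz_ideals_def is_ideal_def)

lemma nz_ideals_submodule: "I \<in> nz_ideals R \<Longrightarrow> is_submodule R I"
  by (simp add: nz_ideals_def is_ideal_def)

lemma nz_ideals_nonzero: "I \<in> nz_ideals R \<Longrightarrow> \<exists>x\<in>I. x \<noteq> 0"
  using submodule_zero[OF nz_ideals_submodule, of I] by (auto simp: nz_ideals_def)

lemma nz_ideals_denominator: "I \<in> nz_ideals R \<Longrightarrow> \<exists>d\<in>R. d \<noteq> 0 \<and> (\<forall>x\<in>I. d * x \<in> R)"
  by (simp add: nz_ideals_def is_ideal_def)

lemma submodule_ideal_mult: "is_submodule R (ideal_mult R I J)"
  by (simp add: ideal_mult_def submodule_span)

lemma ideal_multI: "x \<in> I \<Longrightarrow> y \<in> J \<Longrightarrow> x * y \<in> ideal_mult R I J"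
  unfolding ideal_mult_def by (rule span_superset) blast

lemma ideal_mult_least:
  "is_submodule R L \<Longrightarrow> (\<And>x y. x \<in> I \<Longrightarrow> y \<in> J \<Longrightarrow> x * y \<in> L) \<Longrightarrow> ideal_mult R I J \<subseteq> L"
  unfolding ideal_mult_def by (rule span_least) auto

lemma ideal_mult3I: "x \<in> I \<Longrightarrow> y \<in> I' \<Longrightarrow> z \<in> J \<Longrightarrow> x * y * z \<in> ideal_mult R (ideal_mult R I I') J"
  by (intro ideal_multI)

lemma ideal_mult3_least:
  assumes L: "is_submodule R L" and *: "\<And>x y z. x \<in> I \<Longrightarrow> y \<in> I' \<Longrightarrow> z \<in> J \<Longrightarrow> x * y * z \<in> L"
  shows "ideal_mult R (ideal_mult R I I') J \<subseteq> L"
proof (rule ideal_mult_least[OF L])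
  fix x y assume "x \<in> ideal_mult R I I'" "y \<in> J"
  moreover have "ideal_mult R I I' \<subseteq> {w. \<forall>z\<in>J. w * z \<in> L}"
    using * by (intro ideal_mult_least submodule_colon[OF L]) auto
  ultimately show "x * y \<in> L" by blast
qed

lemma vN_regularI:
  assumes "is_submodule R I" "J \<in> nz_ideals R" "\<And>x y z. x \<in> I \<Longrightarrow> y \<in> I \<Longrightarrow> z \<in> J \<Longrightarrow> x * y * z \<in> I"
    and "I \<subseteq> ideal_mult R (ideal_mult R I I) J"
  shows "vN_regular R I"
  using assms ideal_mult3_least[of I I I J] unfolding vN_regular_def by blast

lemma vN_regularD:
  assumes "vN_regular R I"
  obtains J where "J \<in> nz_ideals R" "I = ideal_mult R (ideal_mult R I I) J"
    "\<And>x y z. x \<in> I \<Longrightarrow> y \<in> I \<Longrightarrow> z \<in> J \<Longrightarrow> x * y * z \<in> I"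
proof -
  obtain J where J: "J \<in> nz_ideals R" "I = ideal_mult R (ideal_mult R I I) J"
    using assms unfolding vN_regular_def by blast
  have "x * y * z \<in> I" if "x \<in> I" "y \<in> I" "z \<in> J" for x y z
    using ideal_mult3I[OF that] by (subst J(2))
  then show thesis using that J by blast
qed

text \<open>Read as IJ \<subseteq> (I : I): a generator \<open>y * j\<close> of IJ sends
  \<open>x\<close> to \<open>y * x * j\<close>, which lies in \<open>I\<close> by
  hypothesis.\<close>

lemma ideal_mult_absorb:
  assumes I: "is_submodule R I" and IIJ: "\<And>x y z. x \<in> I \<Longrightarrow> y \<in> I \<Longrightarrow> z \<in> J \<Longrightarrow> x * y * z \<in> I"
    and "e \<in> ideal_mult R I J" "x \<in> I"
  shows "e * x \<in> I"
proof -
  have "ideal_mult R I J \<subseteq> {w. \<forall>v\<in>{x}. w * v \<in> I}"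
  proof (intro ideal_mult_least submodule_colon I)
    fix y j assume "y \<in> I" "j \<in> J"
    then have "y * x * j \<in> I" using IIJ assms(4) by blast
    then show "y * j \<in> {w. \<forall>v\<in>{x}. w * v \<in> I}" by (simp add: mult_ac)
  qed
  then show ?thesis using assms(3) by auto
qed

lemma vN_regular_principal:
  assumes x: "x \<noteq> 0" and I: "I = {r * x | r. r \<in> R}" "I \<in> nz_ideals R"
  shows "vN_regular R I"
proof (rule vN_regularI)
  obtain d where d: "d \<in> R" "d \<noteq> 0" "\<And>y. y \<in> I \<Longrightarrow> d * y \<in> R"
    using nz_ideals_denominator[OF I(2)] by blast
  have xI: "x \<in> I" using I(1) by (force intro: exI[of _ 1])
  \<comment> \<open>The inverse of the principal ideal; both inclusions come from
    \<open>x * x * (1 / x) = x\<close>.\<close>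
  let ?J = "{r * (1 / x) |r. r \<in> R}"
  show "is_submodule R I" using I(2) by (rule nz_ideals_submodule)
  have "is_submodule R ?J" by (rule submodule_principal)
  show "?J \<in> nz_ideals R"
  proof (rule nz_idealsI[of _ "1 / x" "d * x"])
    have "1 * (1 / x) \<in> ?J" by blast
    then show "1 / x \<in> ?J" by simp
    show "d * x \<in> R" using d(3)[OF xI] .
    fix y assume "y \<in> ?J"
    then show "d * x * y \<in> R" using d(1) x by auto
  qed (use \<open>is_submodule R ?J\<close> x d in auto)
  show "u * y * z \<in> I" if "u \<in> I" "y \<in> I" "z \<in> ?J" for u y z
  proof -
    from that obtain a b c where "u = a * x" "y = b * x" "z = c * (1 / x)" "a \<in> R" "b \<in> R" "c \<in> R"
      unfolding I(1) by blast
    then have "u * y * z = (a * b * c) * x" "a * b * c \<in> R" using x by auto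
    then show ?thesis unfolding I(1) by blast
  qed
  show "I \<subseteq> ideal_mult R (ideal_mult R I I) ?J"
  proof
    fix y assume "y \<in> I"
    moreover have "1 * (1 / x) \<in> ?J" by blast
    ultimately have "y * x * (1 * (1 / x)) \<in> ideal_mult R (ideal_mult R I I) ?J"
      using xI by (intro ideal_mult3I)
    then show "y \<in> ideal_mult R (ideal_mult R I I) ?J" using x by simp
  qed
qed

end

text \<open>\<open>B'\<close> is a localization of \<open>B\<close>; the regularity equations of the ideals of \<open>B\<close> need only hold
  after extension to \<open>B'\<close>.\<close>

lemma Clifford_regular_localizationI:
  assumes B: "subdomain B" and B': "subdomain B'" and BB: "B \<subseteq> B'"
    and loc: "\<And>x. x \<in> B' \<Longrightarrow> \<exists>s\<in>B. s \<noteq> 0 \<and> 1 / s \<in> B' \<and> s * x \<in> B"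
    and reg: "\<And>I. I \<in> nz_ideals B \<Longrightarrow> \<exists>J\<in>nz_ideals B.
      (\<forall>x\<in>I. \<forall>y\<in>I. \<forall>z\<in>J. \<exists>s. s \<noteq> 0 \<and> 1 / s \<in> B' \<and> s * (x * y * z) \<in> I) \<and>
      (\<forall>x\<in>I. \<exists>s. s \<noteq> 0 \<and> 1 / s \<in> B' \<and> s * x \<in> ideal_mult B (ideal_mult B I I) J)"
  shows "Clifford_regular B'"
  unfolding Clifford_regular_def
proof
  interpret B: subdom B by unfold_locales (rule B)
  interpret B': subdom B' by unfold_locales (rule B')
  have subm: "is_submodule B L" if "is_submodule B' L" for L
    using that BB by (auto simp: is_submodule_def)
  fix I' assume I': "I' \<in> nz_ideals B'"
  note I'sub = B'.nz_ideals_submodule[OF I']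
  obtain d' where d': "d' \<in> B'" "d' \<noteq> 0" "\<And>x. x \<in> I' \<Longrightarrow> d' * x \<in> B'"
    using B'.nz_ideals_denominator[OF I'] by blast
  obtain s where s: "s \<in> B" "s \<noteq> 0" "s * d' \<in> B" using loc[OF d'(1)] by blast
  define d where "d = s * d'"
  have d: "d \<in> B" "d \<noteq> 0" using s d' by (auto simp: d_def)
  have dI: "d * x \<in> B'" if "x \<in> I'" for x
    using d'(3)[OF that] s BB by (auto simp: d_def mult.assoc)
  \<comment> \<open>An ideal of \<open>B\<close> whose extension is \<open>I'\<close>: each element
    of \<open>I'\<close> enters it after multiplication by some \<open>s\<close> with
    \<open>1 / s\<close> in \<open>B'\<close>. The factor \<open>d\<close> comes from
    \<open>B\<close>, so it also serves as a denominator over \<open>B\<close>.\<close>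
  define I where "I = {x \<in> I'. d * x \<in> B}"
  have I_ex: "\<exists>s\<in>B. s \<noteq> 0 \<and> 1 / s \<in> B' \<and> s * x \<in> I" if x: "x \<in> I'" for x
  proof -
    obtain s where s: "s \<in> B" "s \<noteq> 0" "1 / s \<in> B'" "s * (d * x) \<in> B" using loc[OF dI[OF x]] by blast
    then have "s * x \<in> I"
      using x BB B'.submodule_scale[OF I'sub] unfolding I_def by (auto simp: algebra_simps)
    then show ?thesis using s by blast
  qed
  have cancel: "x \<in> L" if "is_submodule B' L" "s \<noteq> 0" "1 / s \<in> B'" "s * x \<in> L" for L s x
    using B'.submodule_scale[OF that(1,3,4)] that(2) by simp
  have "I \<in> nz_ideals B"
  proof -
    have "is_submodule B I"
      using subm[OF I'sub] d(1) unfolding I_def is_submodule_def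
      by (auto simp: distrib_left intro!: B.add_closed) (auto simp: mult.left_commute[of d])
    moreover obtain x where "x \<in> I'" "x \<noteq> 0" using B'.nz_ideals_nonzero[OF I'] by blast
    then obtain s where "s \<noteq> 0" "s * x \<in> I" using I_ex by blast
    ultimately show ?thesis
      using d \<open>x \<noteq> 0\<close> by (intro B.nz_idealsI[of I "s * x" d]) (auto simp: I_def)
  qed
  from reg[OF this] obtain J where J: "J \<in> nz_ideals B"
    and J1: "\<And>x y z. x \<in> I \<Longrightarrow> y \<in> I \<Longrightarrow> z \<in> J \<Longrightarrow> \<exists>s. s \<noteq> 0 \<and> 1 / s \<in> B' \<and> s * (x * y * z) \<in> I"
    and J2: "\<And>x. x \<in> I \<Longrightarrow> \<exists>s. s \<noteq> 0 \<and> 1 / s \<in> B' \<and> s * x \<in> ideal_mult B (ideal_mult B I I) J"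
    by blast
  have II': "I \<subseteq> I'" by (auto simp: I_def)
  define J' where "J' = B'.span J"
  have JJ': "J \<subseteq> J'" unfolding J'_def by (auto intro: B'.span_superset)
  show "vN_regular B' I'"
  proof (rule B'.vN_regularI[OF I'sub])
    obtain e where e: "e \<in> B" "e \<noteq> 0" "\<And>x. x \<in> J \<Longrightarrow> e * x \<in> B"
      using B.nz_ideals_denominator[OF J] by blast
    obtain z where z: "z \<in> J" "z \<noteq> 0" using B.nz_ideals_nonzero[OF J] by blast
    have "is_submodule B' {x. \<forall>y\<in>{e}. x * y \<in> B'}"
      by (rule B'.submodule_colon[OF B'.submodule_self])
    then have "J' \<subseteq> {x. \<forall>y\<in>{e}. x * y \<in> B'}"
      unfolding J'_def using e BB by (intro B'.span_least) (auto simp: mult.commute)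
    then show "J' \<in> nz_ideals B'"
      using z JJ' e BB B'.submodule_span by (intro B'.nz_idealsI[of _ z e]) (auto simp: J'_def mult.commute)
    fix x y w assume *: "x \<in> I'" "y \<in> I'" "w \<in> J'"
    have "is_submodule B' {w. \<forall>u\<in>{x * y}. w * u \<in> I'}"
      by (rule B'.submodule_colon[OF I'sub])
    moreover have "J \<subseteq> {w. \<forall>u\<in>{x * y}. w * u \<in> I'}"
    proof safe
      fix z assume z: "z \<in> J"
      obtain s where s: "s \<noteq> 0" "1 / s \<in> B'" "s * x \<in> I" using I_ex[OF *(1)] by blast
      obtain t where t: "t \<noteq> 0" "1 / t \<in> B'" "t * y \<in> I" using I_ex[OF *(2)] by blast
      obtain r where r: "r \<noteq> 0" "1 / r \<in> B'" "r * (s * x * (t * y) * z) \<in> I"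
        using J1[OF s(3) t(3) z] by blast
      have eq: "s * (t * (z * (x * y))) = s * x * (t * y) * z" by (simp add: algebra_simps)
      have "r * (s * (t * (z * (x * y)))) \<in> I'" using subsetD[OF II' r(3)] by (simp only: eq)
      then show "z * (x * y) \<in> I'" using cancel[OF I'sub] s r t by blast
    qed
    ultimately have "J' \<subseteq> {w. \<forall>u\<in>{x * y}. w * u \<in> I'}"
      unfolding J'_def by (rule B'.span_least)
    then show "x * y * w \<in> I'" using * by (auto simp: mult.commute)
  next
    let ?P = "ideal_mult B' (ideal_mult B' I' I') J'"
    have sub: "ideal_mult B (ideal_mult B I I) J \<subseteq> ?P"
      using II' JJ' by (intro B.ideal_mult3_least subm B'.submodule_ideal_mult B'.ideal_mult3I) auto
    show "I' \<subseteq> ?P"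
    proof
      fix x assume "x \<in> I'"
      then obtain s where s: "s \<noteq> 0" "1 / s \<in> B'" "s * x \<in> I" using I_ex by blast
      then obtain t where t: "t \<noteq> 0" "1 / t \<in> B'" "t * (s * x) \<in> ?P" using J2 sub by blast
      then show "x \<in> ?P" using s cancel[OF B'.submodule_ideal_mult] by blast
    qed
  qed
qed

lemma Clifford_regular_localization:
  assumes "subdomain B" "subdomain B'" "B \<subseteq> B'"
    and "\<And>x. x \<in> B' \<Longrightarrow> \<exists>s\<in>B. s \<noteq> 0 \<and> 1 / s \<in> B' \<and> s * x \<in> B"
    and reg: "Clifford_regular B"
  shows "Clifford_regular B'"
proof (rule Clifford_regular_localizationI[OF assms(1-4)])
  interpret B: subdom B by unfold_locales (rule assms)
  interpret B': subdom B' by unfold_locales (rule assms)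
  fix I assume "I \<in> nz_ideals B"
  then have "vN_regular B I" using reg by (simp add: Clifford_regular_def)
  then obtain J where "J \<in> nz_ideals B" "I = ideal_mult B (ideal_mult B I I) J"
    "\<And>x y z. x \<in> I \<Longrightarrow> y \<in> I \<Longrightarrow> z \<in> J \<Longrightarrow> x * y * z \<in> I"
    using B.vN_regularD by blast
  then show "\<exists>J\<in>nz_ideals B.
      (\<forall>x\<in>I. \<forall>y\<in>I. \<forall>z\<in>J. \<exists>s. s \<noteq> 0 \<and> 1 / s \<in> B' \<and> s * (x * y * z) \<in> I) \<and>
      (\<forall>x\<in>I. \<exists>s. s \<noteq> 0 \<and> 1 / s \<in> B' \<and> s * x \<in> ideal_mult B (ideal_mult B I I) J)"
    by (intro bexI[of _ J] conjI ballI exI[of _ 1]) auto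
qed

subsection \<open>Finite character of Clifford regular domains\<close>

text \<open>A determinant trick without determinants: \<open>T\<close> is a ring possibly lacking 1,
  and each generator is a \<open>T\<close>-combination of all of them. Generators are eliminated one
  at a time; in a field the last equation \<open>b = f b * b\<close> leaves only
  \<open>b = 0\<close> or \<open>f b = 1\<close>.\<close>

lemma finite_generators_idempotent_ring:
  fixes T :: "'k::field set"
  assumes T: "0 \<in> T" "\<And>x y. x \<in> T \<Longrightarrow> y \<in> T \<Longrightarrow> x + y \<in> T \<and> x - y \<in> T \<and> x * y \<in> T"
    and A: "finite A" "\<And>x. x \<in> A \<Longrightarrow> \<exists>f. (\<forall>a. f a \<in> T) \<and> x = (\<Sum>a\<in>A. f a * a)"
  shows "A \<subseteq> {0} \<or> 1 \<in> T"
  using A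
proof (induction A rule: finite_induct)
  case empty
  then show ?case by simp
next
  case (insert b A)
  obtain f where f: "\<And>a. f a \<in> T" "b = (\<Sum>a\<in>insert b A. f a * a)"
    using insert.prems[of b] by blast
  have b: "b = f b * b + (\<Sum>a\<in>A. f a * a)" using f(2) insert.hyps by simp
  have "\<exists>h. (\<forall>a. h a \<in> T) \<and> x = (\<Sum>a\<in>A. h a * a)" if x: "x \<in> A" for x
  proof -
    obtain g where g: "\<And>a. g a \<in> T" "x = (\<Sum>a\<in>insert b A. g a * a)"
      using insert.prems[of x] x by blast
    have x': "x = g b * b + (\<Sum>a\<in>A. g a * a)" using g(2) insert.hyps by simp
    \<comment> \<open>The equation of \<open>b\<close> makes \<open>(1 - f b) * b\<close> a
      combination of \<open>A\<close>; multiplying the equation of \<open>x\<close> by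
      \<open>1 - f b\<close> therefore eliminates \<open>b\<close>. The missing
      \<open>f b * x\<close> is put back by the last summand, so all coefficients stay in
      \<open>T\<close> even without 1.\<close>
    define h where "h a = g b * f a + (g a - f b * g a) + (if a = x then f b else 0)" for a
    have "(\<Sum>a\<in>A. h a * a) = (\<Sum>a\<in>A. g b * (f a * a) + (g a * a - f b * (g a * a)) + (if a = x then f b * a else 0))"
      by (intro sum.cong) (auto simp: h_def algebra_simps)
    also have "\<dots> = g b * (\<Sum>a\<in>A. f a * a) + ((\<Sum>a\<in>A. g a * a) - f b * (\<Sum>a\<in>A. g a * a)) + f b * x"
      using x insert.hyps(1) by (simp add: sum.distrib sum_subtractf sum_distrib_left)
    also have "\<dots> = x"
    proof -
      have "(\<Sum>a\<in>A. f a * a) = b - f b * b" "(\<Sum>a\<in>A. g a * a) = x - g b * b"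
        using b x' by (simp_all only: eq_diff_eq add.commute)
      then show ?thesis by (simp only:) (simp add: algebra_simps)
    qed
    finally have "x = (\<Sum>a\<in>A. h a * a)" by simp
    moreover have "h a \<in> T" for a using T f(1) g(1) by (simp add: h_def)
    ultimately show ?thesis by blast
  qed
  then have "A \<subseteq> {0} \<or> 1 \<in> T" by (rule insert.IH)
  moreover have "b = 0 \<or> f b = 1" if "A \<subseteq> {0}"
  proof -
    have "(\<Sum>a\<in>A. f a * a) = 0" using that by (intro sum.neutral) auto
    then show ?thesis using b by simp
  qed
  ultimately show ?case using f(1)[of b] by auto
qed

context subdom
begin

text \<open>With \<open>I = I\<^sup>2J\<close> one gets \<open>1 \<in> IJ\<close> and \<open>J \<subseteq> T = (R : I\<^sup>2)\<close>; hence \<open>1 \<in> IT\<close>, so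
  \<open>T \<subseteq> I\<^sup>2T\<^sup>3 \<subseteq> R\<close> and \<open>1 \<in> IJ \<subseteq> I\<close>.\<close>

lemma finitely_generated_regular_eq_one:
  assumes A: "finite A" and I: "I = span A" "I \<subseteq> R" "I \<noteq> {0}" and reg: "vN_regular R I"
    and T: "\<And>u v. \<forall>y\<in>I. \<forall>z\<in>I. u * y * z \<in> R \<Longrightarrow> \<forall>y\<in>I. \<forall>z\<in>I. v * y * z \<in> R \<Longrightarrow>
      \<forall>y\<in>I. \<forall>z\<in>I. u * v * y * z \<in> R"
  shows "1 \<in> I"
proof -
  obtain J where J: "J \<in> nz_ideals R" "I = ideal_mult R (ideal_mult R I I) J"
    "\<And>x y z. x \<in> I \<Longrightarrow> y \<in> I \<Longrightarrow> z \<in> J \<Longrightarrow> x * y * z \<in> I"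
    using vN_regularD[OF reg] by blast
  have sI: "is_submodule R I" using I(1) submodule_span by simp
  define E where "E = ideal_mult R I J"
  have sE: "is_submodule R E" by (simp add: E_def submodule_ideal_mult)
  have EI: "e * x \<in> I" if "e \<in> E" "x \<in> I" for e x
    using ideal_mult_absorb[OF sI J(3)] that unfolding E_def by blast
  have EE: "e * e' \<in> E" if "e \<in> E" "e' \<in> E" for e e'
  proof -
    have "E \<subseteq> {w. \<forall>u\<in>{e}. w * u \<in> E}"
      unfolding E_def
    proof (intro ideal_mult_least submodule_colon submodule_ideal_mult)
      fix x y assume "x \<in> I" "y \<in> J"
      then have "e * x * y \<in> ideal_mult R I J" using EI[OF that(1)] by (intro ideal_multI)
      then show "x * y \<in> {w. \<forall>u\<in>{e}. w * u \<in> ideal_mult R I J}"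
        by (simp add: mult.assoc mult.left_commute mult.commute)
    qed
    then show ?thesis using that by (auto simp: mult.commute)
  qed
  \<comment> \<open>This is EA. As I = I(IJ) and \<open>A\<close> spans \<open>I\<close>, it
    contains \<open>I\<close>; since \<open>E\<close> is closed under products, the elimination
    applies with \<open>E\<close> as coefficient ring.\<close>
  let ?Z = "{x. \<exists>f. (\<forall>a. f a \<in> E) \<and> x = (\<Sum>a\<in>A. f a * a)}"
  have "is_submodule R ?Z" by (rule submodule_combinations[OF sE])
  then have "ideal_mult R (ideal_mult R I I) J \<subseteq> ?Z"
  proof (rule ideal_mult3_least)
    fix x y z assume *: "x \<in> I" "y \<in> I" "z \<in> J"
    obtain f where f: "\<And>a. f a \<in> R" "x = (\<Sum>a\<in>A. f a * a)" using span_finite[OF A] *(1) I(1) by blast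
    have "x * y * z = (\<Sum>a\<in>A. f a * (y * z) * a)"
      by (simp add: f(2) sum_distrib_left sum_distrib_right algebra_simps)
    moreover have "f a * (y * z) \<in> E" for a
      unfolding E_def by (rule submodule_scale[OF submodule_ideal_mult f(1) ideal_multI[OF *(2,3)]])
    ultimately show "x * y * z \<in> ?Z" by (intro CollectI exI[of _ "\<lambda>a. f a * (y * z)"]) simp
  qed
  then have IZ: "I \<subseteq> ?Z" using J(2) by blast
  have "A \<subseteq> I" using I(1) span_superset by blast
  then have "A \<subseteq> {0} \<or> 1 \<in> E"
    using A IZ EE submodule_zero[OF sE] submodule_add[OF sE] submodule_diff[OF sE]
    by (intro finite_generators_idempotent_ring) auto
  moreover have "\<not> A \<subseteq> {0}"
  proof
    assume "A \<subseteq> {0}"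
    then have "I \<subseteq> {0}" unfolding I(1) by (intro span_least) (auto simp: is_submodule_def)
    then show False using I(3) submodule_zero[OF sI] by blast
  qed
  ultimately have 1: "1 \<in> E" by blast
  define T where "T = {x. \<forall>y\<in>I. \<forall>z\<in>I. x * y * z \<in> R}"
  have TT: "u * v \<in> T" if "u \<in> T" "v \<in> T" for u v
    using assms(6)[of u v] that by (simp add: T_def)
  have JT: "J \<subseteq> T"
    unfolding T_def
  proof safe
    fix j y z assume "j \<in> J" "y \<in> I" "z \<in> I"
    then have "y * z * j \<in> R" using J(3) I(2) by blast
    then show "j * y * z \<in> R" by (simp add: mult.assoc mult.left_commute mult.commute)
  qed
  have sT: "is_submodule R T"
    unfolding T_def is_submodule_def
    by (auto simp: algebra_simps)
  \<comment> \<open>Each term of \<open>t * (e * e')\<close> has the form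
    \<open>(t * y * y') * x * x'\<close> with \<open>x\<close>, \<open>x'\<close> in
    \<open>I\<close> and \<open>y\<close>, \<open>y'\<close> in \<open>J\<close>. The first factor
    lies in \<open>T\<close> by closure under products, and the other two then bring it into
    \<open>R\<close>.\<close>
  have key: "t * (e * e') \<in> R" if t: "t \<in> T" and e: "e \<in> E" "e' \<in> E" for t e e'
  proof -
    have "E \<subseteq> {w. \<forall>u\<in>{t * e'}. w * u \<in> R}" if *: "\<And>x. x \<in> I \<Longrightarrow> \<forall>y\<in>J. x * y * (t * e') \<in> R"
      unfolding E_def using * by (intro ideal_mult_least submodule_colon submodule_self) auto
    moreover have "\<forall>y\<in>J. x * y * (t * e') \<in> R" if x: "x \<in> I" for x
    proof
      fix y assume y: "y \<in> J"
      have "E \<subseteq> {w. \<forall>u\<in>{t * x * y}. w * u \<in> R}"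
        unfolding E_def
      proof (intro ideal_mult_least submodule_colon submodule_self)
        fix x' y' assume *: "x' \<in> I" "y' \<in> J"
        have "t * y * y' \<in> T" using TT t y *(2) JT by blast
        then have "t * y * y' * x * x' \<in> R" using x * by (simp add: T_def)
        then show "x' * y' \<in> {w. \<forall>u\<in>{t * x * y}. w * u \<in> R}"
          by (simp add: mult.assoc mult.left_commute mult.commute)
      qed
      then show "x * y * (t * e') \<in> R" using e by (auto simp: algebra_simps)
    qed
    ultimately show ?thesis using e by (auto simp: algebra_simps)
  qed
  have "J \<subseteq> R" using key[OF _ 1 1] JT by auto
  then have "E \<subseteq> I"
    unfolding E_def by (intro ideal_mult_least sI) (auto intro: submodule_scale_right[OF sI])
  then show ?thesis using 1 by blast
qed

text \<open>The module generated by a sequence of modules. Finite sums run over initial segments of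
  the indices, so two of them can be added after padding with zeros.\<close>

lemma submodule_partial_sums:
  assumes "\<And>i. is_submodule R (T i)"
  shows "is_submodule R {x. \<exists>n f. (\<forall>i. f i \<in> T i) \<and> x = (\<Sum>i<n::nat. f i)}" (is "is_submodule R ?L")
  unfolding is_submodule_def mem_Collect_eq Ball_def
proof (intro conjI allI impI; (elim exE conjE)?)
  show "\<exists>n f. (\<forall>i. f i \<in> T i) \<and> 0 = (\<Sum>i<n::nat. f i)"
    by (rule exI[of _ 0], rule exI[of _ "\<lambda>_. 0"]) (auto simp: submodule_zero assms)
next
  fix x y m n f g
  assume *: "\<forall>i. f i \<in> T i" "x = (\<Sum>i<m::nat. f i)" "\<forall>i. g i \<in> T i" "y = (\<Sum>i<n::nat. g i)"
  have pad: "(\<Sum>i<k. h i) = (\<Sum>i<m+n. if i < k then h i else 0)" if "k \<le> m + n" for k and h :: "nat \<Rightarrow> 'k"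
  proof -
    have "(\<Sum>i<m+n. if i < k then h i else 0) = (\<Sum>i\<in>{..<m+n} \<inter> {i. i < k}. h i)"
      by (subst sum.inter_restrict) auto
    also have "{..<m+n} \<inter> {i. i < k} = {..<k}" using that by auto
    finally show ?thesis by simp
  qed
  have "x + y = (\<Sum>i<m+n. (if i < m then f i else 0) + (if i < n then g i else 0))"
    unfolding sum.distrib *(2,4) by (simp add: pad[of m f] pad[of n g])
  moreover have "(if i < m then f i else 0) + (if i < n then g i else 0) \<in> T i" for i
    using * assms submodule_zero submodule_add by auto
  ultimately show "\<exists>n f. (\<forall>i. f i \<in> T i) \<and> x + y = (\<Sum>i<n::nat. f i)"
    by (intro exI[of _ "m + n"] exI[of _ "\<lambda>i. (if i < m then f i else 0) + (if i < n then g i else 0)"]) simp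
next
  fix r x m f
  assume "r \<in> R" "\<forall>i. f i \<in> T i" "x = (\<Sum>i<m::nat. f i)"
  then show "\<exists>n f. (\<forall>i. f i \<in> T i) \<and> r * x = (\<Sum>i<n::nat. f i)"
    by (intro exI[of _ m] exI[of _ "\<lambda>i. r * f i"]) (auto simp: sum_distrib_left submodule_scale assms)
qed

text \<open>Let \<open>T\<^sub>n = (R : I\<^sub>n\<^sup>2)\<close>, \<open>L = \<Sum>T\<^sub>n\<close> and \<open>L = L\<^sup>2H\<close>. Only finitely many \<open>T\<^sub>n\<close> are needed to write \<open>1\<close> as an
  element of \<open>L\<^sup>2H\<close>; at another \<open>I\<^sub>k\<close> these are locally trivial, so \<open>1 \<in> H\<close> locally and \<open>T\<^sub>k\<close> is a ring.\<close>

lemma comaximal_family_not_Clifford_regular: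
  fixes I :: "nat \<Rightarrow> 'k set"
  assumes reg: "Clifford_regular R" and a: "a \<noteq> 0" "\<And>n. a \<in> I n"
    and I: "\<And>n. finite (A n)" "\<And>n. I n = span (A n)" "\<And>n. I n \<subseteq> R" "\<And>n. 1 \<notin> I n"
    and comax: "\<And>m n. m \<noteq> n \<Longrightarrow> \<exists>p\<in>I m. \<exists>q\<in>I n. p + q = 1"
  shows False
proof -
  have sI: "is_submodule R (I n)" for n using I(2) submodule_span by simp
  define T where "T n = {x. \<forall>y\<in>I n. \<forall>z\<in>I n. x * y * z \<in> R}" for n
  \<comment> \<open>\<open>1 - e \<in> Q k\<close> expresses that \<open>e\<close> acts like 1 on
    products of two elements of \<open>T k\<close>: the error \<open>(1 - e) * u * v\<close> falls
    into \<open>R\<close>.\<close>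
  define Q where "Q k = {w. \<forall>u\<in>T k. \<forall>v\<in>T k. w * u * v \<in> R}" for k
  have TD: "x * y * z \<in> R" if "x \<in> T n" "y \<in> I n" "z \<in> I n" for x y z n
    using that by (simp add: T_def)
  have sT: "is_submodule R (T n)" for n
    unfolding T_def is_submodule_def by (auto simp: algebra_simps)
  have sQ: "is_submodule R (Q n)" for n
    unfolding Q_def is_submodule_def by (auto simp: algebra_simps)
  have RT: "R \<subseteq> T n" for n
    using I(3) unfolding T_def by blast
  have single: "\<exists>e\<in>R. (\<forall>x\<in>T i. e * x \<in> R) \<and> 1 - e \<in> Q k" if ik: "i \<noteq> k" for i k
  proof -
    obtain p q where pq: "p \<in> I i" "q \<in> I k" "p + q = 1" using comax[OF ik] by blast
    then have R: "p \<in> R" "q \<in> R" using I(3) by auto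
    \<comment> \<open>The square of (1 - q^4) / (1 - q). Since p = 1 - q, this gives p^2 c = (1 -
      q^4)^2, so 1 - p^2 c is divisible by q^4. The factor p^2 clears \<open>T i\<close>, and q^4
      clears a product of two elements of \<open>T k\<close>.\<close>
    define c where "c = ((1 + q) * (1 + q * q)) * ((1 + q) * (1 + q * q))"
    have c: "c \<in> R" unfolding c_def using R by (intro add_closed mult_closed one_closed)
    have 1: "1 - p * p * c = q * q * q * q * (1 + 1 - q * q * q * q)"
    proof -
      have p: "p = 1 - q" using pq(3) by (simp add: eq_diff_eq)
      have "p * ((1 + q) * (1 + q * q)) = 1 - q * q * q * q" unfolding p by (simp add: algebra_simps)
      moreover have "p * p * c = (p * ((1 + q) * (1 + q * q))) * (p * ((1 + q) * (1 + q * q)))"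
        unfolding c_def by (simp only: mult_ac)
      ultimately have "p * p * c = (1 - q * q * q * q) * (1 - q * q * q * q)" by simp
      then show ?thesis by (simp add: algebra_simps)
    qed
    have "p * p * c * x \<in> R" if "x \<in> T i" for x
    proof -
      have "x * p * p * c \<in> R" using TD[OF that pq(1,1)] c by (rule mult_closed)
      then show ?thesis by (simp only: mult_ac)
    qed
    moreover have "(1 - p * p * c) * u * v \<in> R" if "u \<in> T k" "v \<in> T k" for u v
    proof -
      have eq: "(1 - p * p * c) * u * v = (u * q * q) * (v * q * q) * (1 + 1 - q * q * q * q)"
        unfolding 1 by (simp only: mult_ac)
      have R2: "1 + 1 - q * q * q * q \<in> R"
        using R by (intro mult_closed add_closed diff_closed one_closed)
      have "(u * q * q) * (v * q * q) * (1 + 1 - q * q * q * q) \<in> R"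
        by (rule mult_closed[OF mult_closed[OF TD[OF that(1) pq(2,2)] TD[OF that(2) pq(2,2)]] R2])
      then show ?thesis unfolding eq .
    qed
    ultimately show ?thesis
      using R c by (intro bexI[of _ "p * p * c"] mult_closed conjI) (auto simp: Q_def)
  qed
  have many: "\<exists>e\<in>R. (\<forall>i\<in>F. \<forall>x\<in>T i. e * x \<in> R) \<and> 1 - e \<in> Q k" if "finite F" "k \<notin> F" for F k
    using that
  proof (induction F rule: finite_induct)
    case empty
    show ?case using submodule_zero[OF sQ] by (intro bexI[of _ 1]) auto
  next
    case (insert i F)
    then obtain e where e: "e \<in> R" "\<And>i x. i \<in> F \<Longrightarrow> x \<in> T i \<Longrightarrow> e * x \<in> R" "1 - e \<in> Q k" by blast
    obtain e' where e': "e' \<in> R" "\<And>x. x \<in> T i \<Longrightarrow> e' * x \<in> R" "1 - e' \<in> Q k"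
      using single[of i k] insert.prems by auto
    have "(1 - e') + e' * (1 - e) \<in> Q k" using e e' by (intro submodule_add[OF sQ] submodule_scale[OF sQ])
    then have "1 - e' * e \<in> Q k" by (simp add: algebra_simps)
    moreover have "e' * e * x \<in> R" if "j \<in> insert i F" "x \<in> T j" for j x
    proof (cases "j = i")
      case True
      then have "e * (e' * x) \<in> R" using that e e' by auto
      then show ?thesis by (simp add: mult_ac)
    next
      case False
      then show ?thesis using that e e' by (auto simp: mult.assoc)
    qed
    ultimately show ?case using e(1) e'(1) by (intro bexI[of _ "e' * e"]) auto
  qed
  define L where "L = {x. \<exists>n f. (\<forall>i. f i \<in> T i) \<and> x = (\<Sum>i<n::nat. f i)}"
  have sL: "is_submodule R L" unfolding L_def by (rule submodule_partial_sums[OF sT])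
  have TL: "x \<in> L" if "x \<in> T k" for x k
  proof -
    have "x = (\<Sum>i<Suc k. if i = k then x else 0)" by simp
    moreover have "(if i = k then x else 0) \<in> T i" for i using that submodule_zero[OF sT] by auto
    ultimately show ?thesis unfolding L_def mem_Collect_eq
      by (intro exI[of _ "Suc k"] exI[of _ "\<lambda>i. if i = k then x else 0"]) blast
  qed
  have "L \<in> nz_ideals R"
  proof (rule nz_idealsI[OF sL])
    show "1 \<in> L" using TL RT by blast
    show "a * a \<in> R" "a * a \<noteq> 0" using a I(3) by auto
    fix y assume "y \<in> L"
    then obtain n f where f: "\<And>i. f i \<in> T i" "y = (\<Sum>i<n::nat. f i)" by (auto simp: L_def)
    have "a * a * f i \<in> R" for i using TD[OF f(1) a(2) a(2), of i] by (simp add: mult_ac)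
    then show "a * a * y \<in> R" unfolding f(2) sum_distrib_left by (intro submodule_sum submodule_self)
  qed auto
  then have "vN_regular R L" using reg by (simp add: Clifford_regular_def)
  then obtain H where H: "H \<in> nz_ideals R" "L = ideal_mult R (ideal_mult R L L) H"
    "\<And>x y z. x \<in> L \<Longrightarrow> y \<in> L \<Longrightarrow> z \<in> H \<Longrightarrow> x * y * z \<in> L"
    using vN_regularD by blast
  note sH = nz_ideals_submodule[OF H(1)]
  \<comment> \<open>Two factors \<open>e\<close>, one for each of the two elements of
    \<open>L\<close> in a product from LLH. Once 1 is in \<open>W k\<close>, any such
    \<open>e\<close> yields \<open>e * e \<in> H\<close>.\<close>
  define W where "W k = {w. \<forall>e\<in>R. (\<forall>i<k. \<forall>x\<in>T i. e * x \<in> R) \<longrightarrow> e * e * w \<in> H}" for k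
  have W_mono: "W k \<subseteq> W l" if "k \<le> l" for k l
    using that unfolding W_def by (auto dest: order.strict_trans2)
  have sW: "is_submodule R (W k)" for k
    unfolding W_def is_submodule_def
    by (auto simp: distrib_left mult.left_commute submodule_zero[OF sH] submodule_add[OF sH] submodule_scale[OF sH])
  have "is_submodule R (\<Union>k. W k)"
    unfolding is_submodule_def
  proof (intro conjI ballI)
    show "0 \<in> (\<Union>k. W k)" using submodule_zero[OF sW] by blast
    show "x + y \<in> (\<Union>k. W k)" if "x \<in> (\<Union>k. W k)" "y \<in> (\<Union>k. W k)" for x y
    proof -
      from that obtain k l where "x \<in> W k" "y \<in> W l" by blast
      then have "x \<in> W (max k l)" "y \<in> W (max k l)"
        using W_mono[of k "max k l"] W_mono[of l "max k l"] by auto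
      then show ?thesis using submodule_add[OF sW] by blast
    qed
  qed (use submodule_scale[OF sW] in blast)
  moreover have "x * y * z \<in> (\<Union>k. W k)" if xyz: "x \<in> L" "y \<in> L" "z \<in> H" for x y z
  proof -
    obtain m f where f: "\<And>i. f i \<in> T i" "x = (\<Sum>i<m::nat. f i)" using xyz(1) by (auto simp: L_def)
    obtain n g where g: "\<And>i. g i \<in> T i" "y = (\<Sum>i<n::nat. g i)" using xyz(2) by (auto simp: L_def)
    have "x * y * z \<in> W (max m n)"
      unfolding W_def mem_Collect_eq
    proof (intro ballI impI)
      fix e assume e: "e \<in> R" "\<forall>i<max m n. \<forall>x\<in>T i. e * x \<in> R"
      have "e * f i \<in> R" if "i < m" for i using e(2) f(1)[of i] that by (auto simp: less_max_iff_disj)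
      then have ex: "e * x \<in> R"
        unfolding f(2) sum_distrib_left by (intro submodule_sum[OF submodule_self]) auto
      have "e * g i \<in> R" if "i < n" for i using e(2) g(1)[of i] that by (auto simp: less_max_iff_disj)
      then have ey: "e * y \<in> R"
        unfolding g(2) sum_distrib_left by (intro submodule_sum[OF submodule_self]) auto
      have "(e * x) * (e * y) * z \<in> H" by (rule submodule_scale[OF sH mult_closed[OF ex ey] xyz(3)])
      then show "e * e * (x * y * z) \<in> H" by (simp add: mult_ac)
    qed
    then show ?thesis by blast
  qed
  ultimately have "ideal_mult R (ideal_mult R L L) H \<subseteq> (\<Union>k. W k)" by (rule ideal_mult3_least)
  moreover have "1 \<in> L" by (rule TL[of _ 0]) (use RT in blast)
  ultimately obtain k where "1 \<in> W k" using H(2) by blast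
  \<comment> \<open>The index \<open>k\<close> is not below itself, so \<open>e\<close> can clear
    all \<open>T i\<close> with \<open>i < k\<close> and still act like 1 at
    \<open>T k\<close>.\<close>
  moreover obtain e where e: "e \<in> R" "\<forall>i\<in>{..<k}. \<forall>x\<in>T i. e * x \<in> R" "1 - e \<in> Q k"
    using many[of "{..<k}" k] by auto
  ultimately have eH: "e * e \<in> H" by (auto simp: W_def)
  \<comment> \<open>The product \<open>u * v * (e * e)\<close> is in \<open>L\<close>, and
    \<open>d\<close> clears all its summands except the one from \<open>T k\<close>. The rest,
    \<open>(1 - d * (e * e)) * u * v\<close>, is in \<open>R\<close> because
    \<open>1 - d * (e * e)\<close> is in \<open>Q k\<close>.\<close>
  have Tk: "u * v \<in> T k" if uv: "u \<in> T k" "v \<in> T k" for u v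
  proof -
    have "u * v * (e * e) \<in> L" by (intro H(3) eH TL[OF uv(1)] TL[OF uv(2)])
    then obtain n f where f: "\<And>i. f i \<in> T i" "u * v * (e * e) = (\<Sum>i<n::nat. f i)" by (auto simp: L_def)
    obtain d where d: "d \<in> R" "\<And>i x. i < n \<Longrightarrow> i \<noteq> k \<Longrightarrow> x \<in> T i \<Longrightarrow> d * x \<in> R" "1 - d \<in> Q k"
      using many[of "{..<n} - {k}" k] by auto
    have "d * (u * v * (e * e)) \<in> T k"
      unfolding f(2) sum_distrib_left
    proof (rule submodule_sum[OF sT])
      fix i assume i: "i \<in> {..<n}"
      show "d * f i \<in> T k"
      proof (cases "i = k")
        case True
        then show ?thesis using submodule_scale[OF sT d(1) f(1)] by simp
      next
        case False
        then show ?thesis using d(2)[of i "f i"] i f(1) RT by blast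
      qed
    qed
    moreover have "(1 - d) + d * ((1 - e) + e * (1 - e)) \<in> Q k"
      using d(1,3) e(1,3) by (intro submodule_add[OF sQ] submodule_scale[OF sQ])
    then have "1 - d * (e * e) \<in> Q k" by (simp add: algebra_simps)
    then have "(1 - d * (e * e)) * u * v \<in> T k" using uv RT by (auto simp: Q_def)
    ultimately have "d * (u * v * (e * e)) + (1 - d * (e * e)) * u * v \<in> T k" by (rule submodule_add[OF sT])
    then show ?thesis by (simp add: algebra_simps)
  qed
  have "I k \<in> nz_ideals R"
    using I(3)[of k] a by (intro nz_idealsI[OF sI, of a k 1]) auto
  then have "vN_regular R (I k)" "I k \<noteq> {0}" using reg by (auto simp: Clifford_regular_def nz_ideals_def)
  then have "1 \<in> I k"
    using finitely_generated_regular_eq_one[OF I(1,2,3)] Tk by (auto simp: T_def)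
  then show False using I(4) by blast
qed

section \<open>Maximal ideals and comaximal families\<close>

definition maximal_ideal :: "'k set \<Rightarrow> bool" where
  "maximal_ideal M \<longleftrightarrow> is_submodule R M \<and> M \<subseteq> R \<and> 1 \<notin> M \<and>
     (\<forall>N. is_submodule R N \<and> N \<subseteq> R \<and> 1 \<notin> N \<and> M \<subseteq> N \<longrightarrow> N = M)"

lemma maximal_ideal_eq:
  "maximal_ideal M \<Longrightarrow> is_submodule R N \<Longrightarrow> N \<subseteq> R \<Longrightarrow> M \<subseteq> N \<Longrightarrow> 1 \<notin> N \<Longrightarrow> N = M"
  by (simp add: maximal_ideal_def)

lemma ex_maximal_ideal:
  assumes "is_submodule R I" "I \<subseteq> R" "1 \<notin> I"
  shows "\<exists>M. maximal_ideal M \<and> I \<subseteq> M"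
proof -
  let ?A = "{N. is_submodule R N \<and> N \<subseteq> R \<and> 1 \<notin> N \<and> I \<subseteq> N}"
  have "\<exists>M\<in>?A. \<forall>X\<in>?A. M \<subseteq> X \<longrightarrow> X = M"
  proof (rule subset_Zorn_nonempty)
    fix C assume C: "C \<noteq> {}" "subset.chain ?A C"
    then have CA: "C \<subseteq> ?A" by (simp add: subset_chain_def)
    then have CD: "is_submodule R X" "X \<subseteq> R" "1 \<notin> X" "I \<subseteq> X" if "X \<in> C" for X using that by auto
    obtain X0 where X0: "X0 \<in> C" using C(1) by blast
    have "is_submodule R (\<Union>C)" by (rule submodule_chain_Union[OF C CD(1)])
    moreover have "I \<subseteq> \<Union>C" using CD(4)[OF X0] X0 by blast
    moreover have "\<Union>C \<subseteq> R" "1 \<notin> \<Union>C" using CD(2,3) by auto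
    ultimately show "\<Union>C \<in> ?A" by simp
  next
    have "I \<in> ?A" using assms by simp
    then show "?A \<noteq> {}" by blast
  qed
  then obtain M where M: "M \<in> ?A" and max: "\<forall>X\<in>?A. M \<subseteq> X \<longrightarrow> X = M" by (rule bexE)
  have "maximal_ideal M"
    unfolding maximal_ideal_def
  proof (intro conjI allI impI)
    fix N assume N: "is_submodule R N \<and> N \<subseteq> R \<and> 1 \<notin> N \<and> M \<subseteq> N"
    then have "N \<in> ?A" using M by auto
    then show "N = M" using max N by blast
  qed (use M in simp_all)
  then show ?thesis using M by blast
qed

lemma maximal_ideal_comaximal:
  assumes M: "maximal_ideal M" and x: "x \<in> R" "x \<notin> M"
  shows "\<exists>r\<in>R. 1 - r * x \<in> M"
proof -
  have sM: "is_submodule R M" and MR: "M \<subseteq> R" using M by (auto simp: maximal_ideal_def)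
  let ?N = "{y. \<exists>m\<in>M. \<exists>u\<in>{r * x |r. r \<in> R}. y = m + u}"
  have N: "is_submodule R ?N" by (intro submodule_plus submodule_principal sM)
  have NR: "?N \<subseteq> R" using MR x by auto
  have MN: "M \<subseteq> ?N" using submodule_zero[OF submodule_principal[of x]] by force
  have "1 * x \<in> {r * x |r. r \<in> R}" by blast
  then have "x \<in> ?N" using submodule_zero[OF sM] by force
  then have "1 \<in> ?N" using maximal_ideal_eq[OF M N NR MN] x(2) by blast
  then obtain m r where mr: "m \<in> M" "r \<in> R" "1 = m + r * x" by blast
  have "1 - r * x = m" unfolding mr(3) by simp
  then show ?thesis using mr by blast
qed

text \<open>A form of the Chinese remainder theorem: an element \<open>c\<close> of all ideals in
  \<open>F\<close> with \<open>1 - c\<close> in \<open>M\<close> is built factor by factor, and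
  \<open>1 - c\<close> then avoids every ideal in \<open>F\<close>.\<close>

lemma maximal_ideals_avoid:
  assumes "finite F" "\<And>N. N \<in> F \<Longrightarrow> maximal_ideal N" and M: "maximal_ideal M" "M \<notin> F"
  shows "\<exists>b\<in>M. \<forall>N\<in>F. b \<notin> N"
proof -
  have sM: "is_submodule R M" and MR: "M \<subseteq> R" using M by (auto simp: maximal_ideal_def)
  have "\<exists>c\<in>R. 1 - c \<in> M \<and> (\<forall>N\<in>F. c \<in> N)"
    using assms(1,2,4)
  proof (induction F rule: finite_induct)
    case empty
    show ?case using submodule_zero[OF sM] by (intro bexI[of _ 1]) auto
  next
    case (insert N F)
    have "\<exists>c\<in>R. 1 - c \<in> M \<and> (\<forall>N\<in>F. c \<in> N)"
      by (rule insert.IH) (use insert.prems in simp_all)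
    then obtain c where c: "c \<in> R" "1 - c \<in> M" "\<forall>N\<in>F. c \<in> N" by blast
    have N: "maximal_ideal N" "N \<noteq> M" using insert.prems by auto
    have "\<not> N \<subseteq> M" using maximal_ideal_eq[OF N(1) sM MR] N(2) M(1) by (auto simp: maximal_ideal_def)
    then obtain x where x: "x \<in> N" "x \<notin> M" by blast
    have sN: "is_submodule R N" "N \<subseteq> R" using N by (auto simp: maximal_ideal_def)
    obtain r where r: "r \<in> R" "1 - r * x \<in> M"
      using maximal_ideal_comaximal[OF M(1) subsetD[OF sN(2) x(1)] x(2)] by blast
    have "(1 - c) + c * (1 - r * x) \<in> M" using c r by (intro submodule_add[OF sM] submodule_scale[OF sM])
    then have "1 - c * (r * x) \<in> M" by (simp add: algebra_simps)
    moreover have "c * (r * x) \<in> N'" if "N' \<in> insert N F" for N'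
    proof (cases "N' = N")
      case True
      then show ?thesis using submodule_scale[OF sN(1) c(1) submodule_scale[OF sN(1) r(1) x(1)]] by simp
    next
      case False
      then have cN: "c \<in> N'" using that c(3) by blast
      have "maximal_ideal N'" using insert.prems(1) that .
      then have sN': "is_submodule R N'" by (simp add: maximal_ideal_def)
      have "r * x \<in> R" using r(1) subsetD[OF sN(2) x(1)] by (rule mult_closed)
      then show ?thesis using cN by (rule submodule_scale_right[OF sN'])
    qed
    ultimately show ?case using c(1) r(1) x(1) sN(2) by (intro bexI[of _ "c * (r * x)"] conjI ballI mult_closed) auto
  qed
  then obtain c where c: "1 - c \<in> M" "\<forall>N\<in>F. c \<in> N" by blast
  have "1 - c \<notin> N" if "N \<in> F" for N
  proof
    assume "1 - c \<in> N"
    moreover have N: "is_submodule R N" "1 \<notin> N" using assms(2)[OF that] by (auto simp: maximal_ideal_def)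
    ultimately have "(1 - c) + c \<in> N" using c(2) that by (intro submodule_add) auto
    then show False using N by simp
  qed
  then show ?thesis using c(1) by blast
qed

text \<open>The pairwise comaximal ideals come from the finitely generated ideals that lie in a unique
  maximal ideal: if there are too few of these, repeated splitting produces the family.\<close>

lemma infinite_maximal_ideals_comaximal_family:
  assumes a: "a \<in> R" and inf: "infinite {M. maximal_ideal M \<and> a \<in> M}"
  shows "\<exists>I A. (\<forall>n::nat. finite (A n) \<and> I n = span (A n) \<and> I n \<subseteq> R \<and> 1 \<notin> I n \<and> a \<in> I n) \<and>
    (\<forall>m n. m \<noteq> n \<longrightarrow> (\<exists>p\<in>I m. \<exists>q\<in>I n. p + q = 1))"
proof (rule ccontr)
  assume no: "\<not> ?thesis"
  define P where "P I \<longleftrightarrow> (\<exists>A. finite A \<and> I = span A) \<and> I \<subseteq> R \<and> 1 \<notin> I \<and> a \<in> I" for I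
  define comax where "comax I J \<longleftrightarrow> (\<exists>p\<in>I. \<exists>q\<in>J. p + q = 1)" for I J :: "'k set"
  have noseq: False if I: "\<And>n. P (I n)" and co: "\<And>m n. m < n \<Longrightarrow> comax (I m) (I n)" for I :: "nat \<Rightarrow> _"
  proof -
    obtain A where A: "\<And>n. finite (A n) \<and> I n = span (A n)" using I unfolding P_def by metis
    have "comax (I m) (I n)" if "m \<noteq> n" for m n
      using co[of m n] co[of n m] that unfolding comax_def
      by (metis add.commute nat_neq_iff)
    then show False using no A I unfolding comax_def P_def by blast
  qed
  have sP: "is_submodule R I" if "P I" for I using that submodule_span by (auto simp: P_def)
  have P_insert: "P (span (insert b I))" if I: "P I" "I \<subseteq> M" and M: "maximal_ideal M" "b \<in> M" for I M b
  proof -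
    obtain A where A: "finite A" "I = span A" using I(1) by (auto simp: P_def)
    have M': "is_submodule R M" "M \<subseteq> R" "1 \<notin> M" using M by (auto simp: maximal_ideal_def)
    have "span (insert b I) = span (insert b A)" unfolding A(2) by (rule hull_insert[symmetric])
    moreover have "span (insert b I) \<subseteq> M" using I M M' by (intro span_least) auto
    moreover have "a \<in> span (insert b I)" using I by (auto simp: P_def intro: span_superset)
    ultimately show ?thesis unfolding P_def using A M' by (metis finite_insert subset_iff)
  qed
  define hom where "hom H \<longleftrightarrow> P H \<and> (\<forall>M N. maximal_ideal M \<and> maximal_ideal N \<and> H \<subseteq> M \<and> H \<subseteq> N \<longrightarrow> M = N)" for H
  have ex_hom: "\<exists>H. hom H \<and> I \<subseteq> H" if I: "P I" for I
  proof (rule ccontr)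
    assume nohom: "\<not> (\<exists>H. hom H \<and> I \<subseteq> H)"
    \<comment> \<open>Two maximal ideals over \<open>J\<close> are told apart by some
      \<open>r * b\<close> in the first with \<open>1 - r * b\<close> in the second. Adjoining
      either element to \<open>J\<close> gives two proper comaximal ideals.\<close>
    have split: "\<exists>X. P (fst X) \<and> P (snd X) \<and> I \<subseteq> snd X \<and> J \<subseteq> fst X \<and> J \<subseteq> snd X \<and> comax (fst X) (snd X)"
      if J: "P J" "I \<subseteq> J" for J
    proof -
      obtain M N where MN: "maximal_ideal M" "maximal_ideal N" "J \<subseteq> M" "J \<subseteq> N" "M \<noteq> N"
      proof -
        have "\<not> hom J" using nohom J(2) by blast
        then show thesis using that J(1) unfolding hom_def by blast
      qed
      then have "\<not> M \<subseteq> N" using maximal_ideal_eq[OF MN(1), of N] by (auto simp: maximal_ideal_def)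
      then obtain b where b: "b \<in> M" "b \<notin> N" by blast
      moreover have MR: "is_submodule R M" "M \<subseteq> R" using MN by (auto simp: maximal_ideal_def)
      ultimately obtain r where r: "r \<in> R" "1 - r * b \<in> N" using maximal_ideal_comaximal[OF MN(2)] by blast
      have rb: "r * b \<in> M" using b r MR submodule_scale by blast
      have "comax (span (insert (r * b) J)) (span (insert (1 - r * b) J))"
        unfolding comax_def
        by (-, rule bexI[of _ "r * b"], rule bexI[of _ "1 - r * b"]) (auto intro: span_superset)
      then show ?thesis
        using P_insert[OF J(1) MN(3,1) rb] P_insert[OF J(1) MN(4,2) r(2)] J
        by (intro exI[of _ "(span (insert (r * b) J), span (insert (1 - r * b) J))"])
          (auto intro: span_superset)
    qed
    \<comment> \<open>\<open>fst (f n)\<close> goes into the family and \<open>snd (f n)\<close> is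
      split further. Every later member contains \<open>snd (f n)\<close>, which is comaximal with
      \<open>fst (f n)\<close> for positive \<open>n\<close>.\<close>
    have "\<exists>f :: nat \<Rightarrow> _. \<forall>n. (P (fst (f n)) \<and> P (snd (f n)) \<and> I \<subseteq> snd (f n)) \<and>
      (snd (f n) \<subseteq> fst (f (Suc n)) \<and> snd (f n) \<subseteq> snd (f (Suc n)) \<and> comax (fst (f (Suc n))) (snd (f (Suc n))))"
    proof (rule dependent_nat_choice)
      show "\<exists>X. P (fst X) \<and> P (snd X) \<and> I \<subseteq> snd X" using I by (intro exI[of _ "(I, I)"]) simp
    qed (use split in blast)
    then obtain f :: "nat \<Rightarrow> _" where f: "\<And>n. P (fst (f n))" "\<And>n. snd (f n) \<subseteq> fst (f (Suc n))"
      "\<And>n. snd (f n) \<subseteq> snd (f (Suc n))" "\<And>n. comax (fst (f (Suc n))) (snd (f (Suc n)))" by blast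
    have mono: "snd (f m) \<subseteq> snd (f n)" if "m \<le> n" for m n
      using lift_Suc_mono_le[of "\<lambda>n. snd (f n)"] f(3) that by blast
    show False
    \<comment> \<open>The shift drops the initial pair, whose components need not be
      comaximal.\<close>
    proof (rule noseq[of "\<lambda>n. fst (f (Suc n))"])
      fix m n :: nat assume "m < n"
      then have "snd (f (Suc m)) \<subseteq> fst (f (Suc n))" using mono[of "Suc m" n] f(2)[of n] by auto
      then show "comax (fst (f (Suc m))) (fst (f (Suc n)))" using f(4)[of m] unfolding comax_def by blast
    qed (rule f)
  qed
  define X where "X = {M. maximal_ideal M \<and> (\<exists>H. hom H \<and> H \<subseteq> M)}"
  \<comment> \<open>If \<open>H m\<close> and \<open>H n\<close> lie in different single maximal
    ideals, no maximal ideal contains both, so they are comaximal. Infinitely many of them would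
    form the excluded family.\<close>
  have "finite X"
  proof (rule ccontr)
    assume "infinite X"
    then obtain M :: "nat \<Rightarrow> _" where M: "inj M" "range M \<subseteq> X" using infinite_countable_subset by blast
    then have "\<And>n. \<exists>H. maximal_ideal (M n) \<and> hom H \<and> H \<subseteq> M n" unfolding X_def by blast
    then obtain H where H: "\<And>n. maximal_ideal (M n)" "\<And>n. hom (H n)" "\<And>n. H n \<subseteq> M n" by metis
    show False
    proof (rule noseq)
      fix n show "P (H n)" using H(2) by (simp add: hom_def)
    next
      fix m n :: nat assume "m < n"
      then have ne: "M m \<noteq> M n" using M(1) by (auto dest: injD)
      have s: "is_submodule R (H m)" "is_submodule R (H n)" using H(2) sP by (auto simp: hom_def)
      let ?S = "{x. \<exists>p\<in>H m. \<exists>q\<in>H n. x = p + q}"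
      have "is_submodule R ?S" using s by (rule submodule_plus)
      moreover have "H n \<subseteq> R" for n using H(2) by (simp add: hom_def P_def)
      then have "?S \<subseteq> R" by blast
      moreover have "H m \<subseteq> ?S" "H n \<subseteq> ?S"
        using submodule_zero[OF s(1)] submodule_zero[OF s(2)] by (force intro: bexI[of _ 0])+
      moreover have "\<not> (maximal_ideal N \<and> H m \<subseteq> N \<and> H n \<subseteq> N)" for N
        using H ne unfolding hom_def by metis
      ultimately have "1 \<in> ?S" using ex_maximal_ideal[of ?S] by (meson subset_trans)
      then show "comax (H m) (H n)" by (auto simp: comax_def)
    qed
  qed
  \<comment> \<open>A maximal ideal \<open>M\<close> outside the finite set \<open>X\<close>
    contains some \<open>b\<close> that avoids all of \<open>X\<close>. An ideal with
    \<open>hom\<close> above (a, b) would lie in a member of \<open>X\<close> that contains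
    \<open>b\<close>.\<close>
  moreover have "{M. maximal_ideal M \<and> a \<in> M} \<subseteq> X"
  proof (safe, rule ccontr)
    fix M assume M: "maximal_ideal M" "a \<in> M" "M \<notin> X"
    obtain b where b: "b \<in> M" "\<forall>N\<in>X. b \<notin> N"
      using maximal_ideals_avoid[OF \<open>finite X\<close> _ M(1,3)] by (auto simp: X_def)
    have M': "is_submodule R M" "M \<subseteq> R" "1 \<notin> M" using M by (auto simp: maximal_ideal_def)
    have "span {a, b} \<subseteq> M" using b M M' by (intro span_least) auto
    then have "P (span {a, b})"
      using M' unfolding P_def by (auto intro!: exI[of _ "{a, b}"] span_superset)
    then obtain H where H: "hom H" "span {a, b} \<subseteq> H" using ex_hom by blast
    have "is_submodule R H" "H \<subseteq> R" "1 \<notin> H" using H(1) sP by (auto simp: hom_def P_def)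
    then obtain N where N: "maximal_ideal N" "H \<subseteq> N" using ex_maximal_ideal by blast
    moreover have "b \<in> span {a, b}" by (auto intro: span_superset)
    ultimately show False using b(2) H unfolding X_def by blast
  qed
  ultimately show False using inf finite_subset by blast
qed

theorem Clifford_regular_finite_character:
  assumes "Clifford_regular R" "a \<in> R" "a \<noteq> 0"
  shows "finite {M. maximal_ideal M \<and> a \<in> M}"
proof (rule ccontr)
  assume "infinite {M. maximal_ideal M \<and> a \<in> M}"
  from infinite_maximal_ideals_comaximal_family[OF assms(2) this] obtain I A
    where I: "\<forall>n::nat. finite (A n) \<and> I n = span (A n) \<and> I n \<subseteq> R \<and> 1 \<notin> I n \<and> a \<in> I n"
    and co: "\<forall>m n. m \<noteq> n \<longrightarrow> (\<exists>p\<in>I m. \<exists>q\<in>I n. p + q = 1)"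
    by (elim exE conjE)
  show False
    by (rule comaximal_family_not_Clifford_regular[OF assms(1,3), of I A]) (use I co in blast)+
qed

end

subsection \<open>The \<open>t\<close>- and \<open>w\<close>-operation\<close>

locale fraction_domain =
  fixes R :: "'k::field set"
  assumes dom: "domain_with_fraction_field R"
begin

sublocale subdom R
  using dom by unfold_locales (simp add: domain_with_fraction_field_def)

lemma ex_fraction: "\<exists>a\<in>R. \<exists>b\<in>R. b \<noteq> 0 \<and> x = a / b"
  using dom by (simp add: domain_with_fraction_field_def)

lemma nz_ideals_Int_ring:
  assumes "I \<in> nz_ideals R"
  shows "\<exists>c\<in>I \<inter> R. c \<noteq> 0"
proof -
  obtain i where "i \<in> I" "i \<noteq> 0" using nz_ideals_nonzero[OF assms] by blast
  moreover obtain d where "d \<in> R" "d \<noteq> 0" "\<forall>x\<in>I. d * x \<in> R"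
    using nz_ideals_denominator[OF assms] by blast
  ultimately show ?thesis
    using submodule_scale[OF nz_ideals_submodule[OF assms], of d i] by (intro bexI[of _ "d * i"]) auto
qed

lemma nz_ideals_integral: "is_submodule R I \<Longrightarrow> I \<subseteq> R \<Longrightarrow> x \<in> I \<Longrightarrow> x \<noteq> 0 \<Longrightarrow> I \<in> nz_ideals R"
  by (rule nz_idealsI[of I x 1]) auto

lemma ideal_mult_nz_ideals:
  assumes "I \<in> nz_ideals R" "J \<in> nz_ideals R"
  shows "ideal_mult R I J \<in> nz_ideals R"
proof -
  obtain x y where "x \<in> I" "x \<noteq> 0" "y \<in> J" "y \<noteq> 0" using assms nz_ideals_nonzero by blast
  then have xy: "x * y \<in> ideal_mult R I J" "x * y \<noteq> 0" by (auto intro: ideal_multI)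
  obtain d where d: "d \<in> R" "d \<noteq> 0" "\<forall>x\<in>I. d * x \<in> R" using nz_ideals_denominator[OF assms(1)] by blast
  obtain e where e: "e \<in> R" "e \<noteq> 0" "\<forall>x\<in>J. e * x \<in> R" using nz_ideals_denominator[OF assms(2)] by blast
  have "ideal_mult R I J \<subseteq> {z. \<forall>u\<in>{d * e}. z * u \<in> R}"
  proof (rule ideal_mult_least[OF submodule_colon[OF submodule_self]])
    fix u v assume "u \<in> I" "v \<in> J"
    then have "d * u \<in> R" "e * v \<in> R" using d e by auto
    then have "(d * u) * (e * v) \<in> R" by (rule mult_closed)
    then show "u * v \<in> {z. \<forall>u\<in>{d * e}. z * u \<in> R}" by (simp add: mult_ac)
  qed
  then show ?thesis
    using d e by (intro nz_idealsI[OF submodule_ideal_mult xy, of "d * e"]) (auto simp: mult.commute)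
qed

section \<open>The \<open>v\<close>-operation on arbitrary subsets\<close>

lemma v_op_iff: "x \<in> v_op R A \<longleftrightarrow> (\<forall>z. (\<forall>a\<in>A. z * a \<in> R) \<longrightarrow> x * z \<in> R)"
  by (simp add: v_op_def ideal_quot_def)

text \<open>Lets finite generating sets replace finitely generated ideals in all later arguments
  about \<open>v\<close> and \<open>t\<close>.\<close>

lemma v_op_span: "v_op R (span A) = v_op R A"
proof -
  have "(\<forall>a\<in>span A. z * a \<in> R) \<longleftrightarrow> (\<forall>a\<in>A. z * a \<in> R)" for z
  proof
    assume "\<forall>a\<in>A. z * a \<in> R"
    then have "span A \<subseteq> {x. \<forall>y\<in>{z}. x * y \<in> R}"
      by (intro span_least submodule_colon submodule_self) (auto simp: mult.commute)
    then show "\<forall>a\<in>span A. z * a \<in> R" by (auto simp: mult.commute)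
  qed (auto intro: span_superset)
  then show ?thesis by (auto simp: v_op_iff)
qed

lemma v_op_superset: "A \<subseteq> v_op R A"
  by (auto simp: v_op_iff) (metis mult.commute)

lemma v_op_le: "A \<subseteq> v_op R B \<Longrightarrow> v_op R A \<subseteq> v_op R B"
  unfolding subset_iff v_op_iff by (metis mult.commute)

lemma v_op_mono: "A \<subseteq> B \<Longrightarrow> v_op R A \<subseteq> v_op R B"
  using v_op_superset[of B] by (intro v_op_le) auto

lemma v_op_subset_ring: "A \<subseteq> R \<Longrightarrow> v_op R A \<subseteq> R"
  unfolding subset_iff v_op_iff by (metis mult_1 mult.commute)

lemma submodule_v_op: "is_submodule R (v_op R A)"
  unfolding v_op_def ideal_quot_def by (rule submodule_colon[OF submodule_self])

text \<open>One factor is exchanged at a time: if z AB lies in \<open>R\<close>, then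
  \<open>z * a\<close> multiplies \<open>B\<close>, hence also \<open>t\<close>, into
  \<open>R\<close>; so \<open>z * t\<close> multiplies \<open>A\<close>, hence also
  \<open>s\<close>, into \<open>R\<close>.\<close>

lemma v_op_mult:
  assumes "s \<in> v_op R A" "t \<in> v_op R B"
  shows "s * t \<in> v_op R {a * b |a b. a \<in> A \<and> b \<in> B}"
  unfolding v_op_iff
proof (intro allI impI)
  fix z assume z: "\<forall>c\<in>{a * b |a b. a \<in> A \<and> b \<in> B}. z * c \<in> R"
  have "t * (z * a) \<in> R" if "a \<in> A" for a
  proof -
    have "\<forall>b\<in>B. z * (a * b) \<in> R" using z that by blast
    then show ?thesis using assms(2) unfolding v_op_iff by (simp add: mult.assoc)
  qed
  then have "\<forall>a\<in>A. (t * z) * a \<in> R" by (simp add: mult.assoc)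
  then have "s * (t * z) \<in> R" using assms(1) unfolding v_op_iff by blast
  then show "s * t * z \<in> R" by (simp add: mult.assoc)
qed

lemma t_op_iff:
  assumes I: "I \<in> nz_ideals R"
  shows "x \<in> t_op R I \<longleftrightarrow> (\<exists>A. finite A \<and> A \<subseteq> I \<and> x \<in> v_op R A)"
proof
  assume "x \<in> t_op R I"
  then obtain A where "finite A" "span A \<subseteq> I" "x \<in> v_op R (span A)"
    by (auto simp: t_op_def finitely_generated_def)
  then show "\<exists>A. finite A \<and> A \<subseteq> I \<and> x \<in> v_op R A"
    using v_op_span span_superset by (intro exI[of _ A]) auto
next
  assume "\<exists>A. finite A \<and> A \<subseteq> I \<and> x \<in> v_op R A"
  then obtain A where A: "finite A" "A \<subseteq> I" "x \<in> v_op R A" by blast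
  obtain i where i: "i \<in> I" "i \<noteq> 0" using nz_ideals_nonzero[OF I] by blast
  obtain d where d: "d \<in> R" "d \<noteq> 0" "\<forall>x\<in>I. d * x \<in> R" using nz_ideals_denominator[OF I] by blast
  \<comment> \<open>The definition of \<open>t_op\<close> admits nonzero ideals only, and
    \<open>A\<close> may be empty or consist of 0. Adding a nonzero \<open>i\<close> from
    \<open>I\<close> can only enlarge the \<open>v\<close>-closure.\<close>
  let ?J = "span (insert i A)"
  have JI: "?J \<subseteq> I" using A i by (intro span_least nz_ideals_submodule[OF I]) auto
  have "?J \<in> nz_ideals R"
  proof (rule nz_idealsI[OF submodule_span _ i(2) d(1,2)])
    show "i \<in> ?J" by (rule span_superset) simp
    show "d * y \<in> R" if "y \<in> ?J" for y using that d(3) JI by blast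
  qed
  moreover have "finitely_generated R ?J"
    using A(1) unfolding finitely_generated_def by (intro exI[of _ "insert i A"]) simp
  moreover have "x \<in> v_op R ?J" using A(3) v_op_mono[of A "insert i A"] unfolding v_op_span by blast
  ultimately show "x \<in> t_op R I" using JI unfolding t_op_def by blast
qed

lemma t_op_superset: "I \<in> nz_ideals R \<Longrightarrow> I \<subseteq> t_op R I"
proof
  fix x assume "I \<in> nz_ideals R" "x \<in> I"
  then show "x \<in> t_op R I" using v_op_superset[of "{x}"] by (auto simp: t_op_iff intro!: exI[of _ "{x}"])
qed

lemma t_op_subset_ring: "I \<in> nz_ideals R \<Longrightarrow> I \<subseteq> R \<Longrightarrow> t_op R I \<subseteq> R"
proof
  fix x assume I: "I \<in> nz_ideals R" "I \<subseteq> R" and x: "x \<in> t_op R I"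
  obtain A where "A \<subseteq> I" "x \<in> v_op R A" using x unfolding t_op_iff[OF I(1)] by blast
  then have "A \<subseteq> R" "x \<in> v_op R A" using I(2) by auto
  then show "x \<in> R" using v_op_subset_ring by blast
qed

section \<open>Ideals closed under \<open>t\<close>, \<open>t\<close>-primes and
  \<open>t\<close>-maximal ideals\<close>

lemma t_ideal_iff:
  "t_ideal R I \<longleftrightarrow> I \<in> nz_ideals R \<and> (\<forall>A. finite A \<longrightarrow> A \<subseteq> I \<longrightarrow> v_op R A \<subseteq> I)"
proof (cases "I \<in> nz_ideals R")
  case True
  have "t_op R I = I \<longleftrightarrow> t_op R I \<subseteq> I" using t_op_superset[OF True] by blast
  also have "\<dots> \<longleftrightarrow> (\<forall>A. finite A \<longrightarrow> A \<subseteq> I \<longrightarrow> v_op R A \<subseteq> I)"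
    unfolding subset_iff t_op_iff[OF True] by blast
  finally show ?thesis using True by (simp add: t_ideal_def)
qed (simp add: t_ideal_def)

lemma t_idealD: "t_ideal R I \<Longrightarrow> finite A \<Longrightarrow> A \<subseteq> I \<Longrightarrow> v_op R A \<subseteq> I"
  by (simp add: t_ideal_iff)

lemma t_ideal_nz: "t_ideal R I \<Longrightarrow> I \<in> nz_ideals R"
  by (simp add: t_ideal_def)

lemma t_ideal_t_op:
  assumes I: "I \<in> nz_ideals R"
  shows "t_ideal R (t_op R I)"
  unfolding t_ideal_iff
proof (intro conjI allI impI)
  have "is_submodule R (t_op R I)"
    unfolding is_submodule_def t_op_iff[OF I] Ball_def
  proof (intro conjI allI impI; (elim exE conjE)?)
    show "\<exists>A. finite A \<and> A \<subseteq> I \<and> 0 \<in> v_op R A"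
      using submodule_zero[OF submodule_v_op] by (intro exI[of _ "{}"]) simp
  next
    fix x y A B assume "finite A" "A \<subseteq> I" "x \<in> v_op R A" "finite B" "B \<subseteq> I" "y \<in> v_op R B"
    then show "\<exists>A. finite A \<and> A \<subseteq> I \<and> x + y \<in> v_op R A"
      using v_op_mono[of A "A \<union> B"] v_op_mono[of B "A \<union> B"] submodule_add[OF submodule_v_op, of x "A \<union> B" y]
      by (intro exI[of _ "A \<union> B"]) auto
  next
    fix r x A assume "r \<in> R" "finite A" "A \<subseteq> I" "x \<in> v_op R A"
    then show "\<exists>A. finite A \<and> A \<subseteq> I \<and> r * x \<in> v_op R A"
      using submodule_scale[OF submodule_v_op] by (intro exI[of _ A]) auto
  qed
  moreover obtain i where i: "i \<in> I" "i \<noteq> 0" using nz_ideals_nonzero[OF I] by blast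
  moreover obtain d where d: "d \<in> R" "d \<noteq> 0" "\<forall>x\<in>I. d * x \<in> R" using nz_ideals_denominator[OF I] by blast
  moreover have "d * x \<in> R" if "x \<in> t_op R I" for x
  proof -
    obtain A where A: "A \<subseteq> I" "x \<in> v_op R A" using t_op_iff[OF I] \<open>x \<in> t_op R I\<close> by blast
    then have "\<forall>a\<in>A. d * a \<in> R" using d by blast
    then show ?thesis using A(2) unfolding v_op_iff by (simp add: mult.commute)
  qed
  ultimately show "t_op R I \<in> nz_ideals R"
    using t_op_superset[OF I] by (intro nz_idealsI[of _ i d]) auto
next
  fix A assume A: "finite A" "A \<subseteq> t_op R I"
  then have "\<forall>a\<in>A. \<exists>B. finite B \<and> B \<subseteq> I \<and> a \<in> v_op R B" using t_op_iff[OF I] by blast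
  then obtain B where B: "\<And>a. a \<in> A \<Longrightarrow> finite (B a) \<and> B a \<subseteq> I \<and> a \<in> v_op R (B a)" by metis
  have "A \<subseteq> v_op R (\<Union>a\<in>A. B a)"
  proof
    fix a assume "a \<in> A"
    then show "a \<in> v_op R (\<Union>a\<in>A. B a)" using B v_op_mono[of "B a" "\<Union>a\<in>A. B a"] by blast
  qed
  then have "v_op R A \<subseteq> v_op R (\<Union>a\<in>A. B a)" by (rule v_op_le)
  moreover have "finite (\<Union>a\<in>A. B a)" "(\<Union>a\<in>A. B a) \<subseteq> I" using A(1) B by auto
  ultimately show "v_op R A \<subseteq> t_op R I" using t_op_iff[OF I] by blast
qed

lemma t_ideal_principal:
  assumes "b \<in> R" "b \<noteq> 0"
  shows "t_ideal R {r * b |r. r \<in> R}"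
  unfolding t_ideal_iff
proof (intro conjI allI impI)
  have "1 * b \<in> {r * b |r. r \<in> R}" by blast
  then show "{r * b |r. r \<in> R} \<in> nz_ideals R"
    using assms by (intro nz_ideals_integral[of _ b] submodule_principal) auto
  fix A assume A: "A \<subseteq> {r * b |r. r \<in> R}"
  have "\<forall>a\<in>A. (1 / b) * a \<in> R" using A assms by auto
  then have "x * (1 / b) \<in> R" if "x \<in> v_op R A" for x using that unfolding v_op_iff by blast
  moreover have "x = x * (1 / b) * b" for x using assms by simp
  ultimately show "v_op R A \<subseteq> {r * b |r. r \<in> R}" by blast
qed

lemma is_primeD:
  assumes "is_prime R P"
  shows "is_submodule R P" "P \<subseteq> R" "1 \<notin> P" "\<And>a b. a \<in> R \<Longrightarrow> b \<in> R \<Longrightarrow> a * b \<in> P \<Longrightarrow> a \<in> P \<or> b \<in> P"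
proof -
  show sP: "is_submodule R P" and PR: "P \<subseteq> R"
    and "\<And>a b. a \<in> R \<Longrightarrow> b \<in> R \<Longrightarrow> a * b \<in> P \<Longrightarrow> a \<in> P \<or> b \<in> P"
    using assms by (auto simp: is_prime_def is_ideal_def)
  show "1 \<notin> P"
  proof
    assume "1 \<in> P"
    then have "R \<subseteq> P" using submodule_scale[OF sP, of _ 1] by auto
    then show False using assms by (auto simp: is_prime_def)
  qed
qed

text \<open>Krull's argument works for \<open>t\<close> because \<open>t\<close> is determined by
  finite sets, so unions of chains are again \<open>t\<close>-ideals. \<open>S = {1}\<close>
  produces \<open>t\<close>-maximal ideals; products of the complements of two primes produce a
  \<open>t\<close>-prime inside both.\<close>

lemma ex_t_prime_avoiding:
  assumes S: "1 \<in> S" "\<And>s t. s \<in> S \<Longrightarrow> t \<in> S \<Longrightarrow> s * t \<in> S"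
    and I: "t_ideal R I" "I \<subseteq> R" "I \<inter> S = {}"
  shows "\<exists>P. t_prime R P \<and> I \<subseteq> P \<and> P \<inter> S = {} \<and>
    (\<forall>N. t_ideal R N \<and> N \<subseteq> R \<and> N \<inter> S = {} \<and> P \<subseteq> N \<longrightarrow> N = P)"
proof -
  let ?A = "{N. t_ideal R N \<and> N \<subseteq> R \<and> N \<inter> S = {} \<and> I \<subseteq> N}"
  have "\<exists>P\<in>?A. \<forall>X\<in>?A. P \<subseteq> X \<longrightarrow> X = P"
  proof (rule subset_Zorn_nonempty)
    have "I \<in> ?A" using I by simp
    then show "?A \<noteq> {}" by blast
    fix C assume C: "C \<noteq> {}" "subset.chain ?A C"
    then have "C \<subseteq> ?A" by (simp add: subset_chain_def)
    then have CD: "t_ideal R X" "X \<subseteq> R" "X \<inter> S = {}" "I \<subseteq> X" if "X \<in> C" for X using that by auto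
    note CD' = CD(1)[THEN t_ideal_nz, THEN nz_ideals_submodule]
    obtain X0 where X0: "X0 \<in> C" using C(1) by blast
    have "is_submodule R (\<Union>C)" by (rule submodule_chain_Union[OF C CD'])
    moreover have CR: "\<Union>C \<subseteq> R" using CD(2) by auto
    moreover obtain x where "x \<in> X0" "x \<noteq> 0" using nz_ideals_nonzero[OF t_ideal_nz[OF CD(1)[OF X0]]] by blast
    ultimately have "\<Union>C \<in> nz_ideals R" using X0 by (intro nz_ideals_integral[of _ x]) auto
    moreover have "v_op R A \<subseteq> \<Union>C" if A: "finite A" "A \<subseteq> \<Union>C" for A
    proof -
      obtain Y where "Y \<in> C" "A \<subseteq> Y" using finite_subset_Union_chain[OF A C] by blast
      then show ?thesis using t_idealD[OF CD(1) A(1)] by blast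
    qed
    ultimately have "t_ideal R (\<Union>C)" by (simp add: t_ideal_iff)
    moreover have "I \<subseteq> \<Union>C" using CD(4)[OF X0] X0 by blast
    moreover have "\<Union>C \<inter> S = {}" using CD(3) by auto
    ultimately show "\<Union>C \<in> ?A" using CR by simp
  qed
  then obtain P where "P \<in> ?A" and max: "\<forall>X\<in>?A. P \<subseteq> X \<longrightarrow> X = P" by (rule bexE)
  then have P: "t_ideal R P" "P \<subseteq> R" "P \<inter> S = {}" "I \<subseteq> P" by auto
  have max': "N = P" if "t_ideal R N" "N \<subseteq> R" "N \<inter> S = {}" "P \<subseteq> N" for N
  proof -
    have "N \<in> ?A" using that P(4) by auto
    then show ?thesis using max that(4) by blast
  qed
  have nzP: "P \<in> nz_ideals R" using P(1) by (rule t_ideal_nz)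
  have sP: "is_submodule R P" using nzP by (rule nz_ideals_submodule)
  \<comment> \<open>By maximality of \<open>P\<close> the \<open>t\<close>-closure of P + (a) cannot
    be disjoint from \<open>S\<close>; a finite subset already witnesses this.\<close>
  have meet: "\<exists>s\<in>S. \<exists>A. finite A \<and> A \<subseteq> {x. \<exists>p\<in>P. \<exists>u\<in>{r * a |r. r \<in> R}. x = p + u} \<and> s \<in> v_op R A"
    if a: "a \<in> R" "a \<notin> P" for a
  proof -
    let ?I = "{x. \<exists>p\<in>P. \<exists>u\<in>{r * a |r. r \<in> R}. x = p + u}"
    have sI: "is_submodule R ?I" by (intro submodule_plus submodule_principal sP)
    have IR: "?I \<subseteq> R" using a P(2) by auto
    have PI: "P \<subseteq> ?I" using submodule_zero[OF submodule_principal[of a]] by force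
    have "1 * a \<in> {r * a |r. r \<in> R}" by blast
    then have aI: "a \<in> ?I" using submodule_zero[OF sP] by force
    then have nz: "?I \<in> nz_ideals R" using a submodule_zero[OF sP] by (intro nz_ideals_integral[OF sI IR]) auto
    have "t_op R ?I \<inter> S \<noteq> {}"
    proof
      assume "t_op R ?I \<inter> S = {}"
      then have "t_op R ?I = P"
        using PI t_op_superset[OF nz]
        by (intro max' t_ideal_t_op nz t_op_subset_ring IR) auto
      then show False using aI a t_op_superset[OF nz] by blast
    qed
    then show ?thesis using t_op_iff[OF nz] by blast
  qed
  have "a \<in> P \<or> b \<in> P" if ab: "a \<in> R" "b \<in> R" "a * b \<in> P" for a b
  proof (rule ccontr)
    assume "\<not> (a \<in> P \<or> b \<in> P)"
    then obtain s A t B where s: "s \<in> S" "finite A" "A \<subseteq> {x. \<exists>p\<in>P. \<exists>u\<in>{r * a |r. r \<in> R}. x = p + u}"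
      "s \<in> v_op R A" and t: "t \<in> S" "finite B" "B \<subseteq> {x. \<exists>p\<in>P. \<exists>u\<in>{r * b |r. r \<in> R}. x = p + u}"
      "t \<in> v_op R B"
      using meet[of a] meet[of b] ab(1,2) by blast
    have "{x * y |x y. x \<in> A \<and> y \<in> B} = (\<lambda>(x, y). x * y) ` (A \<times> B)" by auto
    then have fin: "finite {x * y |x y. x \<in> A \<and> y \<in> B}" using s t by simp
    \<comment> \<open>The product of P + (a) and P + (b) lies in \<open>P\<close> because
      \<open>a * b\<close> does. The \<open>v\<close>-closure of the finite product set then puts
      \<open>s * t\<close> into both \<open>P\<close> and \<open>S\<close>.\<close>
    have "x * y \<in> P" if xy: "x \<in> A" "y \<in> B" for x y
    proof -
      obtain p r where pr: "p \<in> P" "r \<in> R" "x = p + r * a" using xy(1) s(3) by blast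
      obtain q r' where qr: "q \<in> P" "r' \<in> R" "y = q + r' * b" using xy(2) t(3) by blast
      have yR: "y \<in> R" using qr P(2) ab by auto
      have "x * y = y * p + (r * a) * q + (r * r') * (a * b)" using pr(3) qr(3) by (simp add: algebra_simps)
      also have "\<dots> \<in> P"
        using submodule_scale[OF sP yR pr(1)] submodule_scale[OF sP mult_closed[OF pr(2) ab(1)] qr(1)]
          submodule_scale[OF sP mult_closed[OF pr(2) qr(2)] ab(3)]
        by (intro submodule_add[OF sP])
      finally show ?thesis .
    qed
    then have "{x * y |x y. x \<in> A \<and> y \<in> B} \<subseteq> P" by blast
    then have "s * t \<in> P" using t_idealD[OF P(1) fin] v_op_mult[OF s(4) t(4)] by blast
    then show False using S(2) s(1) t(1) P(3) by blast
  qed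
  moreover have "1 \<notin> P" using S(1) P(3) by blast
  ultimately have "t_prime R P"
    using P nzP unfolding t_prime_def is_prime_def nz_ideals_def by blast
  then show ?thesis using P max' by blast
qed

lemma t_MaxD:
  assumes "M \<in> t_Max R"
  shows "t_ideal R M" "M \<subseteq> R" "1 \<notin> M" "t_prime R M" "is_prime R M"
    "\<And>N. t_ideal R N \<Longrightarrow> N \<subseteq> R \<Longrightarrow> 1 \<notin> N \<Longrightarrow> M \<subseteq> N \<Longrightarrow> N = M"
proof -
  show M: "t_ideal R M" "M \<subseteq> R" and max: "\<And>N. t_ideal R N \<Longrightarrow> N \<subseteq> R \<Longrightarrow> 1 \<notin> N \<Longrightarrow> M \<subseteq> N \<Longrightarrow> N = M"
    using assms by (auto simp: t_Max_def)
  have sM: "is_submodule R M" using M(1) by (intro nz_ideals_submodule t_ideal_nz)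
  show 1: "1 \<notin> M"
  proof
    assume "1 \<in> M"
    then have "R \<subseteq> M" using submodule_scale[OF sM, of _ 1] by auto
    then show False using assms by (auto simp: t_Max_def)
  qed
  obtain P where P: "t_prime R P" "M \<subseteq> P" "1 \<notin> P"
    using ex_t_prime_avoiding[of "{1}" M] M 1 by auto
  then have "P = M" by (intro max) (auto simp: t_prime_def is_prime_def)
  then show "t_prime R M" "is_prime R M" using P by (auto simp: t_prime_def)
qed

lemma ex_t_Max:
  assumes I: "I \<in> nz_ideals R" "I \<subseteq> R" "1 \<notin> t_op R I"
  shows "\<exists>M\<in>t_Max R. I \<subseteq> M"
proof -
  obtain P where P: "t_prime R P" "t_op R I \<subseteq> P" "1 \<notin> P"
    "\<forall>N. t_ideal R N \<and> N \<subseteq> R \<and> N \<inter> {1} = {} \<and> P \<subseteq> N \<longrightarrow> N = P"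
    using ex_t_prime_avoiding[of "{1}" "t_op R I"] t_ideal_t_op[OF I(1)] t_op_subset_ring[OF I(1,2)] I(3) by auto
  have "P \<in> t_Max R"
    unfolding t_Max_def
  proof (intro CollectI conjI allI impI)
    show "t_ideal R P" "P \<subset> R" using P(1) by (auto simp: t_prime_def is_prime_def)
    fix N assume N: "t_ideal R N \<and> N \<subset> R \<and> P \<subseteq> N"
    have "1 \<notin> N"
    proof
      assume "1 \<in> N"
      moreover have "is_submodule R N" using N by (intro nz_ideals_submodule t_ideal_nz) simp
      ultimately have "R \<subseteq> N" using submodule_scale[of N _ 1] by auto
      then show False using N by auto
    qed
    then show "N = P" using P(4) N by auto
  qed
  then show ?thesis using P(2) t_op_superset[OF I(1)] by blast
qed

end

subsection \<open>Localizations\<close>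

context fraction_domain
begin

text \<open>For a submodule \<open>I\<close> this is the extension of \<open>I\<close> to the
  localization at \<open>P\<close>, written so that one denominator witnesses membership.\<close>

definition loc_hull :: "'k set \<Rightarrow> 'k set \<Rightarrow> 'k set" where
  "loc_hull P I = {x. \<exists>s\<in>R - P. s * x \<in> I}"

context
  fixes P assumes P: "is_prime R P"
begin

lemma one_notin_prime: "1 \<in> R - P"
  using is_primeD(3)[OF P] by blast

lemma mult_notin_prime: "s \<in> R - P \<Longrightarrow> t \<in> R - P \<Longrightarrow> s * t \<in> R - P"
  using is_primeD(4)[OF P] by blast

lemma zero_in_prime: "s \<in> R - P \<Longrightarrow> s \<noteq> 0"
  using submodule_zero[OF is_primeD(1)[OF P]] by blast

lemma prod_notin_prime: "(\<And>i. i \<in> F \<Longrightarrow> f i \<in> R - P) \<Longrightarrow> prod f F \<in> R - P"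
  by (induction F rule: infinite_finite_induct) (use one_notin_prime mult_notin_prime in auto)

lemma localization_eq: "localization R P = loc_hull P R"
proof -
  have "x \<in> localization R P \<longleftrightarrow> x \<in> loc_hull P R" for x
  proof
    assume "x \<in> localization R P"
    then obtain a s where as: "a \<in> R" "s \<in> R - P" "x = a / s" by (auto simp: localization_def fractions_def)
    then have "s * x = a" using zero_in_prime by simp
    then show "x \<in> loc_hull P R" using as unfolding loc_hull_def by blast
  next
    assume "x \<in> loc_hull P R"
    then obtain s where s: "s \<in> R - P" "s * x \<in> R" by (auto simp: loc_hull_def)
    then have "x = (s * x) / s" using zero_in_prime by simp
    then show "x \<in> localization R P" using s unfolding localization_def fractions_def by blast
  qed
  then show ?thesis by blast
qed

lemma fraction_field_localization: "domain_with_fraction_field (localization R P)"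
  unfolding localization_def
  by (rule domain_with_fraction_field_fractions[OF dom])
    (use one_notin_prime mult_notin_prime zero_in_prime in auto)

lemma subset_localization: "R \<subseteq> localization R P"
  unfolding localization_eq loc_hull_def using one_notin_prime by (auto intro!: bexI[of _ 1])

lemma inverse_in_localization: "s \<in> R - P \<Longrightarrow> 1 / s \<in> localization R P"
  unfolding localization_def fractions_def by blast

lemma localization_denominator: "x \<in> localization R P \<Longrightarrow> \<exists>s\<in>R - P. s * x \<in> R"
  by (simp add: localization_eq loc_hull_def)

lemma loc_hull_superset: "I \<subseteq> loc_hull P I"
  unfolding loc_hull_def using one_notin_prime by (auto intro!: bexI[of _ 1])

lemma loc_hull_cancel: "s \<in> R - P \<Longrightarrow> s * x \<in> loc_hull P I \<Longrightarrow> x \<in> loc_hull P I"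
  unfolding loc_hull_def using mult_notin_prime by (auto simp: mult.assoc[symmetric])

lemma loc_hull_le: "I \<subseteq> loc_hull P J \<Longrightarrow> loc_hull P I \<subseteq> loc_hull P J"
proof
  fix x assume "I \<subseteq> loc_hull P J" "x \<in> loc_hull P I"
  then obtain s where "s \<in> R - P" "s * x \<in> loc_hull P J" unfolding loc_hull_def by blast
  then show "x \<in> loc_hull P J" by (rule loc_hull_cancel)
qed

lemma loc_hull_submodule:
  assumes I: "is_submodule R I"
  shows "is_submodule (localization R P) (loc_hull P I)"
  unfolding loc_hull_def
  by (rule submodule_fractions[OF I _ one_notin_prime mult_notin_prime localization_denominator]) auto

lemma loc_hull_submodule_ring: "is_submodule R I \<Longrightarrow> is_submodule R (loc_hull P I)"
  using loc_hull_submodule[of I] subset_localization unfolding is_submodule_def[of _ "loc_hull P I"] by blast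

lemma hull_eq_loc_hull:
  assumes I: "is_submodule R I"
  shows "is_submodule (localization R P) hull I = loc_hull P I"
proof (rule hull_unique)
  show "I \<subseteq> loc_hull P I" by (rule loc_hull_superset)
  show "is_submodule (localization R P) (loc_hull P I)" using I by (rule loc_hull_submodule)
  fix L assume L: "I \<subseteq> L" "is_submodule (localization R P) L"
  show "loc_hull P I \<subseteq> L"
  proof
    fix x assume "x \<in> loc_hull P I"
    then obtain s where s: "s \<in> R - P" "s * x \<in> I" by (auto simp: loc_hull_def)
    then have "1 / s * (s * x) \<in> L" using L inverse_in_localization unfolding is_submodule_def by blast
    then show "x \<in> L" using s zero_in_prime by simp
  qed
qed

lemma loc_hull_nz_ideals:
  assumes I: "I \<in> nz_ideals R"
  shows "loc_hull P I \<in> nz_ideals (localization R P)"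
proof -
  interpret L: fraction_domain "localization R P" by unfold_locales (rule fraction_field_localization)
  obtain x where x: "x \<in> I" "x \<noteq> 0" using nz_ideals_nonzero[OF I] by blast
  obtain d where d: "d \<in> R" "d \<noteq> 0" "\<forall>x\<in>I. d * x \<in> R" using nz_ideals_denominator[OF I] by blast
  have "d * y \<in> localization R P" if y: "y \<in> loc_hull P I" for y
  proof -
    obtain s where s: "s \<in> R - P" "s * y \<in> I" using y unfolding loc_hull_def by blast
    then have "s * (d * y) \<in> R" using d by (simp add: mult.left_commute)
    then show ?thesis unfolding localization_eq loc_hull_def using s by blast
  qed
  then show ?thesis
    using x d loc_hull_superset subset_localization
    by (intro L.nz_idealsI[OF loc_hull_submodule[OF nz_ideals_submodule[OF I]], of x d]) auto
qed

end

section \<open>The \<open>w\<close>-operation through \<open>t\<close>-maximal ideals and through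
  finite sets\<close>

lemma w_op_eq: "is_submodule R I \<Longrightarrow> w_op R I = (\<Inter>M\<in>t_Max R. loc_hull M I)"
  unfolding w_op_def using hull_eq_loc_hull[OF t_MaxD(5)] by simp

lemma w_op_iff:
  assumes I: "is_submodule R I"
  shows "x \<in> w_op R I \<longleftrightarrow> (\<forall>M\<in>t_Max R. \<exists>s\<in>R - M. s * x \<in> I)"
  by (simp add: w_op_eq[OF I] loc_hull_def)

text \<open>The ideal C of those elements of \<open>R\<close> that multiply \<open>x\<close> into
  \<open>I\<close> decides both sides: \<open>x\<close> is locally in \<open>I\<close> iff C lies in
  no \<open>t\<close>-maximal ideal, that is, iff the \<open>t\<close>-closure of C contains
  1.\<close>

lemma w_op_iff_finite:
  assumes I: "I \<in> nz_ideals R"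
  shows "x \<in> w_op R I \<longleftrightarrow> (\<exists>A. finite A \<and> A \<subseteq> R \<and> 1 \<in> v_op R A \<and> (\<forall>a\<in>A. a * x \<in> I))"
  unfolding w_op_iff[OF nz_ideals_submodule[OF I]]
proof (intro iffI ballI)
  note sI = nz_ideals_submodule[OF I]
  assume *: "\<forall>M\<in>t_Max R. \<exists>s\<in>R - M. s * x \<in> I"
  let ?C = "{r. \<forall>y\<in>{x}. r * y \<in> I} \<inter> R"
  have sC: "is_submodule R ?C" by (intro submodule_Int submodule_colon sI submodule_self)
  obtain a b where ab: "a \<in> R" "b \<in> R" "b \<noteq> 0" "x = a / b" using ex_fraction by blast
  obtain c where c: "c \<in> I" "c \<in> R" "c \<noteq> 0" using nz_ideals_Int_ring[OF I] by blast
  \<comment> \<open>Supplies a nonzero element of the ideal of denominators: \<open>b\<close> clears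
    the fraction \<open>x\<close>, and \<open>c\<close> moves the result into
    \<open>I\<close>.\<close>
  have "b * c * x = a * c" using ab by simp
  moreover have "a * c \<in> I" using ab c submodule_scale[OF sI] by blast
  ultimately have "b * c * x \<in> I" by (simp only:)
  then have "b * c \<in> ?C" using mult_closed[OF ab(2) c(2)] by blast
  then have C: "?C \<in> nz_ideals R" using ab c by (intro nz_ideals_integral[OF sC, of "b * c"]) auto
  have "1 \<in> t_op R ?C"
  proof (rule ccontr)
    assume "1 \<notin> t_op R ?C"
    then obtain M where "M \<in> t_Max R" "?C \<subseteq> M" using ex_t_Max[OF C] by blast
    then show False using * by blast
  qed
  then show "\<exists>A. finite A \<and> A \<subseteq> R \<and> 1 \<in> v_op R A \<and> (\<forall>a\<in>A. a * x \<in> I)"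
    unfolding t_op_iff[OF C] by blast
next
  fix M assume M: "M \<in> t_Max R"
  assume "\<exists>A. finite A \<and> A \<subseteq> R \<and> 1 \<in> v_op R A \<and> (\<forall>a\<in>A. a * x \<in> I)"
  then obtain A where A: "finite A" "A \<subseteq> R" "1 \<in> v_op R A" "\<forall>a\<in>A. a * x \<in> I" by blast
  have "\<not> A \<subseteq> M" using t_idealD[OF t_MaxD(1)[OF M] A(1)] A(3) t_MaxD(3)[OF M] by blast
  then show "\<exists>s\<in>R - M. s * x \<in> I" using A by blast
qed

text \<open>Since \<open>R\<close> is its own \<open>w\<close>-closure: a finite \<open>A\<close>
  that multiplies \<open>x\<close> into \<open>R\<close> and has 1 in its \<open>v\<close>-closure
  gives \<open>1 * x \<in> R\<close> by the definition of \<open>v\<close>.\<close>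

lemma in_ring_if_locally:
  assumes "\<And>M. M \<in> t_Max R \<Longrightarrow> \<exists>s\<in>R - M. s * x \<in> R"
  shows "x \<in> R"
proof -
  have "R \<in> nz_ideals R" by (rule nz_ideals_integral[OF submodule_self, of 1]) auto
  from w_op_iff_finite[OF this, of x] obtain A where "1 \<in> v_op R A" "\<forall>a\<in>A. a * x \<in> R"
    using assms w_op_iff[OF submodule_self] by auto
  then show ?thesis unfolding v_op_iff by (metis mult.commute mult_1)
qed

end

subsection \<open>Local criteria for Clifford \<open>w\<close>-regularity\<close>

context fraction_domain
begin

text \<open>This is \<open>(I R\<^sub>M : I\<^sup>2 R\<^sub>M)\<close>.\<close>

definition loc_colon :: "'k set \<Rightarrow> 'k set \<Rightarrow> 'k set" where
  "loc_colon M I = {y. \<forall>a\<in>I. \<forall>b\<in>I. y * a * b \<in> loc_hull M I}"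

lemma loc_colonD: "y \<in> loc_colon M I \<Longrightarrow> a \<in> I \<Longrightarrow> b \<in> I \<Longrightarrow> y * a * b \<in> loc_hull M I"
  by (simp add: loc_colon_def)

context
  fixes M I assumes M: "is_prime R M" and I: "I \<in> nz_ideals R"
begin

lemma submodule_loc_colon: "is_submodule (localization R M) (loc_colon M I)"
proof -
  have L: "is_submodule (localization R M) (loc_hull M I)"
    by (rule loc_hull_submodule[OF M nz_ideals_submodule[OF I]])
  then show ?thesis
    unfolding loc_colon_def is_submodule_def by (auto simp: algebra_simps)
qed

lemma submodule_loc_colon_ring: "is_submodule R (loc_colon M I)"
  using submodule_loc_colon subset_localization[OF M] unfolding is_submodule_def[of _ "loc_colon M I"] by blast

lemma loc_colon_cancel:
  assumes s: "s \<in> R - M" and "s * y \<in> loc_colon M I"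
  shows "y \<in> loc_colon M I"
  unfolding loc_colon_def
proof (intro CollectI ballI)
  fix a b assume "a \<in> I" "b \<in> I"
  then have "s * (y * a * b) \<in> loc_hull M I" using loc_colonD[OF assms(2)] by (simp add: mult.assoc)
  then show "y * a * b \<in> loc_hull M I" by (rule loc_hull_cancel[OF M s])
qed

text \<open>The element does not depend on \<open>M\<close>, which makes the intersection of these
  colons over all \<open>M\<close> nonzero.\<close>

lemma denominator_in_loc_colon:
  assumes "d \<in> R" "\<forall>x\<in>I. d * x \<in> R"
  shows "d \<in> loc_colon M I"
proof -
  have "d * a * b \<in> loc_hull M I" if "a \<in> I" "b \<in> I" for a b
    using assms that submodule_scale[OF nz_ideals_submodule[OF I]] loc_hull_superset[OF M] by blast
  then show ?thesis by (simp add: loc_colon_def)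
qed

text \<open>Any J with I_M = I_M^2 J is contained in (I_M : I_M^2), so replacing J by this colon
  loses nothing.\<close>

lemma locally_regular:
  assumes reg: "Clifford_regular (localization R M)"
  shows "I \<subseteq> loc_hull M (ideal_mult R (ideal_mult R I I) (loc_colon M I))"
proof -
  interpret L: fraction_domain "localization R M" by unfold_locales (rule fraction_field_localization[OF M])
  let ?I = "loc_hull M I" and ?P = "ideal_mult R (ideal_mult R I I) (loc_colon M I)"
  have II: "I \<subseteq> ?I" by (rule loc_hull_superset[OF M])
  have "vN_regular (localization R M) ?I"
    using reg loc_hull_nz_ideals[OF M I] by (simp add: Clifford_regular_def)
  then obtain J where "J \<in> nz_ideals (localization R M)" and J: "?I = ideal_mult (localization R M) (ideal_mult (localization R M) ?I ?I) J"
    "\<And>x y z. x \<in> ?I \<Longrightarrow> y \<in> ?I \<Longrightarrow> z \<in> J \<Longrightarrow> x * y * z \<in> ?I"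
    using L.vN_regularD by blast
  have JC: "z \<in> loc_colon M I" if z: "z \<in> J" for z
    unfolding loc_colon_def
  proof (intro CollectI ballI)
    fix a b assume "a \<in> I" "b \<in> I"
    then have "a * b * z \<in> ?I" using J(2) z II by blast
    then show "z * a * b \<in> ?I" by (simp add: mult_ac)
  qed
  have "ideal_mult (localization R M) (ideal_mult (localization R M) ?I ?I) J \<subseteq> loc_hull M ?P"
  proof (rule L.ideal_mult3_least[OF loc_hull_submodule[OF M submodule_ideal_mult]])
    fix x y z assume xyz: "x \<in> ?I" "y \<in> ?I" "z \<in> J"
    obtain s where s: "s \<in> R - M" "s * x \<in> I" using xyz(1) unfolding loc_hull_def by blast
    obtain t where t: "t \<in> R - M" "t * y \<in> I" using xyz(2) unfolding loc_hull_def by blast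
    have "(s * x) * (t * y) * z \<in> ?P" using s t JC[OF xyz(3)] by (intro ideal_mult3I)
    then have "(s * t) * (x * y * z) \<in> ?P" by (simp add: mult_ac)
    then show "x * y * z \<in> loc_hull M ?P"
      unfolding loc_hull_def using mult_notin_prime[OF M s(1) t(1)] by blast
  qed
  then show ?thesis using II J(1) by blast
qed

end

theorem Clifford_w_regular_if_locally:
  assumes tfc: "t_finite_character R"
    and reg: "\<And>M. M \<in> t_Max R \<Longrightarrow> Clifford_regular (localization R M)"
    and pair: "\<And>I M N y. I \<in> nz_ideals R \<Longrightarrow> M \<in> t_Max R \<Longrightarrow> N \<in> t_Max R \<Longrightarrow> M \<noteq> N \<Longrightarrow>
      y \<in> loc_colon M I \<Longrightarrow> \<exists>s\<in>R - M. s * y \<in> loc_colon N I"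
  shows "Clifford_w_regular R"
  unfolding Clifford_w_regular_def
proof
  fix I assume I: "I \<in> nz_ideals R"
  note sI = nz_ideals_submodule[OF I]
  obtain d where d: "d \<in> R" "d \<noteq> 0" "\<forall>x\<in>I. d * x \<in> R" using nz_ideals_denominator[OF I] by blast
  obtain c where c: "c \<in> I" "c \<in> R" "c \<noteq> 0" using nz_ideals_Int_ring[OF I] by blast
  note prime = t_MaxD(5)
  define J where "J = {y. \<forall>M\<in>t_Max R. y \<in> loc_colon M I}"
  have sC: "is_submodule R (loc_colon M I)" if "M \<in> t_Max R" for M
    by (rule submodule_loc_colon_ring[OF prime[OF that] I])
  have sJ: "is_submodule R J"
    using sC unfolding J_def is_submodule_def by auto
  have J: "J \<in> nz_ideals R"
  proof (rule nz_idealsI[OF sJ])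
    show "d \<in> J" using denominator_in_loc_colon[OF prime I d(1,3)] by (simp add: J_def)
    show "d * c * c \<in> R" using d c by (intro mult_closed)
    fix y assume y: "y \<in> J"
    show "d * c * c * y \<in> R"
    proof (rule in_ring_if_locally)
      fix M assume M: "M \<in> t_Max R"
      then have "y * c * c \<in> loc_hull M I" using y c by (intro loc_colonD) (auto simp: J_def)
      then obtain s where s: "s \<in> R - M" "s * (y * c * c) \<in> I" unfolding loc_hull_def by blast
      then have "d * (s * (y * c * c)) \<in> R" using d by blast
      then have "s * (d * c * c * y) \<in> R" by (simp add: mult_ac)
      then show "\<exists>s\<in>R - M. s * (d * c * c * y) \<in> R" using s by blast
    qed
  qed (use d c in auto)
  \<comment> \<open>The localization of \<open>J\<close> at \<open>M\<close> is the whole colon at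
    \<open>M\<close>, although \<open>J\<close> may be an infinite intersection.\<close>
  have approx: "\<exists>s\<in>R - M. s * y \<in> J" if M: "M \<in> t_Max R" and y: "y \<in> loc_colon M I" for M y
  proof -
    obtain a b where ab: "a \<in> R" "b \<in> R" "b \<noteq> 0" "y = a / b" using ex_fraction by blast
    \<comment> \<open>Outside the \<open>N\<close> containing \<open>e\<close> nothing has to be
      done: the factors \<open>d\<close> move \<open>u\<close> and \<open>v\<close> into
      \<open>R\<close>, \<open>b\<close> clears the denominator of \<open>y\<close>, and
      \<open>c\<close> brings the product into \<open>I\<close>.\<close>
    define e where "e = d * d * c * b"
    have e: "e \<in> R" "e \<noteq> 0" using d c ab by (auto simp: e_def)
    have off: "y \<in> loc_colon N I" if N: "N \<in> t_Max R" "e \<notin> N" for N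
      unfolding loc_colon_def
    proof (intro CollectI ballI)
      fix u v assume uv: "u \<in> I" "v \<in> I"
      have "e * (y * u * v) = ((d * u) * (d * v) * a) * c" using ab by (simp add: e_def)
      moreover have "d * u \<in> R" "d * v \<in> R" using d uv by auto
      then have "(d * u) * (d * v) * a \<in> R" using ab(1) by (rule mult_closed[OF mult_closed])
      ultimately have "e * (y * u * v) \<in> I" using submodule_scale[OF sI _ c(1)] by (simp only:)
      then show "y * u * v \<in> loc_hull N I" unfolding loc_hull_def using N(2) e(1) by blast
    qed
    define F where "F = {N \<in> t_Max R. e \<in> N}"
    have "finite F" using tfc e unfolding t_finite_character_def F_def by blast
    have "\<forall>N\<in>F. \<exists>s\<in>R - M. s * y \<in> loc_colon N I"
    proof
      fix N assume "N \<in> F"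
      then have N: "N \<in> t_Max R" by (simp add: F_def)
      show "\<exists>s\<in>R - M. s * y \<in> loc_colon N I"
      proof (cases "M = N")
        case True
        then show ?thesis using y one_notin_prime[OF prime[OF M]] by (intro bexI[of _ 1]) auto
      next
        case False
        then show ?thesis using pair[OF I M N _ y] by blast
      qed
    qed
    then obtain s where s: "\<And>N. N \<in> F \<Longrightarrow> s N \<in> R - M" "\<And>N. N \<in> F \<Longrightarrow> s N * y \<in> loc_colon N I"
      by metis
    \<comment> \<open>One multiplier for each of the finitely many exceptional \<open>N\<close>; as
      \<open>M\<close> is prime, their product stays outside \<open>M\<close>.\<close>
    have p: "prod s F \<in> R - M" by (rule prod_notin_prime[OF prime[OF M] s(1)])
    have "prod s F * y \<in> loc_colon N I" if N: "N \<in> t_Max R" for N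
    proof (cases "N \<in> F")
      case True
      then have "prod s F = prod s (F - {N}) * s N" using \<open>finite F\<close> by (simp add: prod.remove)
      moreover have "prod s (F - {N}) \<in> R" using s(1) by (intro prod_closed) auto
      ultimately show ?thesis using submodule_scale[OF sC[OF N] _ s(2)[OF True]] by (simp add: mult.assoc)
    next
      case False
      then have "y \<in> loc_colon N I" using N off by (auto simp: F_def)
      then show ?thesis using p submodule_scale[OF sC[OF N]] by blast
    qed
    then show ?thesis using p unfolding J_def by blast
  qed
  let ?P = "ideal_mult R (ideal_mult R I I) J"
  have "w_op R I = w_op R ?P"
  proof -
    have "loc_hull M I = loc_hull M ?P" if M: "M \<in> t_Max R" for M
    proof -
      have "?P \<subseteq> loc_hull M I"
      proof (rule ideal_mult3_least[OF loc_hull_submodule_ring[OF prime[OF M] sI]])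
        fix x y z assume "x \<in> I" "y \<in> I" "z \<in> J"
        then have "z * x * y \<in> loc_hull M I" using M by (intro loc_colonD) (auto simp: J_def)
        then show "x * y * z \<in> loc_hull M I" by (simp add: mult_ac)
      qed
      moreover have "I \<subseteq> loc_hull M ?P"
      proof -
        let ?Q = "ideal_mult R (ideal_mult R I I) (loc_colon M I)"
        have "?Q \<subseteq> loc_hull M ?P"
        proof (rule ideal_mult3_least[OF loc_hull_submodule_ring[OF prime[OF M] submodule_ideal_mult]])
          fix x y z assume xyz: "x \<in> I" "y \<in> I" "z \<in> loc_colon M I"
          obtain s where s: "s \<in> R - M" "s * z \<in> J" using approx[OF M xyz(3)] by blast
          have "x * y * (s * z) \<in> ?P" using xyz s by (intro ideal_mult3I)
          then have "s * (x * y * z) \<in> ?P" by (simp add: mult_ac)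
          then show "x * y * z \<in> loc_hull M ?P" unfolding loc_hull_def using s(1) by blast
        qed
        moreover have "I \<subseteq> loc_hull M ?Q" by (rule locally_regular[OF prime[OF M] I reg[OF M]])
        ultimately show ?thesis using loc_hull_le[OF prime[OF M]] by blast
      qed
      ultimately show ?thesis using loc_hull_le[OF prime[OF M]] by blast
    qed
    then show ?thesis unfolding w_op_eq[OF sI] w_op_eq[OF submodule_ideal_mult] by auto
  qed
  then show "w_regular R I" unfolding w_regular_def using J by blast
qed

text \<open>If \<open>y\<close> is not already in the colon at \<open>N\<close>, some z = y p^2 is
  outside I_N, and comparability in the valuation ring gives I \<subseteq> z R_N. The colon at
  \<open>M\<close> provides t outside M with t z \<in> I, and then t' outside M with t' y (t z)^2
  \<in> I. Dividing by z gives s y z \<in> R_N for s = t' t^2, so s y a b = (s y z)(a / z) b lies in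
  I_N.\<close>

lemma loc_colon_localize_valuation:
  assumes I: "I \<in> nz_ideals R" and M: "is_prime R M" and N: "is_prime R N"
    and val: "\<And>x. x \<noteq> 0 \<Longrightarrow> x \<in> localization R N \<or> 1 / x \<in> localization R N"
    and y: "y \<in> loc_colon M I"
  shows "\<exists>s\<in>R - M. s * y \<in> loc_colon N I"
proof (cases "y \<in> loc_colon N I")
  case True
  then show ?thesis using one_notin_prime[OF M] by (intro bexI[of _ 1]) auto
next
  case False
  interpret L: fraction_domain "localization R N" by unfold_locales (rule fraction_field_localization[OF N])
  have sL: "is_submodule (localization R N) (loc_hull N I)"
    by (rule loc_hull_submodule[OF N nz_ideals_submodule[OF I]])
  note sI = nz_ideals_submodule[OF I]
  have II: "I \<subseteq> loc_hull N I" by (rule loc_hull_superset[OF N])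
  \<comment> \<open>Of \<open>p\<close> and \<open>q\<close>, the one that divides the other in the
    valuation ring can be taken twice.\<close>
  obtain p where p: "p \<in> I" "y * p * p \<notin> loc_hull N I"
  proof -
    obtain p q where pq: "p \<in> I" "q \<in> I" "y * p * q \<notin> loc_hull N I"
      using False unfolding loc_colon_def by blast
    then have nz: "p \<noteq> 0" "q \<noteq> 0" using L.submodule_zero[OF sL] by auto
    show thesis
    proof (cases "q / p \<in> localization R N")
      case True
      have "y * p * p \<notin> loc_hull N I"
      proof
        assume "y * p * p \<in> loc_hull N I"
        then have "q / p * (y * p * p) \<in> loc_hull N I" by (rule L.submodule_scale[OF sL True])
        then show False using pq(3) nz by (simp add: mult_ac)
      qed
      then show thesis using \<open>p \<in> I\<close> that by blast
    next
      case False
      then have pq': "p / q \<in> localization R N" using val[of "q / p"] nz by simp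
      have "y * q * q \<notin> loc_hull N I"
      proof
        assume "y * q * q \<in> loc_hull N I"
        then have "p / q * (y * q * q) \<in> loc_hull N I" by (rule L.submodule_scale[OF sL pq'])
        then show False using pq(3) nz by (simp add: mult_ac)
      qed
      then show thesis using \<open>q \<in> I\<close> that by blast
    qed
  qed
  define z where "z = y * p * p"
  have z: "z \<notin> loc_hull N I" "z \<noteq> 0" using p(2) L.submodule_zero[OF sL] by (auto simp: z_def)
  have Iz: "i / z \<in> localization R N" if i: "i \<in> I" for i
  proof (cases "i = 0")
    case False
    have "z / i \<notin> localization R N"
    proof
      assume "z / i \<in> localization R N"
      then have "z / i * i \<in> loc_hull N I" using i II by (intro L.submodule_scale[OF sL]) auto
      then show False using z False by simp
    qed
    then show ?thesis using val[of "i / z"] False z by simp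
  qed auto
  obtain t where t: "t \<in> R - M" "t * z \<in> I"
    using loc_colonD[OF y p(1) p(1)] unfolding loc_hull_def z_def by blast
  obtain t' where t': "t' \<in> R - M" "t' * (y * (t * z) * (t * z)) \<in> I"
    using loc_colonD[OF y t(2) t(2)] unfolding loc_hull_def by blast
  define s where "s = t' * (t * t)"
  have "t' * (y * (t * z) * (t * z)) / z = s * y * z" using z by (simp add: s_def)
  then have sz: "s * y * z \<in> localization R N" using Iz[OF t'(2)] by simp
  have "s * y \<in> loc_colon N I"
    unfolding loc_colon_def
  proof (intro CollectI ballI)
    fix a b assume ab: "a \<in> I" "b \<in> I"
    have "(s * y * z) * (a / z) * b \<in> loc_hull N I"
      using ab II by (intro L.submodule_scale[OF sL L.mult_closed[OF sz Iz]]) auto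
    moreover have "(s * y * z) * (a / z) * b = s * y * a * b" using z(2) by (simp add: field_simps)
    ultimately show "s * y * a * b \<in> loc_hull N I" by (simp only:)
  qed
  moreover have "s \<in> R - M" unfolding s_def using t t' by (intro mult_notin_prime[OF M])
  ultimately show ?thesis by blast
qed

text \<open>Without a \<open>t\<close>-prime inside both \<open>M\<close> and \<open>N\<close>,
  every nonzero \<open>b\<close> divides a product \<open>s * t\<close> with \<open>s\<close>
  outside \<open>M\<close> and \<open>t\<close> outside \<open>N\<close>. Hence \<open>s\<close>
  absorbs any denominator at the cost of \<open>t\<close>, which can be cancelled at
  \<open>N\<close>.\<close>

lemma loc_colon_localize_independent:
  assumes I: "I \<in> nz_ideals R" and M: "is_prime R M" and N: "is_prime R N"
    and indep: "\<And>P. t_prime R P \<Longrightarrow> P \<subseteq> M \<Longrightarrow> P \<subseteq> N \<Longrightarrow> False"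
  shows "\<exists>s\<in>R - M. s * y \<in> loc_colon N I"
proof -
  obtain d where d: "d \<in> R" "d \<noteq> 0" "\<forall>x\<in>I. d * x \<in> R" using nz_ideals_denominator[OF I] by blast
  \<comment> \<open>Since \<open>d\<close> is a known element of the colon at \<open>N\<close>, it
    suffices to clear the denominator of \<open>y / d\<close> instead of \<open>y\<close>.\<close>
  obtain a b where ab: "a \<in> R" "b \<in> R" "b \<noteq> 0" "y / d = a / b" using ex_fraction by blast
  let ?S = "{s * t |s t. s \<in> R - M \<and> t \<in> R - N}"
  have S1: "u \<in> ?S" if "u \<in> R - M" for u
  proof -
    have "u = u * 1" by simp
    then show ?thesis using that one_notin_prime[OF N] by blast
  qed
  have S2: "u \<in> ?S" if "u \<in> R - N" for u
  proof -
    have "u = 1 * u" by simp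
    then show ?thesis using that one_notin_prime[OF M] by blast
  qed
  have "{r * b |r. r \<in> R} \<inter> ?S \<noteq> {}"
  proof
    assume disj: "{r * b |r. r \<in> R} \<inter> ?S = {}"
    have "1 \<in> ?S" using S1 one_notin_prime[OF M] by blast
    moreover have "u * v \<in> ?S" if uv: "u \<in> ?S" "v \<in> ?S" for u v
    proof -
      obtain s t s' t' where st: "u = s * t" "s \<in> R - M" "t \<in> R - N" "v = s' * t'" "s' \<in> R - M" "t' \<in> R - N"
        using uv by blast
      then have "u * v = (s * s') * (t * t')" by (simp add: mult_ac)
      then show ?thesis using mult_notin_prime[OF M st(2,5)] mult_notin_prime[OF N st(3,6)] by blast
    qed
    moreover have "{r * b |r. r \<in> R} \<subseteq> R" using ab by auto
    ultimately obtain P where P: "t_prime R P" "P \<inter> ?S = {}"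
      using ex_t_prime_avoiding[of ?S "{r * b |r. r \<in> R}"] t_ideal_principal[OF ab(2,3)] disj by blast
    have "P \<subseteq> R" using P(1) by (auto simp: t_prime_def is_prime_def)
    have "P \<subseteq> M"
    proof
      fix u assume "u \<in> P"
      then show "u \<in> M" using S1[of u] P(2) \<open>P \<subseteq> R\<close> by auto
    qed
    moreover have "P \<subseteq> N"
    proof
      fix u assume "u \<in> P"
      then show "u \<in> N" using S2[of u] P(2) \<open>P \<subseteq> R\<close> by auto
    qed
    ultimately show False using indep P(1) by blast
  qed
  then obtain r s t where rst: "r \<in> R" "s \<in> R - M" "t \<in> R - N" "r * b = s * t" by blast
  have "t * (s * y) = (t * s * (a / b)) * d" using ab(4) d(2) by (simp add: field_simps)
  also have "t * s * (a / b) = r * a" using rst(4) ab(3) by (simp add: field_simps)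
  finally have "t * (s * y) = r * a * d" .
  moreover have "r * a * d \<in> loc_colon N I"
    using rst ab denominator_in_loc_colon[OF N I d(1,3)]
    by (intro submodule_scale[OF submodule_loc_colon_ring[OF N I]]) auto
  ultimately have "s * y \<in> loc_colon N I" using loc_colon_cancel[OF N I rst(3)] by simp
  then show ?thesis using rst(2) by blast
qed

end

subsection \<open>Polynomials over a domain\<close>

lemma mem_polys_over: "f \<in> polys_over I \<longleftrightarrow> (\<forall>i. coeff f i \<in> I)"
  by (simp add: polys_over_def)

lemma to_fract_mem_poly_ring [simp]: "to_fract f \<in> poly_ring I \<longleftrightarrow> f \<in> polys_over I"
  by (auto simp: poly_ring_def)

lemma poly_ringE:
  assumes "x \<in> poly_ring I"
  obtains f where "f \<in> polys_over I" "x = to_fract f"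
  using assms by (auto simp: poly_ring_def)

lemma finite_range_coeff: "finite (range (coeff f))"
proof -
  have "range (coeff f) \<subseteq> insert 0 (coeff f ` {..degree f})"
    by (auto simp: image_iff) (metis atMost_iff coeff_eq_0 not_le)
  then show ?thesis by (rule finite_subset) simp
qed

lemma to_fract_smult: "to_fract (smult c f) = to_fract [:c:] * to_fract f"
  by (simp flip: to_fract_mult)

context subdom
begin

lemma polys_over_const: "0 \<in> I \<Longrightarrow> [:c:] \<in> polys_over I \<longleftrightarrow> c \<in> I"
  by (auto simp: mem_polys_over coeff_pCons split: nat.split dest: spec[of _ 0])

lemma polys_over_add: "is_submodule R I \<Longrightarrow> f \<in> polys_over I \<Longrightarrow> g \<in> polys_over I \<Longrightarrow> f + g \<in> polys_over I"
  and polys_over_diff: "is_submodule R I \<Longrightarrow> f \<in> polys_over I \<Longrightarrow> g \<in> polys_over I \<Longrightarrow> f - g \<in> polys_over I"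
  and polys_over_smult: "is_submodule R I \<Longrightarrow> c \<in> R \<Longrightarrow> f \<in> polys_over I \<Longrightarrow> smult c f \<in> polys_over I"
  by (auto simp: mem_polys_over submodule_add submodule_diff submodule_scale)

lemma polys_over_mult:
  "is_submodule R I \<Longrightarrow> f \<in> polys_over R \<Longrightarrow> g \<in> polys_over I \<Longrightarrow> f * g \<in> polys_over I"
  by (auto simp: mem_polys_over coeff_mult intro!: submodule_sum submodule_scale)

lemma polys_over_mult_ideal_mult:
  "f \<in> polys_over I \<Longrightarrow> g \<in> polys_over J \<Longrightarrow> f * g \<in> polys_over (ideal_mult R I J)"
  by (auto simp: mem_polys_over coeff_mult intro!: submodule_sum[OF submodule_ideal_mult] ideal_multI)

lemma polys_over_monom: "0 \<in> I \<Longrightarrow> monom c n \<in> polys_over I \<longleftrightarrow> c \<in> I"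
  by (auto simp: mem_polys_over dest: spec[of _ n])

text \<open>McCoy's argument: multiplying \<open>g\<close> by a coefficient of \<open>f\<close> makes its leading coefficient
  vanish modulo \<open>T\<close>.\<close>

lemma content_saturated_cancel:
  assumes f: "f \<in> polys_over R" and T: "is_submodule R T" and U: "is_submodule R U"
    and sat: "\<And>x. x \<in> U \<Longrightarrow> (\<And>i. coeff f i * x \<in> T) \<Longrightarrow> x \<in> T"
    and g: "g \<in> polys_over U" "f * g \<in> polys_over T"
  shows "g \<in> polys_over T"
proof -
  have fR: "coeff f i \<in> R" for i using f by (simp add: mem_polys_over)
  have "g \<in> polys_over T" if "g \<in> polys_over U" "f * g \<in> polys_over T" "\<And>i. i \<ge> m \<Longrightarrow> coeff g i = 0" for g m
    using that
  proof (induction m arbitrary: g)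
    case 0
    then show ?case using submodule_zero[OF T] by (simp add: mem_polys_over)
  next
    case (Suc m)
    note g = Suc.prems and IH = Suc.IH
    have gU: "coeff g i \<in> U" for i using g(1) by (simp add: mem_polys_over)
    define b where "b = coeff g m"
    \<comment> \<open>Descending induction on \<open>k\<close>, with \<open>n\<close> bounding the
      distance to the degree of \<open>f\<close>: the coefficients of \<open>f\<close> above
      \<open>k\<close> already multiply \<open>g\<close> into \<open>T\<close>.\<close>
    have "smult (coeff f k) g \<in> polys_over T" if "k + n > degree f" for k n
      using that
    proof (induction n arbitrary: k)
      case 0
      then have "coeff f k = 0" by (simp add: coeff_eq_0)
      then show ?case using submodule_zero[OF T] by (simp add: mem_polys_over)
    next
      case (Suc n)
      let ?a = "coeff f k"
      have higher: "coeff f j * coeff g i \<in> T" if "j > k" for i j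
        using Suc.IH[of j] Suc.prems that by (simp add: mem_polys_over)
      have "coeff (f * g) (k + m) = (\<Sum>i\<le>k + m. coeff f i * coeff g (k + m - i))"
        by (rule coeff_mult)
      also have "\<dots> = ?a * b + (\<Sum>i\<in>{..k + m} - {k}. coeff f i * coeff g (k + m - i))"
        by (subst sum.remove[of _ k]) (auto simp: b_def)
      finally have "?a * b = coeff (f * g) (k + m) - (\<Sum>i\<in>{..k + m} - {k}. coeff f i * coeff g (k + m - i))"
        by simp
      also have "\<dots> \<in> T"
      proof (intro submodule_diff[OF T] submodule_sum[OF T])
        show "coeff (f * g) (k + m) \<in> T" using g(2) by (simp add: mem_polys_over)
        fix i assume "i \<in> {..k + m} - {k}"
        then consider "i < k" | "i > k" by fastforce
        then show "coeff f i * coeff g (k + m - i) \<in> T"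
          by cases (use g(3) higher submodule_zero[OF T] in auto)
      qed
      finally have ab: "?a * b \<in> T" .
      \<comment> \<open>As \<open>?a * b\<close> is in \<open>T\<close>, the top term can be removed
        without disturbing the hypothesis on the product with \<open>f\<close> modulo
        \<open>T\<close>; the outer induction then applies.\<close>
      let ?g = "smult ?a (g - monom b m)"
      have "?g \<in> polys_over T"
      proof (rule IH)
        show "?g \<in> polys_over U"
          using g(1) gU[of m] fR submodule_zero[OF U]
          by (intro polys_over_smult polys_over_diff U) (auto simp: polys_over_monom b_def)
        have "f * ?g = smult ?a (f * g) - f * monom (?a * b) m"
          by (simp add: right_diff_distrib smult_diff_right flip: smult_monom)
        then show "f * ?g \<in> polys_over T"
          using g(2) f ab fR submodule_zero[OF T]
          by (auto simp: polys_over_monom intro!: polys_over_diff[OF T] polys_over_mult[OF T] polys_over_smult[OF T])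
        show "coeff ?g i = 0" if "i \<ge> m" for i
          using that g(3)[of i] by (cases "i = m") (auto simp: b_def)
      qed
      moreover have "smult ?a g = ?g + monom (?a * b) m"
        by (simp add: smult_diff_right flip: smult_monom)
      ultimately show ?case
        using ab submodule_zero[OF T] by (auto simp: polys_over_monom intro!: polys_over_add[OF T])
    qed
    from this[of _ "Suc (degree f)"] have "coeff f k * coeff g i \<in> T" for k i
      by (simp add: mem_polys_over)
    then show ?case unfolding mem_polys_over using sat gU by blast
  qed
  then show ?thesis using g coeff_eq_0[of g] by (metis Suc_le_eq)
qed

end

subsection \<open>The \<open>t\<close>-maximal ideals of a polynomial ring\<close>

locale polynomial_domain = fraction_domain D for D :: "'k::field set"
begin

sublocale PX: fraction_domain "poly_ring D"
  by unfold_locales (rule domain_with_fraction_field_poly_ring[OF dom])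

abbreviation cst :: "'k \<Rightarrow> 'k poly fract" where
  "cst c \<equiv> to_fract [:c:]"

lemma cst_mem_poly_ring: "0 \<in> I \<Longrightarrow> cst c \<in> poly_ring I \<longleftrightarrow> c \<in> I"
  by (simp add: polys_over_const)

lemma cst_closed: "c \<in> D \<Longrightarrow> cst c \<in> poly_ring D"
  by (simp add: polys_over_const)

lemma submodule_poly_ring:
  assumes I: "is_submodule D I"
  shows "is_submodule (poly_ring D) (poly_ring I)"
  unfolding is_submodule_def
proof (intro conjI ballI)
  have "to_fract 0 \<in> poly_ring I" unfolding to_fract_mem_poly_ring
    using submodule_zero[OF I] by (simp add: mem_polys_over)
  then show "0 \<in> poly_ring I" by simp
next
  fix x y assume "x \<in> poly_ring I" "y \<in> poly_ring I"
  then obtain f g where fg: "f \<in> polys_over I" "g \<in> polys_over I" "x = to_fract f" "y = to_fract g"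
    by (auto elim!: poly_ringE)
  then have "to_fract (f + g) \<in> poly_ring I" unfolding to_fract_mem_poly_ring
    by (intro polys_over_add[OF I])
  then show "x + y \<in> poly_ring I" using fg by simp
next
  fix x y assume "x \<in> poly_ring D" "y \<in> poly_ring I"
  then obtain f g where fg: "f \<in> polys_over D" "g \<in> polys_over I" "x = to_fract f" "y = to_fract g"
    by (auto elim!: poly_ringE)
  then have "to_fract (f * g) \<in> poly_ring I" unfolding to_fract_mem_poly_ring
    by (intro polys_over_mult[OF I])
  then show "x * y \<in> poly_ring I" using fg by simp
qed

lemma poly_ring_mono: "I \<subseteq> J \<Longrightarrow> poly_ring I \<subseteq> poly_ring J"
  by (auto simp: poly_ring_def polys_over_def)

lemma poly_ring_subset_iff:
  assumes "is_submodule D I" "is_submodule D J"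
  shows "poly_ring I \<subseteq> poly_ring J \<longleftrightarrow> I \<subseteq> J"
proof
  assume *: "poly_ring I \<subseteq> poly_ring J"
  show "I \<subseteq> J"
  proof
    fix c assume "c \<in> I"
    then have "cst c \<in> poly_ring I" using submodule_zero[OF assms(1)] cst_mem_poly_ring by blast
    then show "c \<in> J" using * submodule_zero[OF assms(2)] cst_mem_poly_ring by blast
  qed
qed (rule poly_ring_mono)

lemma X_inverse_notin: "1 / to_fract (monom 1 1) \<notin> poly_ring D"
proof
  assume "1 / to_fract (monom 1 1) \<in> poly_ring D"
  then obtain h where "1 / to_fract (monom 1 1) = (to_fract h :: 'k poly fract)" by (auto elim: poly_ringE)
  then have "to_fract (monom 1 1 * h) = (to_fract 1 :: 'k poly fract)"
    by (simp add: field_simps monom_eq_0_iff)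
  then have "monom 1 1 * h = (1 :: 'k poly)" by (simp only: to_fract_eq_iff)
  then have "coeff (monom 1 1 * h) 0 = 1" by simp
  then show False by (simp add: coeff_monom_mult)
qed

text \<open>Shifting each new summand past the degree of the previous one by a power of X keeps all
  coefficients apart, so one polynomial of the span carries the contents of finitely many.\<close>

lemma ex_collecting_poly:
  assumes "finite A" "A \<subseteq> polys_over D"
  shows "\<exists>f\<in>polys_over D. to_fract f \<in> PX.span (to_fract ` A) \<and> (\<forall>a\<in>A. range (coeff a) \<subseteq> range (coeff f))"
  using assms
proof (induction A rule: finite_induct)
  case empty
  have "to_fract 0 \<in> PX.span (to_fract ` {})" using PX.submodule_zero[OF PX.submodule_span] by simp
  then show ?case by (intro bexI[of _ 0]) (auto simp: mem_polys_over)
next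
  case (insert a A)
  then obtain g where g: "g \<in> polys_over D" "to_fract g \<in> PX.span (to_fract ` A)"
    "\<forall>b\<in>A. range (coeff b) \<subseteq> range (coeff g)" by auto
  define n where "n = Suc (degree a)"
  define f where "f = a + monom 1 n * g"
  have coeff_f: "coeff f i = (if i < n then coeff a i else coeff g (i - n))" for i
    by (auto simp: f_def coeff_monom_mult n_def coeff_eq_0)
  have mon: "monom 1 n \<in> polys_over D" by (simp add: polys_over_monom)
  have span: "PX.span (to_fract ` A) \<subseteq> PX.span (to_fract ` insert a A)" by (rule hull_mono) auto
  have "to_fract a + to_fract (monom 1 n) * to_fract g \<in> PX.span (to_fract ` insert a A)"
  proof (rule PX.submodule_add[OF PX.submodule_span])
    show "to_fract a \<in> PX.span (to_fract ` insert a A)" by (rule PX.span_superset) simp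
    show "to_fract (monom 1 n) * to_fract g \<in> PX.span (to_fract ` insert a A)"
      by (rule PX.submodule_scale[OF PX.submodule_span]) (use mon g(2) span in auto)
  qed
  then have f: "to_fract f \<in> PX.span (to_fract ` insert a A)" "f \<in> polys_over D" unfolding f_def
    using insert.prems g(1) mon by (simp_all add: polys_over_add polys_over_mult submodule_self)
  have fa: "range (coeff a) \<subseteq> range (coeff f)"
  proof
    fix c assume "c \<in> range (coeff a)"
    then obtain i where i: "c = coeff a i" by blast
    show "c \<in> range (coeff f)"
    proof (cases "i < n")
      case True
      then show ?thesis using coeff_f[of i] i by (intro image_eqI[of _ _ i]) auto
    next
      case False
      then have "c = coeff f (Suc (degree f))" using i by (simp add: n_def coeff_eq_0)
      then show ?thesis by blast
    qed
  qed
  have fg: "range (coeff g) \<subseteq> range (coeff f)"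
  proof
    fix c assume "c \<in> range (coeff g)"
    then obtain i where "c = coeff g i" by blast
    then have "c = coeff f (i + n)" by (simp add: coeff_f)
    then show "c \<in> range (coeff f)" by blast
  qed
  have "\<forall>b\<in>insert a A. range (coeff b) \<subseteq> range (coeff f)"
  proof (intro ballI, elim insertE)
    fix b assume "b \<in> A"
    then show "range (coeff b) \<subseteq> range (coeff f)" using g(3) fg by (meson subset_trans)
  qed (use fa in simp)
  then show ?case using f by (intro bexI[of _ f] conjI)
qed

text \<open>For finite \<open>A\<close> in M[X], let C be a finite subset of \<open>M\<close>
  containing all coefficients. Constants z with z C \<subseteq> D multiply \<open>A\<close> into
  D[X], so elements of the \<open>v\<close>-closure of \<open>A\<close> have coefficients in the
  \<open>v\<close>-closure of C, hence in \<open>M\<close>.\<close>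

lemma t_ideal_poly_ring:
  assumes M: "t_ideal D M"
  shows "t_ideal (poly_ring D) (poly_ring M)"
  unfolding PX.t_ideal_iff
proof (intro conjI allI impI)
  have nz: "M \<in> nz_ideals D" using M by (rule t_ideal_nz)
  note sM = nz_ideals_submodule[OF nz]
  obtain m where m: "m \<in> M" "m \<noteq> 0" using nz_ideals_nonzero[OF nz] by blast
  obtain d where d: "d \<in> D" "d \<noteq> 0" "\<forall>x\<in>M. d * x \<in> D" using nz_ideals_denominator[OF nz] by blast
  show "poly_ring M \<in> nz_ideals (poly_ring D)"
  proof (rule PX.nz_idealsI[OF submodule_poly_ring[OF sM]])
    show "cst m \<in> poly_ring M" "cst d \<in> poly_ring D"
      using m d submodule_zero[OF sM] by (auto simp: cst_mem_poly_ring simp del: to_fract_mem_poly_ring)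
    fix y assume "y \<in> poly_ring M"
    then obtain f where f: "f \<in> polys_over M" "y = to_fract f" by (rule poly_ringE)
    then have "smult d f \<in> polys_over D" using d by (simp add: mem_polys_over)
    then have "to_fract (smult d f) \<in> poly_ring D" by simp
    then show "cst d * y \<in> poly_ring D" unfolding to_fract_smult f(2) .
  qed (use m d in auto)
  fix A assume A: "finite A" "A \<subseteq> poly_ring M"
  obtain B where B: "B \<subseteq> polys_over M" "finite B" and AB: "A = to_fract ` B"
    using finite_subset_image[OF A(1), of to_fract "polys_over M"] A(2) unfolding poly_ring_def by blast
  define C where "C = insert m (\<Union>f\<in>B. range (coeff f))"
  have "finite C" using B(2) finite_range_coeff by (auto simp: C_def)
  moreover have "coeff f i \<in> M" if "f \<in> B" for f i
    using that B(1) by (auto simp: mem_polys_over)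
  then have CM: "C \<subseteq> M" using m by (auto simp: C_def)
  ultimately have vC: "v_op D C \<subseteq> M" using t_idealD[OF M] by blast
  have coC: "coeff f i \<in> C" if "f \<in> B" for f i using that by (auto simp: C_def)
  show "v_op (poly_ring D) A \<subseteq> poly_ring M"
  proof
    fix x assume x: "x \<in> v_op (poly_ring D) A"
    have *: "x * cst z \<in> poly_ring D" if z: "\<forall>c\<in>C. z * c \<in> D" for z
    proof -
      have "cst z * a \<in> poly_ring D" if "a \<in> A" for a
      proof -
        obtain f where f: "f \<in> B" "a = to_fract f" using \<open>a \<in> A\<close> AB by blast
        then have "smult z f \<in> polys_over D" using z coC by (simp add: mem_polys_over)
        then have "to_fract (smult z f) \<in> poly_ring D" by simp
        then show ?thesis unfolding to_fract_smult f(2) .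
      qed
      then show ?thesis using x unfolding PX.v_op_iff by blast
    qed
    \<comment> \<open>\<open>d\<close> is one nonzero admissible \<open>z\<close>; it shows that
      \<open>x\<close> is a polynomial over the field at all.\<close>
    have "\<forall>c\<in>C. d * c \<in> D" using d(3) CM by blast
    then obtain g0 where g0: "x * cst d = to_fract g0" using * by (blast elim: poly_ringE)
    define g where "g = smult (1 / d) g0"
    have "x = to_fract g0 / cst d" using g0 d(2) by (simp add: field_simps)
    also have "\<dots> = to_fract g"
    proof -
      have "to_fract g0 = to_fract (smult d g)" using d(2) by (simp add: g_def)
      then show ?thesis unfolding to_fract_smult using d(2) by simp
    qed
    finally have xg: "x = to_fract g" .
    have "coeff g i \<in> v_op D C" for i
      unfolding v_op_iff
    proof (intro allI impI)
      fix z assume "\<forall>c\<in>C. z * c \<in> D"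
      then have "to_fract (smult z g) \<in> poly_ring D"
        using * unfolding to_fract_smult xg by (simp only: mult.commute)
      then show "coeff g i * z \<in> D" by (simp add: mem_polys_over mult.commute)
    qed
    then show "x \<in> poly_ring M" using vC xg by (auto simp: mem_polys_over)
  qed
qed

text \<open>The saturation needed for cancelling is the definition of \<open>v\<close>: an
  \<open>x\<close> that multiplies all coefficients of \<open>f\<close> into \<open>D\<close> also
  multiplies 1 into \<open>D\<close>. Here \<open>g\<close> may have any coefficients in the
  field.\<close>

lemma v_unit_content_cancel:
  assumes "f \<in> polys_over D" "1 \<in> v_op D (range (coeff f))" "f * g \<in> polys_over D"
  shows "g \<in> polys_over D"
proof (rule content_saturated_cancel[OF assms(1) submodule_self _ _ _ assms(3)])
  show "is_submodule D UNIV" "g \<in> polys_over UNIV" by (auto simp: is_submodule_def mem_polys_over)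
  fix x assume "\<And>i. coeff f i * x \<in> D"
  then have "\<forall>a\<in>range (coeff f). x * a \<in> D" by (auto simp: mult.commute)
  then show "x \<in> D" using assms(2) unfolding v_op_iff by (metis mult_1)
qed

text \<open>Let C be the ideal of all coefficients of polynomials in \<open>Q\<close>. If C lies in
  a \<open>t\<close>-maximal M, then Q \<subseteq> M[X] and maximality gives equality. Otherwise
  \<open>Q\<close> contains an \<open>f\<close> with 1 in the \<open>v\<close>-closure of its
  content; then 1 lies in the \<open>v\<close>-closure of \<open>{cst c, to_fract f}\<close>, since
  \<open>cst c\<close> makes a multiplier z a polynomial over the field and \<open>f\<close>
  cancels.\<close>

lemma t_Max_poly_ring_nonzero_contraction:
  assumes Q: "Q \<in> t_Max (poly_ring D)" and c: "cst c \<in> Q" "c \<noteq> 0"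
  shows "\<exists>M\<in>t_Max D. Q = poly_ring M"
proof -
  note Q' = PX.t_MaxD[OF Q]
  have sQ: "is_submodule (poly_ring D) Q" by (rule PX.is_primeD(1)[OF Q'(5)])
  have QD: "\<exists>f\<in>polys_over D. x = to_fract f" if "x \<in> Q" for x
    using that Q'(2) by (auto simp: poly_ring_def)
  have coD: "coeff f i \<in> D" if "to_fract f \<in> Q" for f i
    using that Q'(2) by (auto simp: mem_polys_over dest!: subsetD)
  define C where "C = {coeff f i |f i. to_fract f \<in> Q}"
  have sC: "is_submodule D C"
    unfolding is_submodule_def
  proof (intro conjI ballI)
    show "0 \<in> C" using PX.submodule_zero[OF sQ] unfolding C_def
      by (intro CollectI exI[of _ 0]) auto
  next
    fix x y assume "x \<in> C" "y \<in> C"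
    then obtain f i g j where fg: "to_fract f \<in> Q" "x = coeff f i" "to_fract g \<in> Q" "y = coeff g j"
      by (auto simp: C_def)
    have m: "to_fract (monom 1 n) \<in> poly_ring D" for n by (simp add: polys_over_monom)
    \<comment> \<open>The shifts move coefficient \<open>i\<close> of \<open>f\<close> and
      coefficient \<open>j\<close> of \<open>g\<close> to the common place
      \<open>i + j\<close>.\<close>
    have "to_fract (monom 1 j) * to_fract f + to_fract (monom 1 i) * to_fract g \<in> Q"
      using fg by (intro PX.submodule_add[OF sQ] PX.submodule_scale[OF sQ] m)
    then have "to_fract (monom 1 j * f + monom 1 i * g) \<in> Q" by simp
    moreover have "x + y = coeff (monom 1 j * f + monom 1 i * g) (i + j)"
      using fg by (simp add: coeff_monom_mult)
    ultimately show "x + y \<in> C" unfolding C_def by blast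
  next
    fix r x assume "r \<in> D" "x \<in> C"
    then obtain f i where f: "to_fract f \<in> Q" "x = coeff f i" by (auto simp: C_def)
    then have "to_fract (smult r f) \<in> Q" unfolding to_fract_smult
      using \<open>r \<in> D\<close> by (intro PX.submodule_scale[OF sQ] cst_closed)
    moreover have "r * x = coeff (smult r f) i" using f by simp
    ultimately show "r * x \<in> C" unfolding C_def by blast
  qed
  have CD: "C \<subseteq> D" using coD by (auto simp: C_def)
  have "c = coeff [:c:] 0" by simp
  then have "c \<in> C" using c(1) unfolding C_def by blast
  then have C: "C \<in> nz_ideals D" using c(2) by (intro nz_ideals_integral[OF sC CD])
  have "1 \<notin> t_op D C"
  proof
    assume "1 \<in> t_op D C"
    then obtain A where A: "finite A" "A \<subseteq> C" "1 \<in> v_op D A" using t_op_iff[OF C] by blast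
    have "\<forall>a\<in>A. \<exists>f. to_fract f \<in> Q \<and> a \<in> range (coeff f)" using A(2) unfolding C_def by blast
    then obtain F where F: "\<And>a. a \<in> A \<Longrightarrow> to_fract (F a) \<in> Q \<and> a \<in> range (coeff (F a))" by metis
    have "F ` A \<subseteq> polys_over D" using F coD by (auto simp: mem_polys_over)
    then obtain f where f: "f \<in> polys_over D" "to_fract f \<in> PX.span (to_fract ` F ` A)"
      "\<forall>a\<in>F ` A. range (coeff a) \<subseteq> range (coeff f)"
      using ex_collecting_poly[of "F ` A"] A(1) by blast
    have "PX.span (to_fract ` F ` A) \<subseteq> Q" using F by (intro PX.span_least sQ) auto
    then have fQ: "to_fract f \<in> Q" using f(2) by blast
    have "A \<subseteq> range (coeff f)" using f(3) F by blast
    then have v: "1 \<in> v_op D (range (coeff f))" using A(3) v_op_mono by blast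
    have "1 \<in> v_op (poly_ring D) {cst c, to_fract f}"
      unfolding PX.v_op_iff
    proof (intro allI impI)
      fix z assume "\<forall>a\<in>{cst c, to_fract f}. z * a \<in> poly_ring D"
      then have z: "z * cst c \<in> poly_ring D" "z * to_fract f \<in> poly_ring D" by auto
      obtain g0 where g0: "z * cst c = to_fract g0" using z(1) by (rule poly_ringE)
      define g where "g = smult (1 / c) g0"
      have "to_fract g0 = to_fract (smult c g)" using c(2) by (simp add: g_def)
      then have "z * cst c = to_fract g * cst c" using g0 unfolding to_fract_smult by (simp only: mult.commute)
      then have zg: "z = to_fract g" using c(2) by simp
      have "f * g \<in> polys_over D" using z(2) zg by (simp add: mult.commute flip: to_fract_mult)
      then have "g \<in> polys_over D" using v_unit_content_cancel[OF f(1) v] by simp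
      then show "1 * z \<in> poly_ring D" using zg by simp
    qed
    moreover have "v_op (poly_ring D) {cst c, to_fract f} \<subseteq> Q"
      using c fQ by (intro PX.t_idealD[OF Q'(1)]) auto
    ultimately show False using Q'(3) by blast
  qed
  then obtain M where M: "M \<in> t_Max D" "C \<subseteq> M" using ex_t_Max[OF C CD] by blast
  have QM: "Q \<subseteq> poly_ring M"
  proof
    fix x assume x: "x \<in> Q"
    then obtain f where f: "x = to_fract f" using QD by blast
    then have "coeff f i \<in> M" for i using x M(2) by (auto simp: C_def)
    then show "x \<in> poly_ring M" using f by (simp add: mem_polys_over)
  qed
  note M' = t_MaxD[OF M(1)]
  have "cst 1 \<notin> poly_ring M"
    using M'(3) submodule_zero[OF is_primeD(1)[OF M'(5)]] cst_mem_poly_ring by blast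
  then have "1 \<notin> poly_ring M" by (simp flip: one_pCons)
  then have "poly_ring M = Q"
    by (intro Q'(6) t_ideal_poly_ring M' poly_ring_mono QM)
  then show ?thesis using M(1) by blast
qed

lemma one_notin_poly_ring: "is_submodule D I \<Longrightarrow> 1 \<notin> I \<Longrightarrow> 1 \<notin> poly_ring I"
  using cst_mem_poly_ring[of I 1] submodule_zero[of I] by (simp flip: one_pCons)

text \<open>A \<open>t\<close>-maximal ideal above M[X] contains a nonzero constant, so it is
  extended from some \<open>t\<close>-maximal ideal above \<open>M\<close>, which must be
  \<open>M\<close>.\<close>

lemma t_Max_poly_ring:
  assumes M: "M \<in> t_Max D"
  shows "poly_ring M \<in> t_Max (poly_ring D)"
proof -
  note M' = t_MaxD[OF M]
  have sM: "is_submodule D M" by (rule is_primeD(1)[OF M'(5)])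
  have t: "t_ideal (poly_ring D) (poly_ring M)" by (rule t_ideal_poly_ring[OF M'(1)])
  obtain Q where Q: "Q \<in> t_Max (poly_ring D)" "poly_ring M \<subseteq> Q"
  proof -
    have "1 \<notin> t_op (poly_ring D) (poly_ring M)"
      using t one_notin_poly_ring[OF sM M'(3)] by (simp add: t_ideal_def)
    then show thesis using PX.ex_t_Max[OF PX.t_ideal_nz[OF t] poly_ring_mono[OF M'(2)]] that by blast
  qed
  obtain m where m: "m \<in> M" "m \<noteq> 0" using nz_ideals_nonzero[OF t_ideal_nz[OF M'(1)]] by blast
  then have "cst m \<in> poly_ring M" using submodule_zero[OF sM] cst_mem_poly_ring by blast
  then obtain M1 where M1: "M1 \<in> t_Max D" "Q = poly_ring M1"
    using t_Max_poly_ring_nonzero_contraction[OF Q(1) _ m(2)] Q(2) by blast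
  note M1' = t_MaxD[OF M1(1)]
  have "M \<subseteq> M1" using Q(2) M1(2) poly_ring_subset_iff[OF sM is_primeD(1)[OF M1'(5)]] by simp
  then have "M1 = M" by (intro M'(6) M1')
  then show ?thesis using Q(1) M1(2) by simp
qed

text \<open>A coefficient of \<open>f\<close> outside \<open>P\<close> makes \<open>P\<close>
  saturated in \<open>D\<close> with respect to \<open>f\<close>, so \<open>f\<close> cancels modulo
  \<open>P\<close>.\<close>

lemma is_prime_poly_ring:
  assumes P: "is_prime D P" and nz: "P \<in> nz_ideals D"
  shows "is_prime (poly_ring D) (poly_ring P)"
  unfolding is_prime_def
proof (intro conjI ballI impI)
  note P' = is_primeD[OF P]
  show "is_ideal (poly_ring D) (poly_ring P)"
    unfolding is_ideal_def using submodule_poly_ring[OF P'(1)] poly_ring_mono[OF P'(2)]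
    by (auto intro!: bexI[of _ 1])
  show "poly_ring P \<subset> poly_ring D"
    using poly_ring_mono[OF P'(2)] one_notin_poly_ring[OF P'(1,3)] PX.one_closed by blast
  fix x y assume "x \<in> poly_ring D" "y \<in> poly_ring D" and xy: "x * y \<in> poly_ring P"
  then obtain f g where fg: "f \<in> polys_over D" "g \<in> polys_over D" "x = to_fract f" "y = to_fract g"
    by (auto elim!: poly_ringE)
  have "g \<in> polys_over P" if "f \<notin> polys_over P"
  proof (rule content_saturated_cancel[OF fg(1) P'(1) submodule_self _ fg(2)])
    obtain i where i: "coeff f i \<notin> P" using \<open>f \<notin> polys_over P\<close> by (auto simp: mem_polys_over)
    show "f * g \<in> polys_over P" using xy fg by (simp flip: to_fract_mult)
    fix x assume "x \<in> D" "\<And>i. coeff f i * x \<in> P"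
    then show "x \<in> P" using P'(4)[of "coeff f i" x] i fg(1) by (auto simp: mem_polys_over)
  qed
  then show "x \<in> poly_ring P \<or> y \<in> poly_ring P" using fg by auto
qed

end

subsection \<open>Nagata rings\<close>

lemma fractions_domain:
  assumes "domain_with_fraction_field R" "S \<subseteq> R" "0 \<notin> S" "1 \<in> S"
    and "\<And>s t. s \<in> S \<Longrightarrow> t \<in> S \<Longrightarrow> s * t \<in> S"
  shows "subdomain (fractions R S)" "R \<subseteq> fractions R S"
    and "\<And>s. s \<in> S \<Longrightarrow> 1 / s \<in> fractions R S"
    and "\<And>x. x \<in> fractions R S \<longleftrightarrow> (\<exists>s\<in>S. s * x \<in> R)"
proof -
  show "subdomain (fractions R S)"
    using domain_with_fraction_field_fractions[OF assms] by (simp add: domain_with_fraction_field_def)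
  have 1: "1 \<in> R" using assms by blast
  show "R \<subseteq> fractions R S" unfolding fractions_def using assms(4) by force
  show "1 / s \<in> fractions R S" if "s \<in> S" for s using 1 that unfolding fractions_def by blast
  fix x
  show "x \<in> fractions R S \<longleftrightarrow> (\<exists>s\<in>S. s * x \<in> R)"
  proof
    assume "x \<in> fractions R S"
    then obtain a s where as: "x = a / s" "a \<in> R" "s \<in> S" by (auto simp: fractions_def)
    then have "s * x = a" using assms(3) by auto
    then show "\<exists>s\<in>S. s * x \<in> R" using as by blast
  next
    assume "\<exists>s\<in>S. s * x \<in> R"
    then obtain s where s: "s \<in> S" "s * x \<in> R" by blast
    then have "x = (s * x) / s" using assms(3) by auto
    then show "x \<in> fractions R S" unfolding fractions_def using s by blast
  qed
qed

context polynomial_domain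
begin

lemma polys_over_one: "1 \<in> polys_over D"
  by (simp add: one_pCons polys_over_const)

lemma content_ideal_eq_ring_iff:
  assumes "f \<in> polys_over D"
  shows "content_ideal D f = D \<longleftrightarrow> 1 \<in> content_ideal D f"
proof
  assume "1 \<in> content_ideal D f"
  then have "D \<subseteq> content_ideal D f"
    using submodule_scale[OF submodule_span, of _ 1 "range (coeff f)"] by (auto simp: content_ideal_def)
  moreover have "content_ideal D f \<subseteq> D"
    unfolding content_ideal_def using assms by (intro span_least submodule_self) (auto simp: mem_polys_over)
  ultimately show "content_ideal D f = D" by blast
qed auto

lemma unit_content_saturated:
  assumes f: "1 \<in> content_ideal D f" and T: "is_submodule D T" and x: "\<And>i. coeff f i * x \<in> T"
  shows "x \<in> T"
proof -
  have "content_ideal D f \<subseteq> {c. \<forall>y\<in>{x}. c * y \<in> T}"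
    unfolding content_ideal_def using x by (intro span_least submodule_colon T) auto
  then show ?thesis using f by auto
qed

lemma unit_content_cancel:
  assumes "f \<in> polys_over D" "1 \<in> content_ideal D f" and T: "is_submodule D T" and "f * g \<in> polys_over T"
  shows "g \<in> polys_over T"
proof (rule content_saturated_cancel[OF assms(1) T])
  show "is_submodule D UNIV" "g \<in> polys_over UNIV" by (auto simp: is_submodule_def mem_polys_over)
  show "f * g \<in> polys_over T" by (rule assms(4))
  show "x \<in> T" if "\<And>i. coeff f i * x \<in> T" for x using that by (rule unit_content_saturated[OF assms(2) T])
qed

definition unit_content_polys :: "'k poly set" where
  "unit_content_polys = {h \<in> polys_over D. content_ideal D h = D}"

lemma unit_content_polys_iff: "h \<in> unit_content_polys \<longleftrightarrow> h \<in> polys_over D \<and> 1 \<in> content_ideal D h"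
  using content_ideal_eq_ring_iff by (auto simp: unit_content_polys_def)

lemma unit_content_polys_nonzero: "h \<in> unit_content_polys \<Longrightarrow> h \<noteq> 0"
proof
  assume "h \<in> unit_content_polys" "h = 0"
  then have "1 \<in> span {0}" by (simp add: unit_content_polys_iff content_ideal_def)
  moreover have "span {0} \<subseteq> {0}" by (rule span_least) (auto simp: is_submodule_def)
  ultimately show False by auto
qed

text \<open>Cancelling \<open>f\<close> modulo the content of \<open>f * g\<close> shows that
  \<open>g\<close> has its coefficients there, and these generate the unit ideal.\<close>

lemma unit_content_polys_mult:
  assumes "f \<in> unit_content_polys" "g \<in> unit_content_polys"
  shows "f * g \<in> unit_content_polys"
proof -
  have fg: "f \<in> polys_over D" "1 \<in> content_ideal D f" "g \<in> polys_over D" "1 \<in> content_ideal D g"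
    using assms by (auto simp: unit_content_polys_iff)
  have T: "is_submodule D (content_ideal D (f * g))" by (simp add: content_ideal_def submodule_span)
  have "f * g \<in> polys_over (content_ideal D (f * g))"
    by (auto simp: mem_polys_over content_ideal_def intro!: span_superset)
  then have "g \<in> polys_over (content_ideal D (f * g))" by (rule unit_content_cancel[OF fg(1,2) T])
  then have "content_ideal D g \<subseteq> content_ideal D (f * g)"
    unfolding content_ideal_def[of D g] by (intro span_least T) (auto simp: mem_polys_over)
  then show ?thesis using fg by (auto simp: unit_content_polys_iff polys_over_mult submodule_self)
qed

lemma one_unit_content: "1 \<in> unit_content_polys"
proof -
  have "coeff 1 0 \<in> content_ideal D 1" unfolding content_ideal_def by (rule span_superset) blast
  then show ?thesis by (simp add: unit_content_polys_iff polys_over_one)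
qed

lemma Nagata_ring_eq: "Nagata_ring D = fractions (poly_ring D) (to_fract ` unit_content_polys)"
  by (simp add: Nagata_ring_def unit_content_polys_def)

lemma unit_content_multiplicative:
  "to_fract ` unit_content_polys \<subseteq> poly_ring D" "0 \<notin> to_fract ` unit_content_polys"
  "1 \<in> to_fract ` unit_content_polys"
  "\<And>s t. s \<in> to_fract ` unit_content_polys \<Longrightarrow> t \<in> to_fract ` unit_content_polys \<Longrightarrow>
    s * t \<in> to_fract ` unit_content_polys"
proof -
  show "to_fract ` unit_content_polys \<subseteq> poly_ring D" by (auto simp: unit_content_polys_iff)
  show "0 \<notin> to_fract ` unit_content_polys" using unit_content_polys_nonzero by auto
  show "1 \<in> to_fract ` unit_content_polys" using one_unit_content by (auto intro!: image_eqI[of _ _ 1])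
  fix s t assume "s \<in> to_fract ` unit_content_polys" "t \<in> to_fract ` unit_content_polys"
  then obtain f g where "f \<in> unit_content_polys" "s = to_fract f" "g \<in> unit_content_polys" "t = to_fract g"
    by blast
  then show "s * t \<in> to_fract ` unit_content_polys"
    using unit_content_polys_mult by (intro image_eqI[of _ _ "f * g"]) auto
qed

lemmas Nagata_ring_facts =
  fractions_domain[OF PX.dom unit_content_multiplicative, folded Nagata_ring_eq]

definition Nagata_ext :: "'k set \<Rightarrow> 'k poly fract set" where
  "Nagata_ext I = {x. \<exists>s\<in>unit_content_polys. to_fract s * x \<in> poly_ring I}"

lemma Nagata_ring_iff: "x \<in> Nagata_ring D \<longleftrightarrow> (\<exists>s\<in>unit_content_polys. to_fract s * x \<in> poly_ring D)"
  using Nagata_ring_facts(4) by auto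

lemma submodule_Nagata_ext:
  assumes I: "is_submodule D I"
  shows "is_submodule (Nagata_ring D) (Nagata_ext I)"
proof -
  have "is_submodule (Nagata_ring D) {x. \<exists>s\<in>to_fract ` unit_content_polys. s * x \<in> poly_ring I}"
    by (rule PX.submodule_fractions[OF submodule_poly_ring[OF I] unit_content_multiplicative(1,3,4)])
      (use Nagata_ring_facts(4) in auto)
  then show ?thesis by (simp add: Nagata_ext_def)
qed

lemma poly_ring_subset_Nagata_ext: "poly_ring I \<subseteq> Nagata_ext I"
  unfolding Nagata_ext_def using one_unit_content by (auto intro!: bexI[of _ 1])

lemma cst_in_Nagata_ext: "is_submodule D I \<Longrightarrow> c \<in> I \<Longrightarrow> cst c \<in> Nagata_ext I"
  using cst_mem_poly_ring[of I c] submodule_zero[of I] poly_ring_subset_Nagata_ext by blast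

text \<open>Extension to the Nagata ring loses nothing: denominators of unit content cancel modulo
  every submodule, even when \<open>f\<close> has coefficients outside \<open>D\<close>.\<close>

lemma polys_in_Nagata_ext:
  assumes I: "is_submodule D I" and f: "to_fract f \<in> Nagata_ext I"
  shows "f \<in> polys_over I"
proof -
  obtain s where s: "s \<in> unit_content_polys" "to_fract s * to_fract f \<in> poly_ring I"
    using f by (auto simp: Nagata_ext_def)
  then have "s * f \<in> polys_over I" by (simp flip: to_fract_mult)
  then show ?thesis using unit_content_cancel[OF _ _ I] s by (auto simp: unit_content_polys_iff)
qed

text \<open>Take the largest candidate J = (I : I^2), and let H be a witness for the extension of
  \<open>I\<close>. For h in H, multiplying by c^2 shows that some unit-content multiple s h is a
  polynomial over the field; multiplying by a b with a, b in I puts its coefficients into J. So the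
  extension of \<open>I\<close> lies in that of I^2 J, and contraction gives I \<subseteq> I^2
  J.\<close>

lemma Clifford_regular_if_Nagata_ring:
  assumes reg: "Clifford_regular (Nagata_ring D)"
  shows "Clifford_regular D"
  unfolding Clifford_regular_def
proof
  interpret N: subdom "Nagata_ring D" by unfold_locales (rule Nagata_ring_facts(1))
  fix I assume I: "I \<in> nz_ideals D"
  note sI = nz_ideals_submodule[OF I]
  obtain c where c: "c \<in> I" "c \<in> D" "c \<noteq> 0" using nz_ideals_Int_ring[OF I] by blast
  obtain d where d: "d \<in> D" "d \<noteq> 0" "\<forall>x\<in>I. d * x \<in> D" using nz_ideals_denominator[OF I] by blast
  define J where "J = {y. \<forall>a\<in>I. \<forall>b\<in>I. y * a * b \<in> I}"
  have sJ: "is_submodule D J"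
    using sI unfolding J_def is_submodule_def by (auto simp: algebra_simps)
  have J: "J \<in> nz_ideals D"
  proof (rule nz_idealsI[OF sJ])
    show "d \<in> J" unfolding J_def using d submodule_scale[OF sI] by blast
    show "d * c * c \<in> D" using d c by (intro mult_closed)
    fix y assume "y \<in> J"
    then have "d * (y * c * c) \<in> D" using d c by (auto simp: J_def)
    then show "d * c * c * y \<in> D" by (simp add: mult_ac)
  qed (use d c in auto)
  let ?P = "ideal_mult D (ideal_mult D I I) J"
  have P: "is_submodule D ?P" by (rule submodule_ideal_mult)
  have E: "Nagata_ext I \<in> nz_ideals (Nagata_ring D)"
  proof (rule N.nz_idealsI[OF submodule_Nagata_ext[OF sI]])
    show "cst c \<in> Nagata_ext I" using c cst_in_Nagata_ext[OF sI] by blast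
    show "cst d \<in> Nagata_ring D" using Nagata_ring_facts(2) cst_closed[OF d(1)] by blast
    fix y assume "y \<in> Nagata_ext I"
    then obtain s f where s: "s \<in> unit_content_polys" "to_fract s * y = to_fract f" "f \<in> polys_over I"
      unfolding Nagata_ext_def by (blast elim: poly_ringE)
    have "smult d f \<in> polys_over D" using s(3) d by (auto simp: mem_polys_over)
    then have "to_fract (smult d f) \<in> poly_ring D" by simp
    then have "to_fract s * (cst d * y) \<in> poly_ring D"
      unfolding to_fract_smult s(2)[symmetric] by (simp only: mult_ac)
    then show "cst d * y \<in> Nagata_ring D" unfolding Nagata_ring_iff using s(1) by blast
  qed (use c d in auto)
  then have "vN_regular (Nagata_ring D) (Nagata_ext I)" using reg by (simp add: Clifford_regular_def)
  then obtain H where "H \<in> nz_ideals (Nagata_ring D)"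
    and H: "Nagata_ext I = ideal_mult (Nagata_ring D) (ideal_mult (Nagata_ring D) (Nagata_ext I) (Nagata_ext I)) H"
      "\<And>x y z. x \<in> Nagata_ext I \<Longrightarrow> y \<in> Nagata_ext I \<Longrightarrow> z \<in> H \<Longrightarrow> x * y * z \<in> Nagata_ext I"
    using N.vN_regularD by blast
  have HJ: "\<exists>s\<in>unit_content_polys. to_fract s * h \<in> poly_ring J" if h: "h \<in> H" for h
  proof -
    have cE: "cst a \<in> Nagata_ext I" if "a \<in> I" for a using cst_in_Nagata_ext[OF sI that] .
    have "cst c * cst c * h \<in> Nagata_ext I" using H(2) h cE c(1) by blast
    then obtain s f where s: "s \<in> unit_content_polys" "to_fract s * (cst c * cst c * h) = to_fract f"
      unfolding Nagata_ext_def by (blast elim: poly_ringE)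
    define g where "g = smult (1 / (c * c)) f"
    have "f = smult (c * c) g" using c(3) by (simp add: g_def)
    then have "to_fract f = cst c * cst c * to_fract g" by (simp flip: to_fract_mult)
    then have "cst c * cst c * (to_fract s * h) = cst c * cst c * to_fract g"
      using s(2) by (simp only: mult_ac)
    then have sg: "to_fract s * h = to_fract g" using c(3) by simp
    have "coeff g i \<in> J" for i
      unfolding J_def
    proof (intro CollectI ballI)
      fix a b assume "a \<in> I" "b \<in> I"
      then have abh: "cst a * cst b * h \<in> Nagata_ext I" using H(2) h cE by blast
      have "to_fract s \<in> Nagata_ring D"
        using s(1) unit_content_multiplicative(1) Nagata_ring_facts(2) by blast
      then have "to_fract s * (cst a * cst b * h) \<in> Nagata_ext I"
        using abh by (rule N.submodule_scale[OF submodule_Nagata_ext[OF sI]])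
      moreover have "to_fract s * (cst a * cst b * h) = cst a * cst b * to_fract g"
        unfolding sg[symmetric] by (simp only: mult_ac)
      moreover have "cst a * cst b * to_fract g = to_fract (smult (a * b) g)"
        by (simp add: mult.commute flip: to_fract_mult)
      ultimately have "to_fract (smult (a * b) g) \<in> Nagata_ext I" by simp
      then have "smult (a * b) g \<in> polys_over I" by (rule polys_in_Nagata_ext[OF sI])
      then show "coeff g i * a * b \<in> I" by (simp add: mem_polys_over mult_ac)
    qed
    then have "to_fract s * h \<in> poly_ring J" unfolding sg by (simp add: mem_polys_over)
    then show ?thesis using s(1) by blast
  qed
  have "ideal_mult (Nagata_ring D) (ideal_mult (Nagata_ring D) (Nagata_ext I) (Nagata_ext I)) H \<subseteq> Nagata_ext ?P"
  proof (rule N.ideal_mult3_least[OF submodule_Nagata_ext[OF P]])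
    fix x y h assume xyh: "x \<in> Nagata_ext I" "y \<in> Nagata_ext I" "h \<in> H"
    obtain s f where f: "s \<in> unit_content_polys" "to_fract s * x = to_fract f" "f \<in> polys_over I"
      using xyh(1) unfolding Nagata_ext_def by (blast elim: poly_ringE)
    obtain t g where g: "t \<in> unit_content_polys" "to_fract t * y = to_fract g" "g \<in> polys_over I"
      using xyh(2) unfolding Nagata_ext_def by (blast elim: poly_ringE)
    obtain r u where u: "r \<in> unit_content_polys" "to_fract r * h = to_fract u" "u \<in> polys_over J"
      using HJ[OF xyh(3)] by (blast elim: poly_ringE)
    have "f * g * u \<in> polys_over ?P" using f g u by (intro polys_over_mult_ideal_mult)
    then have "to_fract f * to_fract g * to_fract u \<in> poly_ring ?P" by (simp flip: to_fract_mult)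
    then have "to_fract (s * t * r) * (x * y * h) \<in> poly_ring ?P"
      unfolding f(2)[symmetric] g(2)[symmetric] u(2)[symmetric] to_fract_mult by (simp only: mult_ac)
    then show "x * y * h \<in> Nagata_ext ?P"
      unfolding Nagata_ext_def using unit_content_polys_mult f(1) g(1) u(1) by blast
  qed
  then have E_sub: "Nagata_ext I \<subseteq> Nagata_ext ?P" using H(1) by simp
  show "vN_regular D I"
  proof (rule vN_regularI[OF sI J])
    fix x y z assume "x \<in> I" "y \<in> I" "z \<in> J"
    then have "z * x * y \<in> I" by (simp add: J_def)
    then show "x * y * z \<in> I" by (simp add: mult_ac)
  next
    show "I \<subseteq> ?P"
    proof
      fix a assume "a \<in> I"
      then have "to_fract [:a:] \<in> Nagata_ext ?P" using E_sub cst_in_Nagata_ext[OF sI] by blast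
      then have "[:a:] \<in> polys_over ?P" by (rule polys_in_Nagata_ext[OF P])
      then show "a \<in> ?P" using submodule_zero[OF P] by (simp add: polys_over_const)
    qed
  qed
qed

subsection \<open>The ring \<open>Na(D,v)\<close>\<close>

definition v_unit_polys :: "'k poly set" where
  "v_unit_polys = {h \<in> polys_over D. h \<noteq> 0 \<and> v_op D (content_ideal D h) = D}"

lemma v_unit_polys_iff:
  "h \<in> v_unit_polys \<longleftrightarrow> h \<in> polys_over D \<and> h \<noteq> 0 \<and> 1 \<in> v_op D (range (coeff h))"
proof -
  have "v_op D (content_ideal D h) = D \<longleftrightarrow> 1 \<in> v_op D (range (coeff h))" if "h \<in> polys_over D"
  proof -
    have "v_op D (range (coeff h)) \<subseteq> D" using that by (intro v_op_subset_ring) (auto simp: mem_polys_over)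
    moreover have "D \<subseteq> v_op D (range (coeff h))" if "1 \<in> v_op D (range (coeff h))"
      using submodule_scale[OF submodule_v_op _ that] by auto
    ultimately show ?thesis unfolding content_ideal_def v_op_span by auto
  qed
  then show ?thesis by (auto simp: v_unit_polys_def)
qed

lemma v_unit_multiplicative:
  "to_fract ` v_unit_polys \<subseteq> poly_ring D" "0 \<notin> to_fract ` v_unit_polys" "1 \<in> to_fract ` v_unit_polys"
  "\<And>s t. s \<in> to_fract ` v_unit_polys \<Longrightarrow> t \<in> to_fract ` v_unit_polys \<Longrightarrow> s * t \<in> to_fract ` v_unit_polys"
proof -
  show "to_fract ` v_unit_polys \<subseteq> poly_ring D" "0 \<notin> to_fract ` v_unit_polys"
    by (auto simp: v_unit_polys_def)
  have "coeff 1 0 \<in> v_op D (range (coeff 1))" by (rule subsetD[OF v_op_superset]) (rule rangeI)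
  then have "1 \<in> v_unit_polys" using polys_over_one by (simp add: v_unit_polys_iff)
  then show "1 \<in> to_fract ` v_unit_polys" by (auto intro!: image_eqI[of _ _ 1])
  fix s t assume "s \<in> to_fract ` v_unit_polys" "t \<in> to_fract ` v_unit_polys"
  then obtain f g where f: "f \<in> v_unit_polys" "s = to_fract f" and g: "g \<in> v_unit_polys" "t = to_fract g" by blast
  have "1 \<in> v_op D (range (coeff (f * g)))"
    unfolding v_op_iff
  proof (intro allI impI)
    fix z assume "\<forall>a\<in>range (coeff (f * g)). z * a \<in> D"
    then have "f * smult z g \<in> polys_over D" by (auto simp: mem_polys_over)
    then have "smult z g \<in> polys_over D"
      using f(1) unfolding v_unit_polys_iff by (blast intro: v_unit_content_cancel)
    then have "\<forall>a\<in>range (coeff g). z * a \<in> D" by (auto simp: mem_polys_over)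
    then show "1 * z \<in> D" using g(1) by (simp add: v_unit_polys_iff v_op_iff)
  qed
  then have "f * g \<in> v_unit_polys"
    using f g by (auto simp: v_unit_polys_iff polys_over_mult submodule_self)
  then show "s * t \<in> to_fract ` v_unit_polys" using f g by (intro image_eqI[of _ _ "f * g"]) auto
qed

lemma Na_v_eq: "Na_v D = fractions (poly_ring D) (to_fract ` v_unit_polys)"
  by (simp add: Na_v_def v_unit_polys_def)

lemmas Na_v_facts = fractions_domain[OF PX.dom v_unit_multiplicative, folded Na_v_eq]

lemma Na_v_iff: "x \<in> Na_v D \<longleftrightarrow> (\<exists>s\<in>v_unit_polys. to_fract s * x \<in> poly_ring D)"
  using Na_v_facts(4) by auto

text \<open>Links the finite sets that witness \<open>w\<close> over D[X] to the single polynomials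
  inverted in Na(D,v). Multipliers that are constants suffice to test the content of the collecting
  polynomial.\<close>

lemma v_unit_poly_in_span:
  assumes A: "finite A" "A \<subseteq> poly_ring D" "1 \<in> v_op (poly_ring D) A"
  shows "\<exists>h\<in>v_unit_polys. to_fract h \<in> PX.span A"
proof -
  obtain B where B: "B \<subseteq> polys_over D" "finite B" and AB: "A = to_fract ` B"
    using finite_subset_image[OF A(1), of to_fract "polys_over D"] A(2) unfolding poly_ring_def by blast
  obtain f where f: "f \<in> polys_over D" "to_fract f \<in> PX.span A"
    "\<forall>b\<in>B. range (coeff b) \<subseteq> range (coeff f)"
    using ex_collecting_poly[OF B(2,1)] AB by auto
  have "1 \<in> v_op D (range (coeff f))"
    unfolding v_op_iff
  proof (intro allI impI)
    fix z assume z: "\<forall>a\<in>range (coeff f). z * a \<in> D"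
    have "cst z * a \<in> poly_ring D" if a: "a \<in> A" for a
    proof -
      obtain b where b: "b \<in> B" "a = to_fract b" using a AB by blast
      then have "z * coeff b i \<in> D" for i using z f(3) by blast
      then have "to_fract (smult z b) \<in> poly_ring D" by (simp add: mem_polys_over)
      then show ?thesis unfolding to_fract_smult b(2) .
    qed
    then have "1 * cst z \<in> poly_ring D" using A(3) unfolding PX.v_op_iff by blast
    then show "1 * z \<in> D" by (simp add: polys_over_const)
  qed
  moreover have "f \<noteq> 0"
  proof
    assume "f = 0"
    then have "coeff b i = 0" if "b \<in> B" for b i using f(3) that by fastforce
    then have "b = 0" if "b \<in> B" for b using that by (simp add: poly_eq_iff)
    then have B0: "b = 0" if "b \<in> B" for b using that by blast
    \<comment> \<open>If \<open>A\<close> contains nothing but 0, then even 1/X multiplies it into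
      D[X], so 1 in its \<open>v\<close>-closure would make 1/X a polynomial.\<close>
    have "(1 / to_fract (monom 1 1)) * a \<in> poly_ring D" if "a \<in> A" for a
    proof -
      have "a = 0" using AB that B0 by auto
      then show ?thesis by (simp add: PX.zero_closed)
    qed
    then have "1 * (1 / to_fract (monom 1 1)) \<in> poly_ring D" using A(3) unfolding PX.v_op_iff by blast
    then show False using X_inverse_notin by simp
  qed
  ultimately show ?thesis using f by (auto simp: v_unit_polys_iff)
qed

text \<open>An element of a \<open>w\<close>-closure enters the ideal itself after multiplication by
  some \<open>h\<close> in \<open>v_unit_polys\<close>, and \<open>h\<close> is a unit of Na(D,v).
  Equality of \<open>w\<close>-closures thus gives both inclusions up to such units.\<close>

lemma Clifford_regular_Na_v_if_w_regular:
  assumes reg: "Clifford_w_regular (poly_ring D)"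
  shows "Clifford_regular (Na_v D)"
proof (rule Clifford_regular_localizationI[OF PX.subdomain Na_v_facts(1,2)])
  have Sfacts: "s \<in> poly_ring D" "s \<noteq> 0" "1 / s \<in> Na_v D" if "s \<in> to_fract ` v_unit_polys" for s
    using that v_unit_multiplicative(1,2) Na_v_facts(3) by blast+
  show "\<exists>s\<in>poly_ring D. s \<noteq> 0 \<and> 1 / s \<in> Na_v D \<and> s * x \<in> poly_ring D" if x: "x \<in> Na_v D" for x
  proof -
    obtain s where s: "s \<in> v_unit_polys" "to_fract s * x \<in> poly_ring D" using x unfolding Na_v_iff by blast
    then show ?thesis using Sfacts[OF imageI[OF s(1)]] by blast
  qed
  have w: "\<exists>s. s \<noteq> 0 \<and> 1 / s \<in> Na_v D \<and> s * x \<in> I" if I: "I \<in> nz_ideals (poly_ring D)" and x: "x \<in> w_op (poly_ring D) I" for x I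
  proof -
    note sI = PX.nz_ideals_submodule[OF I]
    obtain A where A: "finite A" "A \<subseteq> poly_ring D" "1 \<in> v_op (poly_ring D) A" "\<forall>a\<in>A. a * x \<in> I"
      using x unfolding PX.w_op_iff_finite[OF I] by blast
    obtain h where h: "h \<in> v_unit_polys" "to_fract h \<in> PX.span A" using v_unit_poly_in_span[OF A(1-3)] by blast
    have "PX.span A \<subseteq> {y. \<forall>u\<in>{x}. y * u \<in> I}" using A(4) by (intro PX.span_least PX.submodule_colon sI) auto
    then have "to_fract h * x \<in> I" using h(2) by blast
    then show ?thesis using Sfacts[OF imageI[OF h(1)]] by blast
  qed
  have w_superset: "I \<subseteq> w_op (poly_ring D) I" if "I \<in> nz_ideals (poly_ring D)" for I
    unfolding w_op_def by (auto intro: hull_inc)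
  fix I assume I: "I \<in> nz_ideals (poly_ring D)"
  then obtain J where J: "J \<in> nz_ideals (poly_ring D)"
    "w_op (poly_ring D) I = w_op (poly_ring D) (ideal_mult (poly_ring D) (ideal_mult (poly_ring D) I I) J)"
    using reg unfolding Clifford_w_regular_def w_regular_def by blast
  let ?P = "ideal_mult (poly_ring D) (ideal_mult (poly_ring D) I I) J"
  have P: "?P \<in> nz_ideals (poly_ring D)"
    using I J(1) by (intro PX.ideal_mult_nz_ideals)
  show "\<exists>J\<in>nz_ideals (poly_ring D).
      (\<forall>x\<in>I. \<forall>y\<in>I. \<forall>z\<in>J. \<exists>s. s \<noteq> 0 \<and> 1 / s \<in> Na_v D \<and> s * (x * y * z) \<in> I) \<and>
      (\<forall>x\<in>I. \<exists>s. s \<noteq> 0 \<and> 1 / s \<in> Na_v D \<and> s * x \<in> ideal_mult (poly_ring D) (ideal_mult (poly_ring D) I I) J)"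
  proof (rule bexI[OF _ J(1)], intro conjI ballI)
    fix x y z assume "x \<in> I" "y \<in> I" "z \<in> J"
    then have "x * y * z \<in> w_op (poly_ring D) ?P" using w_superset[OF P] PX.ideal_mult3I by blast
    then show "\<exists>s. s \<noteq> 0 \<and> 1 / s \<in> Na_v D \<and> s * (x * y * z) \<in> I" using w[OF I] J(2) by blast
  next
    fix x assume "x \<in> I"
    then have "x \<in> w_op (poly_ring D) ?P" using w_superset[OF I] J(2) by blast
    then show "\<exists>s. s \<noteq> 0 \<and> 1 / s \<in> Na_v D \<and> s * x \<in> ?P" by (rule w[OF P])
  qed
qed

lemma v_unit_polys_notin_t_Max:
  assumes h: "h \<in> v_unit_polys" and M: "M \<in> t_Max D"
  shows "h \<notin> polys_over M"
proof
  assume "h \<in> polys_over M"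
  then have "v_op D (range (coeff h)) \<subseteq> M"
    by (intro t_idealD[OF t_MaxD(1)[OF M] finite_range_coeff]) (auto simp: mem_polys_over)
  then show False using h t_MaxD(3)[OF M] by (auto simp: v_unit_polys_iff)
qed

text \<open>Each \<open>t\<close>-maximal ideal of \<open>D\<close> is the contraction of a maximal ideal of \<open>Na(D,v)\<close>, so the
  finite character of the latter ring descends.\<close>

lemma t_finite_character_if_Na_v:
  assumes reg: "Clifford_regular (Na_v D)"
  shows "t_finite_character D"
  unfolding t_finite_character_def
proof (intro ballI impI)
  interpret B: subdom "Na_v D" by unfold_locales (rule Na_v_facts(1))
  fix c assume c: "c \<in> D" "c \<noteq> 0"
  have cB: "cst c \<in> Na_v D" using Na_v_facts(2) cst_closed[OF c(1)] by blast
  let ?X = "{Q. B.maximal_ideal Q \<and> cst c \<in> Q}"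
  have "finite ?X" using c by (intro B.Clifford_regular_finite_character[OF reg cB]) simp
  moreover have "{M \<in> t_Max D. c \<in> M} \<subseteq> (\<lambda>Q. {a \<in> D. cst a \<in> Q}) ` ?X"
  proof
    fix M assume "M \<in> {M \<in> t_Max D. c \<in> M}"
    then have M: "M \<in> t_Max D" "c \<in> M" by auto
    note M' = t_MaxD[OF M(1)]
    have sM: "is_submodule D M" by (rule is_primeD(1)[OF M'(5)])
    \<comment> \<open>The extension of M[X] to Na(D,v); it is proper because no polynomial that is
      inverted there has all its coefficients in \<open>M\<close>.\<close>
    define E where "E = {x. \<exists>h\<in>v_unit_polys. to_fract h * x \<in> poly_ring M}"
    have one: "1 \<in> v_unit_polys" using v_unit_multiplicative(3) by (auto simp flip: to_fract_1)
    have ME: "poly_ring M \<subseteq> E" unfolding E_def using one by (auto intro!: bexI[of _ 1])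
    have "is_submodule (Na_v D) {x. \<exists>h\<in>to_fract ` v_unit_polys. h * x \<in> poly_ring M}"
      by (rule PX.submodule_fractions[OF submodule_poly_ring[OF sM] v_unit_multiplicative(1,3,4)])
        (use Na_v_iff in auto)
    then have sE: "is_submodule (Na_v D) E" by (simp add: E_def)
    have "E \<subseteq> Na_v D"
      unfolding E_def subset_iff Na_v_iff using poly_ring_mono[OF M'(2)] by blast
    moreover have "1 \<notin> E"
      unfolding E_def using v_unit_polys_notin_t_Max[OF _ M(1)] by auto
    ultimately obtain Q where Q: "B.maximal_ideal Q" "E \<subseteq> Q" using B.ex_maximal_ideal[OF sE] by blast
    have sQ: "is_submodule (Na_v D) Q" and Q1: "1 \<notin> Q" using Q(1) by (auto simp: B.maximal_ideal_def)
    have sQ': "is_submodule (poly_ring D) Q"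
      using sQ Na_v_facts(2) by (auto simp: is_submodule_def)
    let ?P = "{a \<in> D. cst a \<in> Q}"
    have MP: "M \<subseteq> ?P"
    proof
      fix a assume a: "a \<in> M"
      then have "cst a \<in> E" using ME cst_mem_poly_ring[of M a] submodule_zero[OF sM] by blast
      then show "a \<in> ?P" using a M'(2) Q(2) by blast
    qed
    have sP: "is_submodule D ?P"
      unfolding is_submodule_def
    proof (intro conjI ballI)
      show "0 \<in> ?P" using MP submodule_zero[OF sM] by blast
    next
      fix x y assume "x \<in> ?P" "y \<in> ?P"
      moreover have "cst (x + y) = cst x + cst y" by (simp flip: to_fract_add)
      ultimately show "x + y \<in> ?P" using B.submodule_add[OF sQ] by auto
    next
      fix r x assume "r \<in> D" "x \<in> ?P"
      moreover have "cst (r * x) = cst r * cst x" by (simp flip: to_fract_mult)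
      ultimately show "r * x \<in> ?P" using PX.submodule_scale[OF sQ' cst_closed] by auto
    qed
    have P: "?P \<in> nz_ideals D" using MP M(2) c(2) by (intro nz_ideals_integral[OF sP]) auto
    \<comment> \<open>Otherwise finitely many constants in \<open>Q\<close> have 1 in their
      \<open>v\<close>-closure, and collecting them into one polynomial gives an element of
      \<open>Q\<close> that is a unit of Na(D,v).\<close>
    have "1 \<notin> t_op D ?P"
    proof
      assume "1 \<in> t_op D ?P"
      then obtain A where A: "finite A" "A \<subseteq> ?P" "1 \<in> v_op D A" unfolding t_op_iff[OF P] by blast
      \<comment> \<open>The nonzero \<open>c\<close> keeps the collecting polynomial from being
        0.\<close>
      let ?A = "(\<lambda>a. [:a:]) ` insert c A"
      have fin: "finite ?A" "?A \<subseteq> polys_over D" using A c by (auto simp: polys_over_const)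
      obtain f where f: "f \<in> polys_over D" "to_fract f \<in> PX.span (to_fract ` ?A)"
        "\<forall>a\<in>?A. range (coeff a) \<subseteq> range (coeff f)"
        using ex_collecting_poly[OF fin] by blast
      have "to_fract ` ?A \<subseteq> Q" using A(2) MP M(2) by auto
      then have fQ: "to_fract f \<in> Q" using f(2) PX.span_least[OF sQ'] by blast
      have Af: "insert c A \<subseteq> range (coeff f)"
      proof
        fix a assume "a \<in> insert c A"
        then have "range (coeff [:a:]) \<subseteq> range (coeff f)" using f(3) by blast
        moreover have "coeff [:a:] 0 = a" by simp
        ultimately show "a \<in> range (coeff f)" by (metis rangeI subsetD)
      qed
      then have "f \<noteq> 0" using c(2) by auto
      moreover have "1 \<in> v_op D (range (coeff f))" using v_op_mono[of A "range (coeff f)"] Af A(3) by blast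
      ultimately have "f \<in> v_unit_polys" using f(1) by (simp add: v_unit_polys_iff)
      then have "1 / to_fract f * to_fract f \<in> Q" using fQ Na_v_facts(3) by (intro B.submodule_scale[OF sQ]) auto
      then show False using Q1 \<open>f \<noteq> 0\<close> by simp
    qed
    then obtain M1 where M1: "M1 \<in> t_Max D" "?P \<subseteq> M1" using ex_t_Max[OF P] by blast
    have "M1 = M" using MP M1 by (intro M'(6) t_MaxD[OF M1(1)]) auto
    then have "?P = M" using MP M1(2) by blast
    moreover have "cst c \<in> Q" using MP M(2) by blast
    ultimately show "M \<in> (\<lambda>Q. {a \<in> D. cst a \<in> Q}) ` ?X" using Q(1) by blast
  qed
  ultimately show "finite {M \<in> t_Max D. c \<in> M}" using finite_surj by blast
qed

end

subsection \<open>Localizations of a polynomial ring at extended primes\<close>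

context polynomial_domain
begin

lemma localization_common_denominator:
  assumes P: "is_prime D P" and f: "f \<in> polys_over (localization D P)"
  shows "\<exists>c\<in>D - P. smult c f \<in> polys_over D"
proof -
  have "\<forall>i. \<exists>s\<in>D - P. s * coeff f i \<in> D"
    using f localization_denominator[OF P] by (simp add: mem_polys_over)
  then obtain s where s: "\<And>i. s i \<in> D - P" "\<And>i. s i * coeff f i \<in> D" by metis
  let ?c = "prod s {..degree f}"
  have c: "?c \<in> D - P" by (rule prod_notin_prime[OF P s(1)])
  have "?c * coeff f i \<in> D" for i
  proof (cases "i \<le> degree f")
    case True
    then have "?c = prod s ({..degree f} - {i}) * s i" by (simp add: prod.remove)
    moreover have "prod s ({..degree f} - {i}) \<in> D" using s(1) by (intro prod_closed) auto
    ultimately show ?thesis using s(2)[of i] by (auto simp: mult.assoc)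
  next
    case False
    then show ?thesis by (simp add: coeff_eq_0)
  qed
  then show ?thesis using c by (intro bexI[of _ ?c]) (auto simp: mem_polys_over)
qed

text \<open>Over the local ring D_P a polynomial has unit content as soon as one coefficient is
  outside the maximal ideal. Inverting these polynomials and inverting the complement of P[X]
  therefore agree up to denominators from \<open>D - P\<close>.\<close>

lemma localization_poly_ring_eq_Nagata:
  assumes P: "is_prime D P" and PP: "is_prime (poly_ring D) (poly_ring P)"
  shows "localization (poly_ring D) (poly_ring P) = Nagata_ring (localization D P)"
proof -
  interpret L: polynomial_domain "localization D P"
    by unfold_locales (rule fraction_field_localization[OF P])
  note sub = subset_localization[OF P]
  note sP = is_primeD(1)[OF P]
  have DL: "polys_over D \<subseteq> polys_over (localization D P)" using sub unfolding mem_polys_over subset_iff by blast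
  show ?thesis
  proof
    show "localization (poly_ring D) (poly_ring P) \<subseteq> Nagata_ring (localization D P)"
    proof
      fix x assume "x \<in> localization (poly_ring D) (poly_ring P)"
      then obtain y where y: "y \<in> poly_ring D - poly_ring P" "y * x \<in> poly_ring D"
        using PX.localization_denominator[OF PP] by blast
      then obtain s where s: "s \<in> polys_over D" "y = to_fract s" by (blast elim: poly_ringE)
      then obtain i where i: "coeff s i \<in> D - P" using y(1) by (auto simp: mem_polys_over)
      have "1 / coeff s i * coeff s i \<in> content_ideal (localization D P) s"
        unfolding content_ideal_def
        by (rule L.submodule_scale[OF L.submodule_span inverse_in_localization[OF P i] L.span_superset]) blast
      then have "1 \<in> content_ideal (localization D P) s" using zero_in_prime[OF P i] by simp
      then have "s \<in> L.unit_content_polys" using s(1) DL by (auto simp: L.unit_content_polys_iff)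
      moreover have "to_fract s * x \<in> poly_ring (localization D P)" using y(2) s(2) poly_ring_mono[OF sub] by blast
      ultimately show "x \<in> Nagata_ring (localization D P)" unfolding L.Nagata_ring_iff by blast
    qed
    show "Nagata_ring (localization D P) \<subseteq> localization (poly_ring D) (poly_ring P)"
    proof
      fix x assume "x \<in> Nagata_ring (localization D P)"
      then obtain s f where s: "s \<in> L.unit_content_polys" "to_fract s * x = to_fract f" "f \<in> polys_over (localization D P)"
        unfolding L.Nagata_ring_iff by (blast elim: poly_ringE)
      then have s': "s \<in> polys_over (localization D P)" "1 \<in> content_ideal (localization D P) s"
        by (auto simp: L.unit_content_polys_iff)
      obtain c where c: "c \<in> D - P" "smult c f \<in> polys_over D" using localization_common_denominator[OF P s(3)] by blast
      obtain d where d: "d \<in> D - P" "smult d s \<in> polys_over D" using localization_common_denominator[OF P s'(1)] by blast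
      let ?e = "c * d"
      have e: "?e \<in> D - P" by (rule mult_notin_prime[OF P c(1) d(1)])
      have es: "smult ?e s \<in> polys_over D" "smult ?e f \<in> polys_over D"
        using polys_over_smult[OF submodule_self _ d(2), of c] polys_over_smult[OF submodule_self _ c(2), of d] c d
        by (auto simp: mult.commute)
      \<comment> \<open>Otherwise the content of \<open>s\<close> would lie in the maximal ideal of
        D_P.\<close>
      have "smult ?e s \<notin> polys_over P"
      proof
        assume "smult ?e s \<in> polys_over P"
        then have "coeff s i \<in> loc_hull P P" for i using e unfolding loc_hull_def by (auto simp: mem_polys_over)
        then have "content_ideal (localization D P) s \<subseteq> loc_hull P P"
          unfolding content_ideal_def by (intro L.span_least loc_hull_submodule[OF P sP]) auto
        then have "1 \<in> loc_hull P P" using s'(2) by blast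
        then show False by (auto simp: loc_hull_def)
      qed
      then have "to_fract (smult ?e s) \<in> poly_ring D - poly_ring P" using es by simp
      moreover have "to_fract (smult ?e s) * x = to_fract (smult ?e f)"
        unfolding to_fract_smult s(2)[symmetric] by (simp only: mult_ac)
      then have "to_fract (smult ?e s) * x \<in> poly_ring D" using es(2) by simp
      ultimately show "x \<in> localization (poly_ring D) (poly_ring P)"
        unfolding PX.localization_eq[OF PP] PX.loc_hull_def by blast
    qed
  qed
qed

text \<open>No polynomial of N(v) lies in M[X], so D_M(X), being D[X] localized at M[X], is also a
  localization of Na(D,v).\<close>

lemma Clifford_regular_localized_Nagata_ring:
  assumes reg: "Clifford_regular (Na_v D)" and M: "M \<in> t_Max D"
  shows "Clifford_regular (Nagata_ring (localization D M))"
proof -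
  note MX = PX.t_MaxD(5)[OF t_Max_poly_ring[OF M]]
  let ?L = "localization (poly_ring D) (poly_ring M)"
  have "Clifford_regular ?L"
  proof (rule Clifford_regular_localization[OF Na_v_facts(1) _ _ _ reg])
    show "subdomain ?L"
      using PX.fraction_field_localization[OF MX] by (simp add: domain_with_fraction_field_def)
    show "Na_v D \<subseteq> ?L"
    proof
      fix x assume "x \<in> Na_v D"
      then obtain h where h: "h \<in> v_unit_polys" "to_fract h * x \<in> poly_ring D" unfolding Na_v_iff by blast
      then have "to_fract h \<in> poly_ring D - poly_ring M"
        using v_unit_polys_notin_t_Max[OF _ M] by (auto simp: v_unit_polys_def)
      then show "x \<in> ?L" unfolding PX.localization_eq[OF MX] PX.loc_hull_def using h(2) by blast
    qed
    fix x assume "x \<in> ?L"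
    then obtain s where s: "s \<in> poly_ring D - poly_ring M" "s * x \<in> poly_ring D"
      using PX.localization_denominator[OF MX] by blast
    then show "\<exists>s\<in>Na_v D. s \<noteq> 0 \<and> 1 / s \<in> ?L \<and> s * x \<in> Na_v D"
      using Na_v_facts(2) PX.zero_in_prime[OF MX] PX.inverse_in_localization[OF MX]
      by (intro bexI[of _ s]) auto
  qed
  then show ?thesis unfolding localization_poly_ring_eq_Nagata[OF t_MaxD(5)[OF M] MX] .
qed

end

subsection \<open>Uppers to zero\<close>

context polynomial_domain
begin

text \<open>Primes of \<open>D[X]\<close> contracting to \<open>0\<close>; they are the contractions of the nonzero primes of \<open>K[X]\<close>.\<close>

definition upper_to_zero :: "'k poly fract set \<Rightarrow> bool" where
  "upper_to_zero Q \<longleftrightarrow> is_prime (poly_ring D) Q \<and> Q \<noteq> {0} \<and> (\<forall>c. cst c \<in> Q \<longrightarrow> c = 0)"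

text \<open>The extension of \<open>Q\<close> to K[X], kept inside \<open>'k poly\<close> so that
  division with remainder applies.\<close>

definition extended_upper :: "'k poly fract set \<Rightarrow> 'k poly set" where
  "extended_upper Q = {g. \<exists>d\<in>D. d \<noteq> 0 \<and> to_fract (smult d g) \<in> Q}"

context
  fixes Q assumes Q: "upper_to_zero Q"
begin

lemma upper_prime: "is_prime (poly_ring D) Q"
  using Q by (simp add: upper_to_zero_def)

lemma upper_submodule: "is_submodule (poly_ring D) Q"
  by (rule PX.is_primeD(1)[OF upper_prime])

lemma cst_notin_upper: "c \<in> D \<Longrightarrow> c \<noteq> 0 \<Longrightarrow> cst c \<in> poly_ring D - Q"
  using Q cst_closed by (auto simp: upper_to_zero_def simp del: to_fract_mem_poly_ring)

lemma mem_extended_upper: "g \<in> polys_over D \<Longrightarrow> g \<in> extended_upper Q \<longleftrightarrow> to_fract g \<in> Q"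
proof
  assume g: "g \<in> polys_over D" "g \<in> extended_upper Q"
  then obtain d where d: "d \<in> D" "d \<noteq> 0" "cst d * to_fract g \<in> Q"
    by (auto simp: extended_upper_def to_fract_smult)
  then show "to_fract g \<in> Q"
    using PX.is_primeD(4)[OF upper_prime cst_closed[OF d(1)], of "to_fract g"] cst_notin_upper[OF d(1,2)] g(1) by auto
next
  assume "to_fract g \<in> Q"
  then show "g \<in> extended_upper Q" unfolding extended_upper_def by (auto intro!: bexI[of _ 1])
qed

lemma extended_upper_add:
  assumes "f \<in> extended_upper Q" "g \<in> extended_upper Q"
  shows "f + g \<in> extended_upper Q"
proof -
  obtain d e where d: "d \<in> D" "d \<noteq> 0" "to_fract (smult d f) \<in> Q" and e: "e \<in> D" "e \<noteq> 0" "to_fract (smult e g) \<in> Q"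
    using assms by (auto simp: extended_upper_def)
  have "cst e * to_fract (smult d f) + cst d * to_fract (smult e g) \<in> Q"
    by (rule PX.submodule_add[OF upper_submodule PX.submodule_scale[OF upper_submodule cst_closed[OF e(1)] d(3)]
      PX.submodule_scale[OF upper_submodule cst_closed[OF d(1)] e(3)]])
  then have "to_fract (smult (d * e) (f + g)) \<in> Q"
    by (simp add: smult_add_right mult.commute flip: to_fract_mult to_fract_add)
  then show ?thesis unfolding extended_upper_def using d e by (intro CollectI bexI[of _ "d * e"]) auto
qed

lemma extended_upper_mult:
  assumes "f \<in> extended_upper Q"
  shows "h * f \<in> extended_upper Q"
proof -
  obtain d where d: "d \<in> D" "d \<noteq> 0" "to_fract (smult d f) \<in> Q" using assms by (auto simp: extended_upper_def)
  obtain e where e: "e \<in> D" "e \<noteq> 0" "smult e h \<in> polys_over D" using common_denominator[OF dom] by blast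
  have "to_fract (smult e h) * to_fract (smult d f) \<in> Q"
    by (rule PX.submodule_scale[OF upper_submodule _ d(3)]) (simp add: e(3))
  then have "to_fract (smult (d * e) (h * f)) \<in> Q" by (simp add: mult.commute flip: to_fract_mult)
  then show ?thesis unfolding extended_upper_def using d e by (intro CollectI bexI[of _ "d * e"]) auto
qed

lemma extended_upper_prime:
  assumes "f * g \<in> extended_upper Q"
  shows "f \<in> extended_upper Q \<or> g \<in> extended_upper Q"
proof -
  obtain d where d: "d \<in> D" "d \<noteq> 0" "smult d f \<in> polys_over D" using common_denominator[OF dom] by blast
  obtain e where e: "e \<in> D" "e \<noteq> 0" "smult e g \<in> polys_over D" using common_denominator[OF dom] by blast
  have "[:d * e:] * (f * g) \<in> extended_upper Q" by (rule extended_upper_mult[OF assms])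
  then have "smult d f * smult e g \<in> extended_upper Q" by (simp add: mult.commute)
  then have "to_fract (smult d f) * to_fract (smult e g) \<in> Q"
    using mem_extended_upper[OF polys_over_mult[OF submodule_self d(3) e(3)]] by (simp flip: to_fract_mult)
  then have "to_fract (smult d f) \<in> Q \<or> to_fract (smult e g) \<in> Q"
    using d e by (intro PX.is_primeD(4)[OF upper_prime]) auto
  then show ?thesis unfolding extended_upper_def using d e by blast
qed

lemma const_extended_upper: "[:c:] \<in> extended_upper Q \<Longrightarrow> c = 0"
proof -
  assume "[:c:] \<in> extended_upper Q"
  then obtain d where "d \<noteq> 0" "cst (d * c) \<in> Q" by (auto simp: extended_upper_def)
  then show "c = 0" using Q by (auto simp: upper_to_zero_def)
qed

text \<open>An element of least degree generates, by division with remainder; it is not constant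
  because \<open>Q\<close> contains no nonzero constant.\<close>

lemma extended_upper_generator:
  "\<exists>p. degree p > 0 \<and> (\<forall>g. g \<in> extended_upper Q \<longleftrightarrow> p dvd g)"
proof -
  have "\<exists>x\<in>Q. x \<noteq> 0" using Q PX.submodule_zero[OF upper_submodule] by (auto simp: upper_to_zero_def)
  then obtain f where f: "to_fract f \<in> Q" "f \<noteq> 0"
    using PX.is_primeD(2)[OF upper_prime] by (auto simp: poly_ring_def)
  then have "f \<in> extended_upper Q \<and> f \<noteq> 0" unfolding extended_upper_def by (auto intro!: bexI[of _ 1])
  then obtain p where p: "p \<in> extended_upper Q" "p \<noteq> 0"
    and min: "\<And>g. g \<in> extended_upper Q \<Longrightarrow> g \<noteq> 0 \<Longrightarrow> degree p \<le> degree g"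
    using ex_has_least_nat[of "\<lambda>f. f \<in> extended_upper Q \<and> f \<noteq> 0" f degree] by blast
  have "degree p > 0"
  proof (rule ccontr)
    assume "\<not> degree p > 0"
    then obtain c where "p = [:c:]" using degree_eq_zeroE by blast
    then show False using p const_extended_upper by auto
  qed
  moreover have "g \<in> extended_upper Q \<longleftrightarrow> p dvd g" for g
  proof
    assume g: "g \<in> extended_upper Q"
    have "g + (- (g div p)) * p \<in> extended_upper Q" by (intro extended_upper_add g extended_upper_mult p)
    moreover have "g + (- (g div p)) * p = g mod p" by (simp add: minus_div_mult_eq_mod[symmetric])
    ultimately have "g mod p \<in> extended_upper Q" by simp
    then have "g mod p = 0" using min[of "g mod p"] degree_mod_less[OF p(2), of g] by fastforce
    then show "p dvd g" by (simp add: dvd_eq_mod_eq_0)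
  next
    assume "p dvd g"
    then obtain h where "g = p * h" by (rule dvdE)
    then show "g \<in> extended_upper Q" using extended_upper_mult[OF p(1), of h] by (simp add: mult.commute)
  qed
  ultimately show ?thesis by blast
qed

lemma upper_eq: "Q = to_fract ` (extended_upper Q \<inter> polys_over D)"
  using mem_extended_upper PX.is_primeD(2)[OF upper_prime] by (auto simp: poly_ring_def)

end

text \<open>The uppers over \<open>f\<close> belong to the irreducible factors of \<open>f\<close>
  in K[X]. Splitting off the generator \<open>p\<close> of one of them leaves a cofactor
  \<open>h\<close> of smaller degree, and an upper whose extension contains \<open>p\<close> equals
  the first one.\<close>

lemma finite_uppers:
  assumes "f \<noteq> 0"
  shows "finite {Q. upper_to_zero Q \<and> f \<in> extended_upper Q}" (is "finite (?U f)")
  using assms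
proof (induction "degree f" arbitrary: f rule: less_induct)
  case less
  show ?case
  proof (cases "?U f = {}")
    case True
    then show ?thesis by (simp only: finite.emptyI)
  next
    case False
    then obtain Q0 where Q0: "upper_to_zero Q0" "f \<in> extended_upper Q0" by blast
    obtain p where p: "degree p > 0" "\<And>g. g \<in> extended_upper Q0 \<longleftrightarrow> p dvd g"
      using extended_upper_generator[OF Q0(1)] by blast
    obtain h where h: "f = p * h" using Q0(2) p(2) by (auto elim: dvdE)
    then have "h \<noteq> 0" "degree h < degree f" using less.prems p(1) by (auto simp: degree_mult_eq)
    then have "finite (?U h)" by (intro less.hyps)
    moreover have "?U f \<subseteq> insert Q0 (?U h)"
    proof
      fix Q assume "Q \<in> ?U f"
      then have Q: "upper_to_zero Q" "f \<in> extended_upper Q" by auto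
      show "Q \<in> insert Q0 (?U h)"
      proof (cases "h \<in> extended_upper Q")
        case False
        then have pQ: "p \<in> extended_upper Q" using extended_upper_prime[OF Q(1)] Q(2) h by blast
        obtain q where q: "degree q > 0" "\<And>g. g \<in> extended_upper Q \<longleftrightarrow> q dvd g"
          using extended_upper_generator[OF Q(1)] by blast
        obtain r where r: "p = q * r" using pQ q(2) by (auto elim: dvdE)
        \<comment> \<open>\<open>p\<close> generates a prime ideal: from \<open>p = q * r\<close>,
          not dividing \<open>q\<close> would mean dividing \<open>r\<close>, whose degree is too
          small.\<close>
        have "p dvd q"
        proof (rule ccontr)
          assume "\<not> p dvd q"
          moreover have "q * r \<in> extended_upper Q0" using p(2) r by simp
          ultimately have "p dvd r" using extended_upper_prime[OF Q0(1)] p(2) by blast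
          moreover have "q \<noteq> 0" "r \<noteq> 0" using r p(1) by auto
          then have "degree p = degree q + degree r" unfolding r by (rule degree_mult_eq)
          then have "degree r < degree p" using q(1) by simp
          ultimately show False using dvd_imp_degree_le[of p r] \<open>r \<noteq> 0\<close> by simp
        qed
        moreover have "q dvd p" using r by simp
        ultimately have "extended_upper Q = extended_upper Q0"
          using q(2) p(2) dvd_trans by blast
        then have "Q = Q0" using upper_eq[OF Q(1)] upper_eq[OF Q0(1)] by simp
        then show ?thesis by simp
      qed (use Q in simp)
    qed
    ultimately show ?thesis by (meson finite.insertI finite_subset)
  qed
qed

lemma t_Max_poly_ring_cases:
  assumes Q: "Q \<in> t_Max (poly_ring D)"
  obtains (extended) M where "M \<in> t_Max D" "Q = poly_ring M" | (upper) "upper_to_zero Q"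
proof (cases "upper_to_zero Q")
  case False
  have "Q \<noteq> {0}" using PX.t_ideal_nz[OF PX.t_MaxD(1)[OF Q]] by (simp add: nz_ideals_def)
  then obtain c where "cst c \<in> Q" "c \<noteq> 0" using False PX.t_MaxD(5)[OF Q] by (auto simp: upper_to_zero_def)
  then show thesis using t_Max_poly_ring_nonzero_contraction[OF Q] extended by blast
qed (rule upper)

lemma t_finite_character_poly_ring:
  assumes tfc: "t_finite_character D"
  shows "t_finite_character (poly_ring D)"
  unfolding t_finite_character_def
proof (intro ballI impI)
  fix x assume "x \<in> poly_ring D" "x \<noteq> 0"
  then obtain f where f: "f \<in> polys_over D" "x = to_fract f" "f \<noteq> 0" by (auto elim!: poly_ringE)
  \<comment> \<open>A nonzero constant that detects the extended ideals: M[X] contains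
    \<open>f\<close> only if \<open>M\<close> contains \<open>c\<close>.\<close>
  define c where "c = lead_coeff f"
  have c: "c \<in> D" "c \<noteq> 0" using f by (auto simp: c_def mem_polys_over)
  have "{Q \<in> t_Max (poly_ring D). x \<in> Q} \<subseteq>
    poly_ring ` {M \<in> t_Max D. c \<in> M} \<union> {Q. upper_to_zero Q \<and> f \<in> extended_upper Q}"
  proof
    fix Q assume "Q \<in> {Q \<in> t_Max (poly_ring D). x \<in> Q}"
    then have Q: "Q \<in> t_Max (poly_ring D)" "x \<in> Q" by auto
    from Q(1) show "Q \<in> poly_ring ` {M \<in> t_Max D. c \<in> M} \<union> {Q. upper_to_zero Q \<and> f \<in> extended_upper Q}"
    proof (cases rule: t_Max_poly_ring_cases)
      case (extended M)
      then have "f \<in> polys_over M" using Q(2) f(2) by simp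
      then have "c \<in> M" by (simp add: c_def mem_polys_over)
      then show ?thesis using extended by blast
    next
      case upper
      then show ?thesis using Q(2) f mem_extended_upper by simp
    qed
  qed
  moreover have "finite {M \<in> t_Max D. c \<in> M}" using tfc c by (simp add: t_finite_character_def)
  ultimately show "finite {Q \<in> t_Max (poly_ring D). x \<in> Q}"
    using finite_uppers[OF f(3)] by (meson finite_UnI finite_imageI finite_subset)
qed

lemma t_finite_character_if_poly_ring:
  assumes tfc: "t_finite_character (poly_ring D)"
  shows "t_finite_character D"
  unfolding t_finite_character_def
proof (intro ballI impI)
  fix c assume c: "c \<in> D" "c \<noteq> 0"
  have sM: "is_submodule D M" if "M \<in> t_Max D" for M by (rule is_primeD(1)[OF t_MaxD(5)[OF that]])
  have "finite {Q \<in> t_Max (poly_ring D). cst c \<in> Q}"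
    using tfc cst_closed[OF c(1)] c(2) unfolding t_finite_character_def by auto
  moreover have "poly_ring ` {M \<in> t_Max D. c \<in> M} \<subseteq> {Q \<in> t_Max (poly_ring D). cst c \<in> Q}"
  proof safe
    fix M assume M: "M \<in> t_Max D" "c \<in> M"
    show "poly_ring M \<in> t_Max (poly_ring D)" by (rule t_Max_poly_ring[OF M(1)])
    show "cst c \<in> poly_ring M" using M cst_mem_poly_ring submodule_zero[OF sM[OF M(1)]] by blast
  qed
  ultimately have "finite (poly_ring ` {M \<in> t_Max D. c \<in> M})" by (rule rev_finite_subset)
  moreover have "inj_on poly_ring {M \<in> t_Max D. c \<in> M}"
  proof (rule inj_onI)
    fix M N assume "M \<in> {M \<in> t_Max D. c \<in> M}" "N \<in> {M \<in> t_Max D. c \<in> M}" "poly_ring M = poly_ring N"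
    then show "M = N"
      using poly_ring_subset_iff[OF sM[of M] sM[of N]] poly_ring_subset_iff[OF sM[of N] sM[of M]] by auto
  qed
  ultimately show "finite {M \<in> t_Max D. c \<in> M}" by (rule finite_imageD)
qed

end

subsection \<open>Valuation rings\<close>

definition valuation_ring :: "'k::field set \<Rightarrow> bool" where
  "valuation_ring V \<longleftrightarrow> (\<forall>x. x \<noteq> 0 \<longrightarrow> x \<in> V \<or> 1 / x \<in> V)"

context subdom
begin

lemma valuation_ring_min:
  assumes V: "valuation_ring R" and C: "finite C" "C \<noteq> {}" "0 \<notin> C"
  shows "\<exists>c\<in>C. \<forall>e\<in>C. e / c \<in> R"
  using C
proof (induction C rule: finite_ne_induct)
  case (singleton x)
  then show ?case by simp
next
  case (insert x C)
  then obtain c where c: "c \<in> C" "\<And>e. e \<in> C \<Longrightarrow> e / c \<in> R" by auto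
  have nz: "c \<noteq> 0" "x \<noteq> 0" using c(1) insert.prems by auto
  show ?case
  proof (cases "x / c \<in> R")
    case True
    then show ?thesis using c by (intro bexI[of _ c]) auto
  next
    case False
    then have cx: "c / x \<in> R"
      using V nz unfolding valuation_ring_def by (auto dest!: spec[of _ "x / c"])
    have "e / x \<in> R" if "e \<in> C" for e
      using mult_closed[OF c(2)[OF that] cx] nz by simp
    then show ?thesis using nz by (intro bexI[of _ x]) auto
  qed
qed

text \<open>For \<open>I = (1, u)\<close> and \<open>I = I\<^sup>2J\<close>, integral closedness gives \<open>IJ \<subseteq> (I : I) = R\<close>; Nakayama's lemma gives
  \<open>IJ = R\<close>, so that \<open>I\<close> is principal.\<close>

lemma valuation_ring_if_Clifford_regular:
  assumes frac: "domain_with_fraction_field R" and reg: "Clifford_regular R"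
    and N: "is_submodule R N" "1 \<notin> N" and unit: "\<And>e. e \<in> R \<Longrightarrow> e \<notin> N \<Longrightarrow> 1 / e \<in> R"
    and closed: "\<And>e b c. b \<in> R \<Longrightarrow> c \<in> R \<Longrightarrow> e * e + b * e + c = 0 \<Longrightarrow> e \<in> R"
  shows "valuation_ring R"
  unfolding valuation_ring_def
proof (intro allI impI)
  fix u :: 'k assume u: "u \<noteq> 0"
  define I where "I = {x. \<exists>p\<in>{r * 1 |r. r \<in> R}. \<exists>q\<in>{r * u |r. r \<in> R}. x = p + q}"
  have sI: "is_submodule R I" unfolding I_def by (intro submodule_plus submodule_principal)
  have I_iff: "x \<in> I \<longleftrightarrow> (\<exists>p\<in>R. \<exists>q\<in>R. x = p + q * u)" for x unfolding I_def by auto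
  have 1: "1 \<in> I" unfolding I_iff by (rule bexI[of _ 1], rule bexI[of _ 0]) auto
  have uI: "u \<in> I" unfolding I_iff by (rule bexI[of _ 0], rule bexI[of _ 1]) auto
  obtain a b where ab: "a \<in> R" "b \<in> R" "b \<noteq> 0" "u = a / b"
    using frac unfolding domain_with_fraction_field_def by blast
  have "I \<in> nz_ideals R"
  proof (rule nz_idealsI[OF sI 1 _ ab(2,3)])
    fix y assume "y \<in> I"
    then obtain p q where "p \<in> R" "q \<in> R" "y = p + q * u" unfolding I_iff by blast
    then have "b * y = b * p + q * a" "p \<in> R" "q \<in> R" using ab by (auto simp: algebra_simps)
    then show "b * y \<in> R" using ab by (simp add: add_closed mult_closed)
  qed simp
  then have "vN_regular R I" using reg by (simp add: Clifford_regular_def)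
  then obtain J where "J \<in> nz_ideals R" and J: "I = ideal_mult R (ideal_mult R I I) J"
    "\<And>x y z. x \<in> I \<Longrightarrow> y \<in> I \<Longrightarrow> z \<in> J \<Longrightarrow> x * y * z \<in> I"
    using vN_regularD by blast
  define E where "E = ideal_mult R I J"
  have sE: "is_submodule R E" by (simp add: E_def submodule_ideal_mult)
  have EI: "e * x \<in> I" if "e \<in> E" "x \<in> I" for e x
    using ideal_mult_absorb[OF sI J(2)] that unfolding E_def by blast
  have ER: "e \<in> R" if e: "e \<in> E" for e
  proof -
    obtain p q where pq: "p \<in> R" "q \<in> R" "e = p + q * u" using EI[OF e 1] I_iff[of e] by auto
    obtain r s where rs: "r \<in> R" "s \<in> R" "e * u = r + s * u" using EI[OF e uI] I_iff[of "e * u"] by auto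
    \<comment> \<open>The characteristic polynomial of multiplication by \<open>e\<close> on
      \<open>I\<close> in the generators 1 and \<open>u\<close>; it makes \<open>e\<close> integral
      over \<open>R\<close>.\<close>
    have "(e - p) * (e - s) = q * (e * u - s * u)" using pq(3) by (simp add: algebra_simps)
    also have "\<dots> = q * r" using rs(3) by simp
    finally have eq: "e * e + (- (p + s)) * e + (p * s - q * r) = 0" by (simp add: algebra_simps)
    have "- (p + s) \<in> R" "p * s - q * r \<in> R"
      by (intro uminus_closed add_closed diff_closed mult_closed pq rs)+
    then show ?thesis using eq by (rule closed)
  qed
  have lin: "\<exists>d\<in>E. \<exists>e\<in>E. x = d + e * u" if x: "x \<in> I" for x
  proof -
    let ?Z = "{x. \<exists>d\<in>E. \<exists>e\<in>{y. \<exists>e\<in>E. y = e * u}. x = d + e}"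
    have "is_submodule R {y. \<exists>e\<in>E. y = e * u}"
      unfolding is_submodule_def
    proof safe
      show "\<exists>e\<in>E. 0 = e * u" using submodule_zero[OF sE] by (intro bexI[of _ 0]) auto
      show "\<exists>e\<in>E. d * u + d' * u = e * u" if "d \<in> E" "d' \<in> E" for d d'
        using submodule_add[OF sE that] by (intro bexI[of _ "d + d'"]) (auto simp: distrib_right)
      show "\<exists>e\<in>E. r * (d * u) = e * u" if "r \<in> R" "d \<in> E" for r d
        using submodule_scale[OF sE that] by (intro bexI[of _ "r * d"]) (auto simp: mult.assoc)
    qed
    then have "is_submodule R ?Z" by (rule submodule_plus[OF sE])
    then have "ideal_mult R (ideal_mult R I I) J \<subseteq> ?Z"
    proof (rule ideal_mult3_least)
      fix x y z assume *: "x \<in> I" "y \<in> I" "z \<in> J"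
      obtain p q where pq: "p \<in> R" "q \<in> R" "x = p + q * u" using *(1) I_iff by auto
      have "y * z \<in> E" unfolding E_def by (rule ideal_multI[OF *(2,3)])
      then have "p * (y * z) \<in> E" "q * (y * z) \<in> E" using pq submodule_scale[OF sE] by blast+
      moreover have "x * y * z = p * (y * z) + q * (y * z) * u" using pq(3) by (simp add: algebra_simps)
      ultimately show "x * y * z \<in> ?Z" by blast
    qed
    then have "x \<in> ?Z" using x J(1) by blast
    then show ?thesis by blast
  qed
  have "\<not> E \<subseteq> N"
  proof
    assume EN: "E \<subseteq> N"
    obtain e1 e2 where e12: "e1 \<in> E" "e2 \<in> E" "1 = e1 + e2 * u" using lin[OF 1] by blast
    obtain e3 e4 where e34: "e3 \<in> E" "e4 \<in> E" "u = e3 + e4 * u" using lin[OF uI] by blast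
    have "e2 * u = 1 - e1" "e3 = (1 - e4) * u" using e12(3) e34(3) by (simp_all add: algebra_simps)
    \<comment> \<open>The vanishing determinant of the two equations for 1 and \<open>u\<close>;
      expanded, it writes 1 in terms of the coefficients from \<open>E\<close>.\<close>
    then have "e2 * e3 = (1 - e1) * (1 - e4)" by (metis mult.assoc mult.commute)
    then have "1 = e1 + e4 - e1 * e4 + e2 * e3" by (simp add: algebra_simps)
    also have "\<dots> \<in> N"
      using EN e12 e34 ER
      by (intro submodule_add[OF N(1)] submodule_diff[OF N(1)] submodule_scale[OF N(1)]) auto
    finally show False using N(2) by simp
  qed
  \<comment> \<open>As \<open>i * j\<close> is a unit, each \<open>x\<close> in \<open>I\<close> is
    \<open>x * j / (i * j)\<close> times \<open>i\<close>, so \<open>i\<close> generates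
    \<open>I\<close>.\<close>
  then obtain i j where ij: "i \<in> I" "j \<in> J" "i * j \<notin> N"
    using ideal_mult_least[OF N(1), of I J] unfolding E_def by blast
  have JE: "x * j \<in> R" if "x \<in> I" for x using ER ideal_multI[OF that ij(2)] unfolding E_def by blast
  have inv: "1 / (i * j) \<in> R" by (rule unit[OF JE[OF ij(1)] ij(3)])
  have nz: "i \<noteq> 0" "j \<noteq> 0" using ij(3) submodule_zero[OF N(1)] by auto
  have div: "x / i \<in> R" if "x \<in> I" for x
  proof -
    have "(x * j) * (1 / (i * j)) \<in> R" by (rule mult_closed[OF JE[OF that] inv])
    then show ?thesis using nz by simp
  qed
  obtain p q where pq: "p \<in> R" "q \<in> R" "i = p + q * u" using ij(1) I_iff by auto
  \<comment> \<open>One of \<open>1 / i\<close> and \<open>u / i\<close> must be a unit; dividing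
    the other by it gives \<open>u\<close> or \<open>1 / u\<close>.\<close>
  have "1 = p * (1 / i) + q * (u / i)" using pq(3) nz by (simp add: add_divide_distrib[symmetric])
  moreover have "p * (1 / i) + q * (u / i) \<in> N" if "1 / i \<in> N" "u / i \<in> N"
    by (intro submodule_add[OF N(1)] submodule_scale[OF N(1)] pq that)
  ultimately have "1 / i \<notin> N \<or> u / i \<notin> N" using N(2) by metis
  then show "u \<in> R \<or> 1 / u \<in> R"
  proof
    assume "1 / i \<notin> N"
    then have "1 / (1 / i) \<in> R" by (rule unit[OF div[OF 1]])
    then have "(u / i) * (1 / (1 / i)) \<in> R" by (rule mult_closed[OF div[OF uI]])
    then show ?thesis using nz by simp
  next
    assume "u / i \<notin> N"
    then have "1 / (u / i) \<in> R" by (rule unit[OF div[OF uI]])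
    then have "(1 / i) * (1 / (u / i)) \<in> R" by (rule mult_closed[OF div[OF 1]])
    then show ?thesis using nz by simp
  qed
qed

end

lemma (in fraction_domain) valuation_ring_localization_if_Clifford_regular:
  assumes ic: "integrally_closed R" and P: "is_prime R P" and reg: "Clifford_regular (localization R P)"
  shows "valuation_ring (localization R P)"
proof -
  interpret L: fraction_domain "localization R P" by unfold_locales (rule fraction_field_localization[OF P])
  note sP = is_primeD(1)[OF P]
  show ?thesis
  proof (rule L.valuation_ring_if_Clifford_regular[OF L.dom reg])
    show "is_submodule (localization R P) (loc_hull P P)" by (rule loc_hull_submodule[OF P sP])
    show "1 \<notin> loc_hull P P" by (auto simp: loc_hull_def)
    show "1 / e \<in> localization R P" if e: "e \<in> localization R P" "e \<notin> loc_hull P P" for e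
    proof -
      obtain s where s: "s \<in> R - P" "s * e \<in> R" using localization_denominator[OF P e(1)] by blast
      then have "s * e \<in> R - P" using e(2) unfolding loc_hull_def by blast
      then have "s * (1 / (s * e)) \<in> localization R P"
        using s(1) subset_localization[OF P] inverse_in_localization[OF P] by (intro L.mult_closed) auto
      then show ?thesis using zero_in_prime[OF P s(1)] by simp
    qed
    show "e \<in> localization R P"
      if bc: "b \<in> localization R P" "c \<in> localization R P" and eq: "e * e + b * e + c = 0" for e b c
    proof -
      obtain s where s: "s \<in> R - P" "s * b \<in> R" using localization_denominator[OF P bc(1)] by blast
      obtain t where t: "t \<in> R - P" "t * c \<in> R" using localization_denominator[OF P bc(2)] by blast
      \<comment> \<open>Chosen so that \<open>r * e\<close> is a root of X^2 + (r b) X + r^2 c,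
        whose coefficients are in \<open>R\<close>.\<close>
      define r where "r = s * t"
      have r: "r \<in> R - P" unfolding r_def by (rule mult_notin_prime[OF P s(1) t(1)])
      have "t * (s * b) \<in> R" "(s * r) * (t * c) \<in> R" using s t r by (auto intro: mult_closed)
      then have co: "r * b \<in> R" "r * r * c \<in> R" by (simp_all add: r_def mult_ac)
      have "poly [:r * r * c, r * b, 1:] (r * e) = r * r * (e * e + b * e + c)"
        by (simp add: algebra_simps)
      then have "poly [:r * r * c, r * b, 1:] (r * e) = 0" by (simp only: eq mult_zero_right)
      moreover have "\<forall>i. coeff [:r * r * c, r * b, 1:] i \<in> R"
        using co by (auto simp: coeff_pCons split: nat.split)
      moreover have "lead_coeff [:r * r * c, r * b, 1:] = 1" by simp
      ultimately have "r * e \<in> R" using ic unfolding integrally_closed_def by blast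
      then show ?thesis unfolding localization_eq[OF P] loc_hull_def using r by blast
    qed
  qed
qed

context polynomial_domain
begin

text \<open>Dividing numerator and denominator by a coefficient of least value among all their
  coefficients makes both integral and gives one of them the coefficient 1, hence unit content; that
  one may be inverted.\<close>

lemma valuation_ring_Nagata_ring:
  assumes V: "valuation_ring D"
  shows "valuation_ring (Nagata_ring D)"
  unfolding valuation_ring_def
proof (intro allI impI)
  fix x :: "'k poly fract" assume x: "x \<noteq> 0"
  obtain y z where "y \<in> poly_ring D" "z \<in> poly_ring D" "z \<noteq> 0" "x = y / z" using PX.ex_fraction by blast
  then obtain f g where fg: "x = to_fract f / to_fract g" "g \<noteq> 0" by (auto elim!: poly_ringE)
  then have f: "f \<noteq> 0" using x by auto
  let ?C = "(range (coeff f) \<union> range (coeff g)) - {0}"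
  have "lead_coeff f \<in> ?C" using f by simp
  then have "?C \<noteq> {}" by blast
  moreover have "finite ?C" by (simp add: finite_range_coeff)
  ultimately have "\<exists>c\<in>?C. \<forall>e\<in>?C. e / c \<in> D" by (intro valuation_ring_min[OF V]) auto
  then obtain c where c: "c \<in> ?C" "\<And>e. e \<in> ?C \<Longrightarrow> e / c \<in> D" by blast
  let ?f = "smult (1 / c) f" and ?g = "smult (1 / c) g"
  have "coeff f i / c \<in> D" for i by (cases "coeff f i = 0") (use c(2) in auto)
  then have fD: "?f \<in> polys_over D" by (simp add: mem_polys_over)
  have "coeff g i / c \<in> D" for i by (cases "coeff g i = 0") (use c(2) in auto)
  then have gD: "?g \<in> polys_over D" by (simp add: mem_polys_over)
  have unit: "smult (1 / c) h \<in> unit_content_polys"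
    if h: "smult (1 / c) h \<in> polys_over D" "c \<in> range (coeff h)" for h
  proof -
    obtain i where "c = coeff h i" using h(2) by blast
    then have "coeff (smult (1 / c) h) i = 1" using c(1) by simp
    then have "1 \<in> content_ideal D (smult (1 / c) h)"
      unfolding content_ideal_def by (metis rangeI span_superset)
    then show ?thesis using h(1) by (simp add: unit_content_polys_iff)
  qed
  have "c \<in> range (coeff f) \<or> c \<in> range (coeff g)" using c(1) by blast
  then show "x \<in> Nagata_ring D \<or> 1 / x \<in> Nagata_ring D"
  proof
    assume "c \<in> range (coeff g)"
    then have "?g \<in> unit_content_polys" by (rule unit[OF gD])
    moreover have "to_fract ?g * x = to_fract ?f" unfolding to_fract_smult using fg by simp
    then have "to_fract ?g * x \<in> poly_ring D" using fD by simp
    ultimately show ?thesis unfolding Nagata_ring_iff by blast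
  next
    assume "c \<in> range (coeff f)"
    then have "?f \<in> unit_content_polys" by (rule unit[OF fD])
    moreover have "to_fract ?f * (1 / x) = to_fract ?g" unfolding to_fract_smult using fg f by simp
    then have "to_fract ?f * (1 / x) \<in> poly_ring D" using gD by simp
    ultimately show ?thesis unfolding Nagata_ring_iff by blast
  qed
qed

end

text \<open>The range is K[X], where an element of least degree, after clearing the denominator
  \<open>d\<close>, generates the ideal. The localizations at uppers to zero inherit regularity from
  it.\<close>

lemma Clifford_regular_range_to_fract: "Clifford_regular (range (to_fract :: 'k::field poly \<Rightarrow> _))"
  unfolding Clifford_regular_def
proof
  let ?K = "range (to_fract :: 'k poly \<Rightarrow> _)"
  interpret K: fraction_domain ?K by unfold_locales (rule domain_with_fraction_field_range_to_fract)
  fix I assume I: "I \<in> nz_ideals ?K"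
  note sI = K.nz_ideals_submodule[OF I]
  obtain d where d: "d \<in> ?K" "d \<noteq> 0" "\<forall>x\<in>I. d * x \<in> ?K" using K.nz_ideals_denominator[OF I] by blast
  obtain x where x: "x \<in> I" "x \<noteq> 0" using K.nz_ideals_nonzero[OF I] by blast
  then obtain f0 where "d * x = to_fract f0" using d by blast
  then have "f0 \<noteq> 0 \<and> (\<exists>y\<in>I. d * y = to_fract f0)" using x d by auto
  then obtain f m where f: "f \<noteq> 0" "m \<in> I" "d * m = to_fract f"
    and min: "\<And>g y. g \<noteq> 0 \<Longrightarrow> y \<in> I \<Longrightarrow> d * y = to_fract g \<Longrightarrow> degree f \<le> degree g"
    using ex_has_least_nat[of "\<lambda>f. f \<noteq> 0 \<and> (\<exists>y\<in>I. d * y = to_fract f)" f0 degree] by blast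
  have m: "m \<noteq> 0" using f by auto
  have "I = {r * m |r. r \<in> ?K}"
  proof (intro equalityI subsetI)
    fix y assume y: "y \<in> I"
    then obtain g where g: "d * y = to_fract g" using d by blast
    have "y - to_fract (g div f) * m \<in> I"
      by (intro K.submodule_diff[OF sI] y K.submodule_scale[OF sI] f rangeI)
    moreover have "d * (y - to_fract (g div f) * m) = to_fract (g mod f)"
    proof -
      have "d * (y - to_fract (g div f) * m) = d * y - to_fract (g div f) * (d * m)" by (simp add: algebra_simps)
      also have "\<dots> = to_fract (g - g div f * f)" unfolding g f(3) by simp
      finally show ?thesis by (simp add: minus_div_mult_eq_mod)
    qed
    ultimately have "g mod f = 0" using min[of "g mod f"] degree_mod_less[OF f(1), of g] by fastforce
    then have "g = g div f * f" by (metis add_0_right div_mult_mod_eq)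
    then have "d * y = to_fract (g div f) * (d * m)" unfolding f(3) g by (metis to_fract_mult)
    then have "y = to_fract (g div f) * m" using d(2) by simp
    then show "y \<in> {r * m |r. r \<in> ?K}" by blast
  qed (use K.submodule_scale[OF sI] f in blast)
  then show "vN_regular ?K I" by (rule K.vN_regular_principal[OF m _ I])
qed

context polynomial_domain
begin

context
  fixes Q assumes Q: "upper_to_zero Q"
begin

text \<open>Nonzero constants are units in this localization, so numerator and denominator may be
  taken over the field: the ring is K[X] localized at the extension of \<open>Q\<close>.\<close>

lemma upper_localizationI:
  assumes "s \<notin> extended_upper Q"
  shows "to_fract f / to_fract s \<in> localization (poly_ring D) Q"
proof -
  obtain d where d: "d \<in> D" "d \<noteq> 0" "smult d f \<in> polys_over D" using common_denominator[OF dom] by blast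
  obtain e where e: "e \<in> D" "e \<noteq> 0" "smult e s \<in> polys_over D" using common_denominator[OF dom] by blast
  have de: "smult (d * e) f \<in> polys_over D" "smult (d * e) s \<in> polys_over D"
    using polys_over_smult[OF submodule_self e(1) d(3)] polys_over_smult[OF submodule_self d(1) e(3)]
    by (simp_all add: mult.commute)
  have "to_fract (smult (d * e) s) \<notin> Q"
    using assms mult_closed[OF d(1) e(1)] d(2) e(2) unfolding extended_upper_def by auto
  then have "to_fract (smult (d * e) f) \<in> poly_ring D" "to_fract (smult (d * e) s) \<in> poly_ring D - Q"
    using de by simp_all
  then have "to_fract (smult (d * e) f) / to_fract (smult (d * e) s) \<in> localization (poly_ring D) Q"
    unfolding localization_def fractions_def by blast
  moreover have "to_fract (smult (d * e) f) / to_fract (smult (d * e) s) = to_fract f / to_fract s"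
    unfolding to_fract_smult using d e by simp
  ultimately show ?thesis by simp
qed

lemma Clifford_regular_localization_upper: "Clifford_regular (localization (poly_ring D) Q)"
proof (rule Clifford_regular_localization[OF _ _ _ _ Clifford_regular_range_to_fract])
  note QP = upper_prime[OF Q]
  show "subdomain (range (to_fract :: 'k poly \<Rightarrow> _))"
    using domain_with_fraction_field_range_to_fract unfolding domain_with_fraction_field_def by blast
  show "subdomain (localization (poly_ring D) Q)"
    using PX.fraction_field_localization[OF QP] by (simp add: domain_with_fraction_field_def)
  have "1 \<notin> extended_upper Q" using const_extended_upper[OF Q, of 1] by (auto simp: one_pCons)
  from upper_localizationI[OF this] show "range to_fract \<subseteq> localization (poly_ring D) Q" by auto
  fix x assume "x \<in> localization (poly_ring D) Q"
  then obtain s where s: "s \<in> poly_ring D - Q" "s * x \<in> poly_ring D"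
    using PX.localization_denominator[OF QP] by blast
  then show "\<exists>s\<in>range to_fract. s \<noteq> 0 \<and> 1 / s \<in> localization (poly_ring D) Q \<and> s * x \<in> range to_fract"
    using PX.zero_in_prime[OF QP] PX.inverse_in_localization[OF QP]
    by (intro bexI[of _ s]) (auto simp: poly_ring_def)
qed

text \<open>Cancelling the generator \<open>p\<close> lowers the degree of the denominator, so
  eventually \<open>p\<close> fails to divide one of numerator and denominator; that one can serve
  as a denominator in the localization.\<close>

lemma valuation_ring_localization_upper: "valuation_ring (localization (poly_ring D) Q)"
  unfolding valuation_ring_def
proof (intro allI impI)
  fix x :: "'k poly fract" assume x: "x \<noteq> 0"
  obtain p where p: "degree p > 0" "\<And>g. g \<in> extended_upper Q \<longleftrightarrow> p dvd g"
    using extended_upper_generator[OF Q] by blast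
  obtain f0 g0 where "g0 \<noteq> 0" "x = to_fract f0 / to_fract g0"
    by (cases x) (auto simp: Fract_conv_to_fract)
  then have "\<exists>f g. g \<noteq> 0 \<and> x = to_fract f / to_fract g \<and> \<not> (p dvd f \<and> p dvd g)"
  proof (induction "degree g0" arbitrary: f0 g0 rule: less_induct)
    case less
    show ?case
    proof (cases "p dvd f0 \<and> p dvd g0")
      case True
      then obtain f1 g1 where fg: "f0 = p * f1" "g0 = p * g1" by (auto elim!: dvdE)
      have "p \<noteq> 0" using p(1) by auto
      then have "g1 \<noteq> 0" "x = to_fract f1 / to_fract g1" "degree g1 < degree g0"
        using fg less.prems p(1) by (auto simp: degree_mult_eq)
      then show ?thesis using less.hyps by blast
    qed (use less.prems in blast)
  qed
  then obtain f g where fg: "g \<noteq> 0" "x = to_fract f / to_fract g" "\<not> (p dvd f \<and> p dvd g)" by blast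
  show "x \<in> localization (poly_ring D) Q \<or> 1 / x \<in> localization (poly_ring D) Q"
  proof (cases "p dvd g")
    case True
    then have "f \<notin> extended_upper Q" using fg(3) p(2) by blast
    then show ?thesis using upper_localizationI[of f g] fg(2) by simp
  next
    case False
    then show ?thesis using upper_localizationI[of g f] fg(2) p(2) by simp
  qed
qed

end

subsection \<open>The equivalences\<close>

text \<open>Extension to D[X] preserves \<open>t\<close>-primes and inclusions and keeps
  \<open>t\<close>-maximal ideals distinct, so the uniqueness assumed in D[X] descends to
  \<open>D\<close>.\<close>

lemma weakly_Matlis_independent:
  assumes W: "weakly_Matlis (poly_ring D)"
    and MN: "M \<in> t_Max D" "N \<in> t_Max D" "M \<noteq> N" and P: "t_prime D P" "P \<subseteq> M" "P \<subseteq> N"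
  shows False
proof -
  have sM: "is_submodule D L" if "L \<in> t_Max D" for L by (rule is_primeD(1)[OF t_MaxD(5)[OF that]])
  have P': "is_prime D P" "t_ideal D P" using P(1) by (auto simp: t_prime_def)
  have "t_prime (poly_ring D) (poly_ring P)"
    unfolding t_prime_def using is_prime_poly_ring[OF P'(1) t_ideal_nz[OF P'(2)]] t_ideal_poly_ring[OF P'(2)] by simp
  then have "\<exists>!Q. Q \<in> t_Max (poly_ring D) \<and> poly_ring P \<subseteq> Q" using W by (simp add: weakly_Matlis_def)
  then have "poly_ring M = poly_ring N"
    using t_Max_poly_ring[OF MN(1)] t_Max_poly_ring[OF MN(2)] poly_ring_mono[OF P(2)] poly_ring_mono[OF P(3)] by blast
  then show False
    using poly_ring_subset_iff[OF sM sM] MN by (metis order_refl subset_antisym)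
qed

context
  assumes tfc: "t_finite_character (poly_ring D)"
    and reg: "\<And>M. M \<in> t_Max D \<Longrightarrow> Clifford_regular (Nagata_ring (localization D M))"
    and ic_or_Matlis: "integrally_closed D \<or> weakly_Matlis (poly_ring D)"
begin

lemma Clifford_regular_localization_t_Max:
  assumes M: "M \<in> t_Max D"
  shows "Clifford_regular (localization D M)"
proof -
  interpret L: polynomial_domain "localization D M"
    by unfold_locales (rule fraction_field_localization[OF t_MaxD(5)[OF M]])
  show ?thesis by (rule L.Clifford_regular_if_Nagata_ring[OF reg[OF M]])
qed

lemma valuation_ring_localization_t_Max:
  "integrally_closed D \<Longrightarrow> M \<in> t_Max D \<Longrightarrow> valuation_ring (localization D M)"
  by (rule valuation_ring_localization_if_Clifford_regular[OF _ t_MaxD(5) Clifford_regular_localization_t_Max])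

lemma Clifford_w_regular_ring: "Clifford_w_regular D"
proof (rule Clifford_w_regular_if_locally[OF t_finite_character_if_poly_ring[OF tfc] Clifford_regular_localization_t_Max])
  fix I M N y
  assume I: "I \<in> nz_ideals D" and MN: "M \<in> t_Max D" "N \<in> t_Max D" "M \<noteq> N" and y: "y \<in> loc_colon M I"
  note primes = t_MaxD(5)[OF MN(1)] t_MaxD(5)[OF MN(2)]
  from ic_or_Matlis show "\<exists>s\<in>D - M. s * y \<in> loc_colon N I"
  proof
    assume "integrally_closed D"
    then have "valuation_ring (localization D N)" using MN(2) by (rule valuation_ring_localization_t_Max)
    then show ?thesis
      by (intro loc_colon_localize_valuation[OF I primes _ y]) (simp add: valuation_ring_def)
  next
    assume "weakly_Matlis (poly_ring D)"
    then show ?thesis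
      using weakly_Matlis_independent MN by (intro loc_colon_localize_independent[OF I primes]) blast
  qed
qed

text \<open>The extended \<open>t\<close>-maximal ideals have local ring D_M(X), controlled by
  \<open>reg\<close>; at uppers to zero the local ring is regular and a valuation ring without
  further assumptions.\<close>

lemma Clifford_w_regular_poly_ring: "Clifford_w_regular (poly_ring D)"
proof (rule PX.Clifford_w_regular_if_locally[OF tfc])
  have ext: "localization (poly_ring D) (poly_ring M) = Nagata_ring (localization D M)" if "M \<in> t_Max D" for M
    using localization_poly_ring_eq_Nagata[OF t_MaxD(5) PX.t_MaxD(5)[OF t_Max_poly_ring]] that by blast
  show "Clifford_regular (localization (poly_ring D) Q)" if "Q \<in> t_Max (poly_ring D)" for Q
    using that
  proof (cases rule: t_Max_poly_ring_cases)
    case (extended M)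
    then show ?thesis using reg ext by simp
  qed (rule Clifford_regular_localization_upper)
  have val: "valuation_ring (localization (poly_ring D) Q)"
    if ic: "integrally_closed D" and "Q \<in> t_Max (poly_ring D)" for Q
    using that(2)
  proof (cases rule: t_Max_poly_ring_cases)
    case (extended M)
    interpret L: polynomial_domain "localization D M"
      by unfold_locales (rule fraction_field_localization[OF t_MaxD(5)[OF extended(1)]])
    show ?thesis
      using L.valuation_ring_Nagata_ring[OF valuation_ring_localization_t_Max[OF ic extended(1)]]
      unfolding extended(2) ext[OF extended(1)] .
  qed (rule valuation_ring_localization_upper)
  fix I M N y
  assume I: "I \<in> nz_ideals (poly_ring D)"
    and MN: "M \<in> t_Max (poly_ring D)" "N \<in> t_Max (poly_ring D)" "M \<noteq> N" and y: "y \<in> PX.loc_colon M I"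
  note primes = PX.t_MaxD(5)[OF MN(1)] PX.t_MaxD(5)[OF MN(2)]
  from ic_or_Matlis show "\<exists>s\<in>poly_ring D - M. s * y \<in> PX.loc_colon N I"
  proof
    assume "integrally_closed D"
    then have "valuation_ring (localization (poly_ring D) N)" using MN(2) by (rule val)
    then show ?thesis
      by (intro PX.loc_colon_localize_valuation[OF I primes _ y]) (simp add: valuation_ring_def)
  next
    assume W: "weakly_Matlis (poly_ring D)"
    show ?thesis
    proof (rule PX.loc_colon_localize_independent[OF I primes])
      fix P assume "t_prime (poly_ring D) P" "P \<subseteq> M" "P \<subseteq> N"
      then show False using W MN unfolding weakly_Matlis_def by blast
    qed
  qed
qed

end

end

theorem proposition3p16:
  fixes D :: "'k::field set"
  assumes "domain_with_fraction_field D" and "\<not> subfield D"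
  shows
    "let cond1 = Clifford_w_regular (poly_ring D);
         cond2 = Clifford_regular (Na_v D);
         cond3 = (t_finite_character (poly_ring D) \<and>
                  (\<forall>M\<in>t_Max D. Clifford_regular (Nagata_ring (localization D M))))
     in (cond1 \<longrightarrow> cond2) \<and> (cond2 \<longrightarrow> cond3) \<and>
        (integrally_closed D \<or> weakly_Matlis (poly_ring D) \<longrightarrow>
           (cond3 \<longrightarrow> cond1) \<and> (cond3 \<longrightarrow> Clifford_w_regular D))"
proof -
  interpret polynomial_domain D by unfold_locales (rule assms(1))
  show ?thesis
    unfolding Let_def
    using Clifford_regular_Na_v_if_w_regular Clifford_regular_localized_Nagata_ring
      t_finite_character_poly_ring[OF t_finite_character_if_Na_v]
      Clifford_w_regular_poly_ring Clifford_w_regular_ring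
    by blast
qed

end
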